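(* Let $\omega\in(0,1)$ be fixed, let $\mathbf a=\{a_k\}_{k\ge1}$ and $\mathbf b=\{b_k\}_{k\ge1}$ be real sequences with $0<a_1\le a_2\le\dots\le a_k\le\dots$, $b_k>0$ for all $k$, and $b_*:=\inf_{k\ge1}b_k>0$. Consider the approximation problem $\mathrm{APP}=\{\mathrm{APP}_d\}_{d\in\mathbb N}$ in the worst case setting, where $\mathrm{APP}_d:H(K_{d,\mathbf a,\mathbf b})\to L_2([0,1]^d)$, $\mathrm{APP}_d f=f$, is the embedding of the analytic Korobov space. Then: (i) For every $t$ with $0<t<1$: EC-$(1,t)$-WT holds for $\mathrm{APP}$ if and only if $$\lim_{j\to\infty}\frac{\ln j}{a_j}=0.$$ (ii) For every $s$ with $0<s<1$ and every $t$ with $0<t\le 1$: EC-$(s,t)$-WT holds for $\mathrm{APP}$ if and only if $$\lim_{j\to\infty}\frac{j^{(1-s)/s}}{a_j}=0.$$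
   Context: $\mathbb N=\{1,2,\dots\}$. Analytic Korobov kernel: for $\mathbf h=(h_1,\dots,h_d)\in\mathbb Z^d$ put $\omega_{\mathbf h}=\omega^{\sum_{k=1}^d a_k|h_k|^{b_k}}$ (with $|0|^{b_k}=0$), and $$K_{d,\mathbf a,\mathbf b}(\mathbf x,\mathbf y)=\sum_{\mathbf h\in\mathbb Z^d}\omega_{\mathbf h}\exp(2\pi i\,\mathbf h\cdot(\mathbf x-\mathbf y)),\qquad \mathbf x,\mathbf y\in[0,1]^d,$$ where $\mathbf x\cdot\mathbf y=\sum_{k=1}^d x_ky_k$ and $i=\sqrt{-1}$. Equivalently $K_{d,\mathbf a,\mathbf b}(\mathbf x,\mathbf y)=\prod_{k=1}^dK_{1,a_k,b_k}(x_k,y_k)$ with $K_{1,a,b}(x,y)=\sum_{h\in\mathbb Z}\omega^{a|h|^b}\exp(2\pi i h(x-y))$. This kernel is real-valued. $H(K_{d,\mathbf a,\mathbf b})$ is the (real) reproducing kernel Hilbert space with reproducing kernel $K_{d,\mathbf a,\mathbf b}$. Algorithms and worst case errors: for $n\ge1$, an algorithm is a map of the form $A_{n,d}f=\phi_{n,d}(L_1(f),\dots,L_n(f))$, where $L_1,\dots,L_n$ are continuous linear functionals on $H(K_{d,\mathbf a,\mathbf b})$ and $\phi_{n,d}:\mathbb R^n\to L_2([0,1]^d)$ is an arbitrary measurable mapping; for $n=0$, $A_{0,d}=0$. The worst case error is $$e^{\rm wor}(A_{n,d})=\sup_{\|f\|_{H(K_{d,\mathbf a,\mathbf b})}\le1}\|\mathrm{APP}_df-A_{n,d}f\|_{L_2([0,1]^d)},$$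 and, for $n\ge1$, $e^{\rm wor}(n,d)=\inf_{A_{n,d}}e^{\rm wor}(A_{n,d})$, the infimum being over all algorithms of the form $A_{n,d}f=\phi_{n,d}(L_1(f),\dots,L_n(f))$ with $L_1,\dots,L_n$ continuous linear functionals on $H(K_{d,\mathbf a,\mathbf b})$ and $\phi_{n,d}:\mathbb R^n\to L_2([0,1]^d)$ measurable; $e^{\rm wor}(0,d)=e^{\rm wor}(A_{0,d})$ is the initial error, which equals $1$, so the absolute and normalized error criteria coincide. The information complexity, for $\varepsilon\in(0,1)$ and $d\in\mathbb N$, is $$n(\varepsilon,d)=\min\{n\ge 0:\ e^{\rm wor}(n,d)\le\varepsilon\}.$$ EC-$(s,t)$-WT (exponential convergent $(s,t)$-weak tractability), for $s,t>0$, means $$\lim_{\varepsilon^{-1}+d\to\infty}\frac{\ln n(\varepsilon,d)}{(\ln\varepsilon^{-1})^s+d^t}=0,$$ where the limit is over pairs $(\varepsilon,d)\in(0,1)\times\mathbb N$. *)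

theory Defs
  imports "HOL-Analysis.Analysis"
begin

section \<open>Real reproducing kernel Hilbert spaces\<close>

text \<open>
  A Hilbert space of real functions on a set \<open>X\<close> is given by its carrier \<open>H\<close> and its inner
  product \<open>ip\<close>.  A function on \<open>X\<close> is represented by its extension by \<open>0\<close> to the whole type, so
  that functions that agree on \<open>X\<close> are equal.  Values of \<open>ip\<close> outside \<open>H\<close> are irrelevant; the
  case distinction in \<open>hdist\<close> only serves to meet the totality requirements of the library's
  locale \<open>Metric_space\<close>.
\<close>

definition hnorm :: "(('a \<Rightarrow> real) \<Rightarrow> ('a \<Rightarrow> real) \<Rightarrow> real) \<Rightarrow> ('a \<Rightarrow> real) \<Rightarrow> real" where
  "hnorm ip f = sqrt (ip f f)"

definition hdist ::
  "('a \<Rightarrow> real) set \<Rightarrow> (('a \<Rightarrow> real) \<Rightarrow> ('a \<Rightarrow> real) \<Rightarrow> real) \<Rightarrow> ('a \<Rightarrow> real) \<Rightarrow> ('a \<Rightarrow> real) \<Rightarrow> real" where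
  "hdist H ip f g = (if f \<in> H \<and> g \<in> H then hnorm ip (\<lambda>x. f x - g x) else 0)"

locale function_hilbert_space =
  fixes X :: "'a set"
    and H :: "('a \<Rightarrow> real) set"
    and ip :: "('a \<Rightarrow> real) \<Rightarrow> ('a \<Rightarrow> real) \<Rightarrow> real"
  assumes zero_outside: "f \<in> H \<Longrightarrow> x \<notin> X \<Longrightarrow> f x = 0"
    and zero_closed: "(\<lambda>x. 0) \<in> H"
    and add_closed: "f \<in> H \<Longrightarrow> g \<in> H \<Longrightarrow> (\<lambda>x. f x + g x) \<in> H"
    and scale_closed: "f \<in> H \<Longrightarrow> (\<lambda>x. c * f x) \<in> H"
    and ip_commute: "f \<in> H \<Longrightarrow> g \<in> H \<Longrightarrow> ip f g = ip g f"
    and ip_add_left: "f \<in> H \<Longrightarrow> g \<in> H \<Longrightarrow> h \<in> H \<Longrightarrow> ip (\<lambda>x. f x + g x) h = ip f h + ip g h"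
    and ip_scale_left: "f \<in> H \<Longrightarrow> g \<in> H \<Longrightarrow> ip (\<lambda>x. c * f x) g = c * ip f g"
    and ip_nonneg: "f \<in> H \<Longrightarrow> 0 \<le> ip f f"
    and ip_definite: "f \<in> H \<Longrightarrow> ip f f = 0 \<Longrightarrow> f = (\<lambda>x. 0)"
    and complete: "Metric_space.mcomplete H (hdist H ip)"

context function_hilbert_space
begin

lemma diff_closed: "f \<in> H \<Longrightarrow> g \<in> H \<Longrightarrow> (\<lambda>x. f x - g x) \<in> H"
  using add_closed[of f "\<lambda>x. -1 * g x"] scale_closed[of g "-1"] by simp

lemma ip_quadratic:
  assumes "f \<in> H" "g \<in> H"
  shows "ip (\<lambda>x. f x + c * g x) (\<lambda>x. f x + c * g x) = ip f f + 2 * c * ip f g + c\<^sup>2 * ip g g"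
proof -
  define u where "u = (\<lambda>x. c * g x)"
  have u: "u \<in> H" "(\<lambda>x. f x + u x) \<in> H"
    using assms scale_closed add_closed by (auto simp: u_def)
  have left: "ip u v = c * ip g v" if "v \<in> H" for v
    using ip_scale_left[of g v c] assms that by (simp add: u_def)
  have "ip (\<lambda>x. f x + u x) (\<lambda>x. f x + u x) = ip f (\<lambda>x. f x + u x) + ip u (\<lambda>x. f x + u x)"
    using assms u by (intro ip_add_left) auto
  also have "ip f (\<lambda>x. f x + u x) = ip f f + ip u f"
    using assms u ip_commute[of f "\<lambda>x. f x + u x"] ip_add_left[of f u f] by simp
  also have "ip u (\<lambda>x. f x + u x) = ip f u + ip u u"
    using assms u ip_commute[of u "\<lambda>x. f x + u x"] ip_add_left[of f u u] by simp
  also have "ip f u = ip u f"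
    using assms u ip_commute by blast
  also have "ip u f = c * ip f g"
    using left[of f] assms ip_commute by simp
  also have "ip u u = c\<^sup>2 * ip g g"
    using left[of u] left[of g] assms u ip_commute[of g u] by (simp add: power2_eq_square)
  finally show ?thesis
    by (simp add: u_def algebra_simps)
qed

lemma Cauchy_Schwarz:
  assumes "f \<in> H" "g \<in> H"
  shows "(ip f g)\<^sup>2 \<le> ip f f * ip g g"
proof (cases "ip g g = 0")
  case True
  then have "g = (\<lambda>x. 0)"
    using assms ip_definite by blast
  then have "ip f g = 0"
    using ip_scale_left[of g f 0] ip_commute[of f g] assms by simp
  then show ?thesis
    using True by simp
next
  case False
  then have pos: "ip g g > 0"
    using ip_nonneg[of g] assms by linarith
  define c where "c = - ip f g / ip g g"
  have "0 \<le> ip f f + 2 * c * ip f g + c\<^sup>2 * ip g g"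
    using ip_nonneg[of "\<lambda>x. f x + c * g x"] ip_quadratic[of f g c] assms
      add_closed scale_closed by simp
  also have "\<dots> = ip f f - (ip f g)\<^sup>2 / ip g g"
    using pos by (simp add: c_def field_simps power2_eq_square)
  finally show ?thesis
    using pos by (simp add: field_simps)
qed

lemma hnorm_add_le:
  assumes "f \<in> H" "g \<in> H"
  shows "hnorm ip (\<lambda>x. f x + g x) \<le> hnorm ip f + hnorm ip g"
proof -
  have "ip f g \<le> sqrt (ip f f) * sqrt (ip g g)"
    using real_le_rsqrt[OF Cauchy_Schwarz[OF assms]] by (simp add: real_sqrt_mult)
  then have "ip (\<lambda>x. f x + g x) (\<lambda>x. f x + g x) \<le> (hnorm ip f + hnorm ip g)\<^sup>2"
    using ip_quadratic[of f g 1] assms ip_nonneg by (simp add: hnorm_def power2_sum)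
  then show ?thesis
    using assms ip_nonneg by (auto simp: hnorm_def intro: real_le_lsqrt)
qed

sublocale Metric_space H "hdist H ip"
proof
  fix f g :: "'a \<Rightarrow> real"
  show "0 \<le> hdist H ip f g"
    using ip_nonneg diff_closed by (simp add: hdist_def hnorm_def)
  have sym: "ip (\<lambda>x. f x - g x) (\<lambda>x. f x - g x) = ip (\<lambda>x. g x - f x) (\<lambda>x. g x - f x)"
    if "f \<in> H" "g \<in> H"
    using ip_quadratic[of "\<lambda>x. 0" "\<lambda>x. f x - g x" "-1"] ip_scale_left[of "\<lambda>x. 0" "\<lambda>x. 0" 0]
      ip_scale_left[of "\<lambda>x. 0" "\<lambda>x. f x - g x" 0] that diff_closed zero_closed by simp
  then show "hdist H ip f g = hdist H ip g f"
    by (auto simp: hdist_def hnorm_def)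
  have zero: "ip (\<lambda>x. 0) (\<lambda>x. 0) = 0"
    using ip_scale_left[of "\<lambda>x. 0" "\<lambda>x. 0" 0] zero_closed by simp
  show "hdist H ip f g = 0 \<longleftrightarrow> f = g" if "f \<in> H" "g \<in> H"
  proof
    assume "hdist H ip f g = 0"
    then have "ip (\<lambda>x. f x - g x) (\<lambda>x. f x - g x) = 0"
      using that by (simp add: hdist_def hnorm_def)
    from ip_definite[OF diff_closed[OF that] this] have "f x - g x = 0" for x
      by metis
    then show "f = g"
      by auto
  qed (simp add: hdist_def hnorm_def zero)
  fix h :: "'a \<Rightarrow> real"
  show "hdist H ip f h \<le> hdist H ip f g + hdist H ip g h" if "f \<in> H" "g \<in> H" "h \<in> H"
    using hnorm_add_le[of "\<lambda>x. f x - g x" "\<lambda>x. g x - h x"] that diff_closed by (simp add: hdist_def)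
qed

end

text \<open>
  By the Moore--Aronszajn theorem a symmetric positive semidefinite kernel on \<open>X\<close> determines
  \<open>H\<close>, and \<open>ip\<close> on \<open>H\<close>, uniquely.
\<close>

locale rkhs = function_hilbert_space X H ip
  for X :: "'a set"
    and K :: "'a \<Rightarrow> 'a \<Rightarrow> real"
    and H :: "('a \<Rightarrow> real) set"
    and ip :: "('a \<Rightarrow> real) \<Rightarrow> ('a \<Rightarrow> real) \<Rightarrow> real" +
  assumes kernel_in: "y \<in> X \<Longrightarrow> (\<lambda>x. if x \<in> X then K x y else 0) \<in> H"
    and reproducing: "f \<in> H \<Longrightarrow> y \<in> X \<Longrightarrow> ip f (\<lambda>x. if x \<in> X then K x y else 0) = f y"

definition continuous_linear_functional ::
  "('a \<Rightarrow> real) set \<Rightarrow> (('a \<Rightarrow> real) \<Rightarrow> ('a \<Rightarrow> real) \<Rightarrow> real) \<Rightarrow> (('a \<Rightarrow> real) \<Rightarrow> real) \<Rightarrow> bool" where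
  "continuous_linear_functional H ip L \<longleftrightarrow>
     (\<forall>f\<in>H. \<forall>g\<in>H. L (\<lambda>x. f x + g x) = L f + L g) \<and>
     (\<forall>c. \<forall>f\<in>H. L (\<lambda>x. c * f x) = c * L f) \<and>
     continuous_map (Metric_space.mtopology H (hdist H ip)) euclideanreal L"


section \<open>The analytic Korobov kernel on the unit cube\<close>

text \<open>
  Points of the \<open>d\<close>-dimensional cube are functions on the index set \<open>{1..d}\<close> (arbitrary but fixed
  elsewhere), and multi-indices in the \<open>d\<close>-fold power of the integers are represented likewise.
\<close>

definition unit_cube :: "nat \<Rightarrow> (nat \<Rightarrow> real) set" where
  "unit_cube d = ({1..d} \<rightarrow>\<^sub>E {0..1})"

definition korobov_weight ::
  "real \<Rightarrow> (nat \<Rightarrow> real) \<Rightarrow> (nat \<Rightarrow> real) \<Rightarrow> nat \<Rightarrow> (nat \<Rightarrow> int) \<Rightarrow> real" where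
  "korobov_weight \<omega> a b d h = \<omega> powr (\<Sum>k=1..d. a k * real_of_int \<bar>h k\<bar> powr b k)"

text \<open>The sum below is a real number; \<^const>\<open>Re\<close> only converts its type.\<close>

definition korobov_kernel ::
  "real \<Rightarrow> (nat \<Rightarrow> real) \<Rightarrow> (nat \<Rightarrow> real) \<Rightarrow> nat \<Rightarrow> (nat \<Rightarrow> real) \<Rightarrow> (nat \<Rightarrow> real) \<Rightarrow> real" where
  "korobov_kernel \<omega> a b d x y =
     Re (\<Sum>\<^sub>\<infinity>h\<in>({1..d} \<rightarrow>\<^sub>E (UNIV :: int set)).
           complex_of_real (korobov_weight \<omega> a b d h) *
           exp (2 * complex_of_real pi * \<i> *
             complex_of_real (\<Sum>k=1..d. real_of_int (h k) * (x k - y k))))"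


section \<open>Square integrable functions\<close>

text \<open>
  Elements of \<open>L\<^sub>2\<close> are represented by square integrable functions, without passing to the quotient
  modulo equality almost everywhere.  The open sets of the \<open>L\<^sub>2\<close> seminorm are closed under almost
  everywhere equality, hence they generate exactly the pullback of the Borel sigma algebra of the
  quotient, and measurability of a map into \<open>L\<^sub>2\<close> does not depend on the choice of representatives.
\<close>

definition cube_measure :: "nat \<Rightarrow> (nat \<Rightarrow> real) measure" where
  "cube_measure d = (\<Pi>\<^sub>M k\<in>{1..d}. restrict_space lborel {0..1})"

definition L2_space :: "'a measure \<Rightarrow> ('a \<Rightarrow> real) set" where
  "L2_space M = {g \<in> borel_measurable M. integrable M (\<lambda>x. (g x)\<^sup>2)}"

definition L2_norm :: "'a measure \<Rightarrow> ('a \<Rightarrow> real) \<Rightarrow> real" where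
  "L2_norm M g = sqrt (\<integral>x. (g x)\<^sup>2 \<partial>M)"

definition L2_open :: "'a measure \<Rightarrow> ('a \<Rightarrow> real) set \<Rightarrow> bool" where
  "L2_open M U \<longleftrightarrow> U \<subseteq> L2_space M \<and>
     (\<forall>f\<in>U. \<exists>r>0. \<forall>g\<in>L2_space M. L2_norm M (\<lambda>x. g x - f x) < r \<longrightarrow> g \<in> U)"

definition L2_borel :: "'a measure \<Rightarrow> ('a \<Rightarrow> real) measure" where
  "L2_borel M = sigma (L2_space M) {U. L2_open M U}"


section \<open>Algorithms, worst case errors and information complexity\<close>

definition algorithms ::
  "'a measure \<Rightarrow> ('a \<Rightarrow> real) set \<Rightarrow> (('a \<Rightarrow> real) \<Rightarrow> ('a \<Rightarrow> real) \<Rightarrow> real) \<Rightarrow> nat \<Rightarrow>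
   (('a \<Rightarrow> real) \<Rightarrow> ('a \<Rightarrow> real)) set" where
  "algorithms M H ip n =
     (if n = 0 then {\<lambda>f x. 0}
      else {\<lambda>f. \<phi> (\<lambda>i\<in>{1..n}. L i f) | \<phi> L.
              (\<forall>i\<in>{1..n}. continuous_linear_functional H ip (L i)) \<and>
              \<phi> \<in> measurable (\<Pi>\<^sub>M i\<in>{1..n}. (borel :: real measure)) (L2_borel M)})"

definition worst_case_error ::
  "'a measure \<Rightarrow> ('a \<Rightarrow> real) set \<Rightarrow> (('a \<Rightarrow> real) \<Rightarrow> ('a \<Rightarrow> real) \<Rightarrow> real) \<Rightarrow>
   (('a \<Rightarrow> real) \<Rightarrow> ('a \<Rightarrow> real)) \<Rightarrow> ennreal" where
  "worst_case_error M H ip A =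
     (SUP f\<in>{f \<in> H. hnorm ip f \<le> 1}. ennreal (L2_norm M (\<lambda>x. f x - A f x)))"

definition minimal_error ::
  "'a measure \<Rightarrow> ('a \<Rightarrow> real) set \<Rightarrow> (('a \<Rightarrow> real) \<Rightarrow> ('a \<Rightarrow> real) \<Rightarrow> real) \<Rightarrow> nat \<Rightarrow> ennreal" where
  "minimal_error M H ip n = (INF A\<in>algorithms M H ip n. worst_case_error M H ip A)"

definition information_complexity ::
  "'a measure \<Rightarrow> ('a \<Rightarrow> real) set \<Rightarrow> (('a \<Rightarrow> real) \<Rightarrow> ('a \<Rightarrow> real) \<Rightarrow> real) \<Rightarrow> real \<Rightarrow> nat" where
  "information_complexity M H ip \<epsilon> = (LEAST n. minimal_error M H ip n \<le> ennreal \<epsilon>)"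


section \<open>Exponential convergent weak tractability\<close>

definition eps_dim_at_top :: "(real \<times> nat) filter" where
  "eps_dim_at_top =
     inf (filtercomap (\<lambda>(\<epsilon>, d). 1 / \<epsilon> + real d) at_top) (principal ({0<..<1} \<times> {1..}))"

definition EC_WT :: "(real \<Rightarrow> nat \<Rightarrow> nat) \<Rightarrow> real \<Rightarrow> real \<Rightarrow> bool" where
  "EC_WT n s t \<longleftrightarrow>
     ((\<lambda>(\<epsilon>, d). ln (real (n \<epsilon> d)) / (ln (1 / \<epsilon>) powr s + real d powr t)) \<longlongrightarrow> 0) eps_dim_at_top"

end

theory Submission
  imports Defs
begin

text \<open>
  The proof has two halves: the information complexity is the number of eigenvalues above
  \<open>\<epsilon>\<^sup>2\<close>, and this number is estimated by counting integer points.

  \<^bold>\<open>Spectral half.\<close>  With \<open>cas t = cos t + sin t\<close>, the functions \<open>cas (2 * pi * h \<bullet> x)\<close>, indexed by all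
  multi-indices \<open>h\<close>, form a real orthonormal system in \<open>L\<^sub>2\<close> of the cube.  Since the weights are even
  in \<open>h\<close>, the Korobov kernel is \<open>\<Sum>h. \<omega>\<^sub>h * cas\<^sub>h x * cas\<^sub>h y\<close>, so a real space needs no pairing of \<open>h\<close>
  with \<open>- h\<close>.  The Hilbert space is only known through its reproducing property; to see that it contains
  \<open>cas\<^sub>h\<close>, average \<open>cas\<^sub>h y * K(\<cdot>, y)\<close> over finer and finer grids.  The averages converge in norm, and
  their limit is \<open>\<omega>\<^sub>h * cas\<^sub>h\<close> (\<open>eigenfunction_in_space\<close>).  Consequently \<open>sqrt \<omega>\<^sub>h * cas\<^sub>h\<close> is an
  orthonormal basis of the space.  Truncating the expansion in this basis to the indices with
  \<open>\<omega>\<^sub>h > \<epsilon>\<^sup>2\<close> is an algorithm of error at most \<open>\<epsilon>\<close> (\<open>minimal_error_le\<close>).  With fewer functionals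
  some unit vector \<open>f\<close> in the span of these basis functions has zero information; no algorithm
  distinguishes \<open>f\<close> from \<open>- f\<close>, and \<open>f\<close> has \<open>L\<^sub>2\<close> norm above \<open>\<epsilon>\<close> (\<open>minimal_error_ge\<close>).

  \<^bold>\<open>Counting half.\<close>  The complexity is therefore the number \<open>N\<close> of \<open>h\<close> with
  \<open>\<Sum>k. a\<^sub>k * \<bar>h\<^sub>k\<bar> powr b\<^sub>k < R\<close>, where \<open>R\<close> is a fixed multiple of \<open>ln (1 / \<epsilon>)\<close>.  For every
  \<open>\<tau> > 0\<close>, bounding the indicator of this set by \<open>exp (\<tau> * (R - \<dots>))\<close> gives
  \<open>ln N \<le> \<tau> * R + (\<Sum>k. ln (1 + 2 * G (\<tau> * a\<^sub>k)))\<close> with \<open>G \<theta> = (\<Sum>n\<ge>1. exp (- \<theta> * n powr \<beta>))\<close>.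
  If \<open>ln j / a\<^sub>j\<close> tends to \<open>0\<close>, the sum over \<open>k\<close> is bounded for each fixed \<open>\<tau>\<close>.  If
  \<open>j powr ((1 - s) / s) / a\<^sub>j\<close> tends to \<open>0\<close>, the choice \<open>\<tau> = \<zeta> * R powr (s - 1)\<close> with a small constant
  \<open>\<zeta>\<close> makes both terms at most a small multiple of \<open>R powr s\<close>.  Conversely, the indicators of subsets
  of \<open>{1..j}\<close> are among the counted points: all subsets once \<open>R > j * a\<^sub>j\<close>, and the subsets of size \<open>m\<close>
  once \<open>R > m * a\<^sub>j\<close>.  Weak tractability along \<open>d = j\<close> then forces the decay of the two quotients; for the
  logarithmic one \<open>m\<close> is a power of \<open>j\<close> with exponent strictly between \<open>t\<close> and \<open>1\<close>, which is where
  \<open>t < 1\<close> enters.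
\<close>

section \<open>Limits in a Hilbert space of functions\<close>

context function_hilbert_space
begin

lemma sum_closed:
  assumes "finite F" "\<And>i. i \<in> F \<Longrightarrow> u i \<in> H"
  shows "(\<lambda>x. \<Sum>i\<in>F. c i * u i x) \<in> H"
  using assms
proof (induction F)
  case empty
  then show ?case
    using zero_closed by simp
next
  case (insert j F)
  then show ?case
    using add_closed[OF scale_closed[of "u j" "c j"]] by simp
qed

lemma ip_zero_left: "f \<in> H \<Longrightarrow> ip (\<lambda>x. 0) f = 0"
  using ip_scale_left[of f f 0] by simp

lemma ip_sum_left:
  assumes "finite F" "\<And>i. i \<in> F \<Longrightarrow> u i \<in> H" "f \<in> H"
  shows "ip (\<lambda>x. \<Sum>i\<in>F. c i * u i x) f = (\<Sum>i\<in>F. c i * ip (u i) f)"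
  using assms
proof (induction F)
  case empty
  then show ?case
    by (simp add: ip_zero_left)
next
  case (insert j F)
  then have "ip (\<lambda>x. c j * u j x + (\<Sum>i\<in>F. c i * u i x)) f =
      ip (\<lambda>x. c j * u j x) f + ip (\<lambda>x. \<Sum>i\<in>F. c i * u i x) f"
    by (intro ip_add_left scale_closed sum_closed) auto
  with insert show ?case
    by (simp add: ip_scale_left)
qed

lemma ip_sum_right:
  assumes "finite F" "\<And>i. i \<in> F \<Longrightarrow> u i \<in> H" "f \<in> H"
  shows "ip f (\<lambda>x. \<Sum>i\<in>F. c i * u i x) = (\<Sum>i\<in>F. c i * ip f (u i))"
  using ip_sum_left[OF assms] assms ip_commute[OF _ sum_closed[of F u c]]
  by (simp add: ip_commute)

lemma ip_diff_left:
  assumes "f \<in> H" "g \<in> H" "h \<in> H"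
  shows "ip (\<lambda>x. f x - g x) h = ip f h - ip g h"
  using ip_add_left[OF assms(1) scale_closed[OF assms(2), of "-1"] assms(3)]
    ip_scale_left[OF assms(2,3), of "-1"] by simp

lemma ip_diff_right:
  assumes "f \<in> H" "g \<in> H" "h \<in> H"
  shows "ip h (\<lambda>x. f x - g x) = ip h f - ip h g"
  using ip_diff_left[OF assms] assms ip_commute[of h] diff_closed by simp

lemma ip_diff_self:
  assumes "f \<in> H" "g \<in> H"
  shows "ip (\<lambda>x. f x - g x) (\<lambda>x. f x - g x) = ip f f - 2 * ip f g + ip g g"
  using ip_quadratic[OF assms, of "-1"] by simp

lemma abs_ip_le:
  assumes "f \<in> H" "g \<in> H"
  shows "\<bar>ip f g\<bar> \<le> hnorm ip f * hnorm ip g"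
  using real_le_rsqrt[of "\<bar>ip f g\<bar>" "ip f f * ip g g"] Cauchy_Schwarz[OF assms]
  by (simp add: hnorm_def real_sqrt_mult)

lemma hnorm_nonneg: "f \<in> H \<Longrightarrow> 0 \<le> hnorm ip f"
  by (simp add: hnorm_def ip_nonneg)

lemma ip_le_one: "f \<in> H \<Longrightarrow> hnorm ip f \<le> 1 \<Longrightarrow> ip f f \<le> 1"
  by (simp add: hnorm_def)

lemma continuous_linear_functional_ip:
  assumes "g \<in> H"
  shows "continuous_linear_functional H ip (\<lambda>f. ip f g)"
  unfolding continuous_linear_functional_def
proof (intro conjI ballI allI)
  have "continuous_map mtopology (Met_TC.mtopology :: real topology) (\<lambda>f. ip f g)"
    unfolding metric_continuous_map[OF Met_TC.Metric_space_axioms]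
  proof (intro conjI ballI allI impI)
    fix f and \<epsilon> :: real
    assume f: "f \<in> H" and \<epsilon>: "\<epsilon> > 0"
    have N: "0 \<le> hnorm ip g"
      using hnorm_nonneg assms by blast
    show "\<exists>\<delta>>0. \<forall>x. x \<in> H \<and> hdist H ip f x < \<delta> \<longrightarrow> dist (ip f g) (ip x g) < \<epsilon>"
    proof (intro exI[of _ "\<epsilon> / (1 + hnorm ip g)"] conjI allI impI)
      show "0 < \<epsilon> / (1 + hnorm ip g)"
        using \<epsilon> N by simp
      fix x
      assume x: "x \<in> H \<and> hdist H ip f x < \<epsilon> / (1 + hnorm ip g)"
      have "dist (ip f g) (ip x g) = \<bar>ip (\<lambda>y. f y - x y) g\<bar>"
        using ip_diff_left f x assms by (simp add: dist_real_def)
      also have "\<dots> \<le> hdist H ip f x * hnorm ip g"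
        using abs_ip_le[OF diff_closed assms] f x by (simp add: hdist_def)
      also have "\<dots> \<le> hdist H ip f x * (1 + hnorm ip g)"
        by (intro mult_left_mono) auto
      also have "\<dots> < \<epsilon>"
        using x N by (simp add: field_simps)
      finally show "dist (ip f g) (ip x g) < \<epsilon>" .
    qed
  qed simp
  then show "continuous_map mtopology euclideanreal (\<lambda>f. ip f g)"
    by simp
qed (use assms in \<open>simp_all add: ip_add_left ip_scale_left\<close>)

end

context rkhs
begin

abbreviation kernel_at :: "'a \<Rightarrow> 'a \<Rightarrow> real" where
  "kernel_at y \<equiv> (\<lambda>x. if x \<in> X then K x y else 0)"

text \<open>
  Norm convergence implies pointwise convergence because evaluation at \<open>x\<close> is the inner product with
  \<open>kernel_at x\<close>.  Hence the limit supplied by completeness must be the pointwise limit \<open>v\<close>, and this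
  shows that a concretely given function belongs to the abstract space.
\<close>

lemma cauchy_sequence_limit:
  assumes u: "\<And>m. u m \<in> H"
    and cauchy: "\<And>m n. ip (\<lambda>x. u m x - u n x) (\<lambda>x. u m x - u n x) \<le> D m + D n" "D \<longlonglongrightarrow> 0"
    and v: "\<And>x. x \<in> X \<Longrightarrow> (\<lambda>m. u m x) \<longlonglongrightarrow> v x" "\<And>x. x \<notin> X \<Longrightarrow> v x = 0"
  shows "v \<in> H" "\<And>f. f \<in> H \<Longrightarrow> (\<lambda>m. ip f (u m)) \<longlonglongrightarrow> ip f v"
proof -
  have "MCauchy u"
    unfolding MCauchy_def
  proof (intro conjI allI impI)
    fix \<epsilon> :: real
    assume "\<epsilon> > 0"
    then have "\<epsilon>\<^sup>2 / 2 > 0" by simp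
    from LIMSEQ_D[OF cauchy(2) this] obtain N where N: "\<And>n. n \<ge> N \<Longrightarrow> \<bar>D n\<bar> < \<epsilon>\<^sup>2 / 2"
      by auto
    have "hdist H ip (u m) (u n) < \<epsilon>" if "N \<le> m" "N \<le> n" for m n
    proof -
      have "ip (\<lambda>x. u m x - u n x) (\<lambda>x. u m x - u n x) < \<epsilon>\<^sup>2"
        using cauchy(1)[of m n] N[OF that(1)] N[OF that(2)] by linarith
      then show ?thesis
        using u \<open>\<epsilon> > 0\<close> by (simp add: hdist_def hnorm_def real_less_lsqrt)
    qed
    then show "\<exists>N. \<forall>n n'. N \<le> n \<longrightarrow> N \<le> n' \<longrightarrow> hdist H ip (u n) (u n') < \<epsilon>"
      by blast
  qed (use u in auto)
  then obtain l where l: "limitin mtopology u l sequentially"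
    using complete unfolding mcomplete_def by blast
  then have lH: "l \<in> H"
    using limitin_mspace by blast
  have "(\<lambda>m. hdist H ip (u m) l) \<longlonglongrightarrow> 0"
    unfolding LIMSEQ_iff using l nonneg unfolding limit_metric_sequentially by simp blast
  then have d0: "(\<lambda>m. hnorm ip f * hdist H ip (u m) l) \<longlonglongrightarrow> 0" for f
    using tendsto_mult_right_zero by blast
  have lim: "(\<lambda>m. ip f (u m)) \<longlonglongrightarrow> ip f l" if f: "f \<in> H" for f
  proof -
    have "norm (ip f (u m) - ip f l) \<le> hnorm ip f * hdist H ip (u m) l" for m
      using abs_ip_le[OF f diff_closed[OF u lH]] ip_diff_right[OF u lH f] u lH
      by (simp add: hdist_def)
    then have "(\<lambda>m. ip f (u m) - ip f l) \<longlonglongrightarrow> 0"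
      by (intro Lim_null_comparison[OF _ d0[of f]]) auto
    then show ?thesis
      by (simp add: LIM_zero_iff)
  qed
  have "l = v"
  proof
    fix x
    show "l x = v x"
    proof (cases "x \<in> X")
      case True
      then have "(\<lambda>m. u m x) \<longlonglongrightarrow> l x"
        using lim[OF kernel_in[OF True]] reproducing[OF _ True] u lH kernel_in[OF True]
        by (simp add: ip_commute)
      then show ?thesis
        using v(1)[OF True] LIMSEQ_unique by blast
    qed (use v zero_outside lH in simp)
  qed
  with lH lim show "v \<in> H" "\<And>f. f \<in> H \<Longrightarrow> (\<lambda>m. ip f (u m)) \<longlonglongrightarrow> ip f v"
    by auto
qed

end

section \<open>Weighted sums and underdetermined systems\<close>

lemma sum_infsum_swap:
  fixes f :: "'a \<Rightarrow> 'b \<Rightarrow> real"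
  assumes "finite A" "\<And>a. a \<in> A \<Longrightarrow> f a summable_on I"
  shows "(\<Sum>a\<in>A. \<Sum>\<^sub>\<infinity>i\<in>I. f a i) = (\<Sum>\<^sub>\<infinity>i\<in>I. \<Sum>a\<in>A. f a i)"
proof -
  have "((\<lambda>i. \<Sum>a\<in>A. f a i) has_sum (\<Sum>a\<in>A. \<Sum>\<^sub>\<infinity>i\<in>I. f a i)) I"
    using assms
  proof (induction A)
    case (insert a A)
    then have "((\<lambda>i. f a i + (\<Sum>a\<in>A. f a i)) has_sum
        ((\<Sum>\<^sub>\<infinity>i\<in>I. f a i) + (\<Sum>a\<in>A. \<Sum>\<^sub>\<infinity>i\<in>I. f a i))) I"
      by (intro has_sum_add) auto
    then show ?case
      using insert by simp
  qed simp
  then show ?thesis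
    by (simp add: infsumI)
qed

lemma summable_mult_bounded:
  fixes l t :: "'i \<Rightarrow> real"
  assumes "l summable_on I" "\<And>i. i \<in> I \<Longrightarrow> 0 \<le> l i" "\<And>i. i \<in> I \<Longrightarrow> \<bar>t i\<bar> \<le> C"
  shows "(\<lambda>i. l i * t i) summable_on I"
proof -
  have "(\<lambda>i. C * l i) summable_on I"
    using assms(1) by (rule summable_on_cmult_right)
  moreover have "norm (l i * t i) \<le> C * l i" if "i \<in> I" for i
    using mult_right_mono[OF assms(3)[OF that] assms(2)[OF that]] assms(2)[OF that]
    by (simp add: abs_mult mult.commute)
  ultimately have "(\<lambda>i. norm (l i * t i)) summable_on I"
    by (rule summable_on_comparison_test) auto
  then show ?thesis
    by (rule abs_summable_summable)
qed

lemma infsum_tail_less: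
  fixes l :: "'i \<Rightarrow> real"
  assumes "l summable_on I" "0 < r"
  obtains F where "finite F" "F \<subseteq> I" "(\<Sum>\<^sub>\<infinity>i\<in>I - F. l i) < r"
proof -
  obtain F where F: "finite F" "F \<subseteq> I" "dist (sum l F) (infsum l I) \<le> r / 2"
    using infsum_finite_approximation[OF assms(1), of "r / 2"] assms(2) by auto
  have "infsum l (I - F) = infsum l I - sum l F"
    using infsum_Diff[of l I F] assms(1) F by simp
  then have "infsum l (I - F) < r"
    using F(3) assms(2) unfolding dist_real_def by linarith
  with F show thesis
    using that by blast
qed

lemma abs_infsum_mult_le:
  fixes l t :: "'i \<Rightarrow> real"
  assumes "l summable_on I" "\<And>i. i \<in> I \<Longrightarrow> 0 \<le> l i" "\<And>i. i \<in> I \<Longrightarrow> \<bar>t i\<bar> \<le> C"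
  shows "\<bar>\<Sum>\<^sub>\<infinity>i\<in>I. l i * t i\<bar> \<le> C * (\<Sum>\<^sub>\<infinity>i\<in>I. l i)"
proof -
  have "norm (\<Sum>\<^sub>\<infinity>i\<in>I. l i * t i) \<le> (\<Sum>\<^sub>\<infinity>i\<in>I. C * l i)"
  proof (rule norm_infsum_le)
    show "((\<lambda>i. l i * t i) has_sum (\<Sum>\<^sub>\<infinity>i\<in>I. l i * t i)) I"
      using summable_mult_bounded[OF assms] by simp
    show "((\<lambda>i. C * l i) has_sum (\<Sum>\<^sub>\<infinity>i\<in>I. C * l i)) I"
      using assms(1) by (simp add: summable_on_cmult_right)
    show "norm (l i * t i) \<le> C * l i" if "i \<in> I" for i
      using mult_right_mono[OF assms(3)[OF that] assms(2)[OF that]] assms(2)[OF that]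
      by (simp add: abs_mult mult.commute)
  qed
  then show ?thesis
    by (simp add: infsum_cmult_right')
qed

text \<open>
  Dominated convergence for sums over an arbitrary index set, with \<open>C * l i\<close> as the dominating family.
\<close>

lemma infsum_mult_tendsto:
  fixes l :: "'i \<Rightarrow> real" and t :: "nat \<Rightarrow> 'i \<Rightarrow> real"
  assumes l: "l summable_on I" "\<And>i. i \<in> I \<Longrightarrow> 0 \<le> l i"
    and bound: "\<And>m i. i \<in> I \<Longrightarrow> \<bar>t m i\<bar> \<le> C"
    and lim: "\<And>i. i \<in> I \<Longrightarrow> (\<lambda>m. t m i) \<longlonglongrightarrow> t0 i"
  shows "(\<lambda>m. \<Sum>\<^sub>\<infinity>i\<in>I. l i * t m i) \<longlonglongrightarrow> (\<Sum>\<^sub>\<infinity>i\<in>I. l i * t0 i)"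
proof (rule LIMSEQ_I)
  fix r :: real
  assume "r > 0"
  define D where "D = \<bar>C\<bar> + 1"
  have D: "D > 0" "\<bar>t m i\<bar> \<le> D" "\<bar>t0 i\<bar> \<le> D" if "i \<in> I" for m i
  proof -
    show "D > 0" by (simp add: D_def add_nonneg_pos)
    have *: "\<bar>t m i\<bar> \<le> D" for m
      using bound[OF that, of m] by (simp add: D_def)
    then show "\<bar>t m i\<bar> \<le> D" .
    show "\<bar>t0 i\<bar> \<le> D"
      using LIMSEQ_le_const2[OF tendsto_rabs[OF lim[OF that]]] * by blast
  qed
  have "D > 0" by (simp add: D_def add_nonneg_pos)
  then have "r / (4 * D) > 0" using \<open>r > 0\<close> by simp
  from infsum_tail_less[OF l(1) this] obtain F
    where F: "finite F" "F \<subseteq> I" "(\<Sum>\<^sub>\<infinity>i\<in>I - F. l i) < r / (4 * D)" .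
  have "(\<lambda>m. \<Sum>i\<in>F. l i * t m i) \<longlonglongrightarrow> (\<Sum>i\<in>F. l i * t0 i)"
    using F lim by (intro tendsto_intros) auto
  then obtain N where
    N: "\<And>m. m \<ge> N \<Longrightarrow> \<bar>(\<Sum>i\<in>F. l i * t m i) - (\<Sum>i\<in>F. l i * t0 i)\<bar> < r / 2"
    using LIMSEQ_D[of _ _ "r / 2"] \<open>r > 0\<close> by fastforce
  have split: "(\<Sum>\<^sub>\<infinity>i\<in>I. l i * u i) = (\<Sum>i\<in>F. l i * u i) + (\<Sum>\<^sub>\<infinity>i\<in>I - F. l i * u i)"
    "\<bar>\<Sum>\<^sub>\<infinity>i\<in>I - F. l i * u i\<bar> < r / 4" if "\<And>i. i \<in> I \<Longrightarrow> \<bar>u i\<bar> \<le> D" for u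
  proof -
    show "(\<Sum>\<^sub>\<infinity>i\<in>I. l i * u i) = (\<Sum>i\<in>F. l i * u i) + (\<Sum>\<^sub>\<infinity>i\<in>I - F. l i * u i)"
      using infsum_Diff[of "\<lambda>i. l i * u i" I F] F summable_mult_bounded[OF l that] by simp
    have "\<bar>\<Sum>\<^sub>\<infinity>i\<in>I - F. l i * u i\<bar> \<le> D * (\<Sum>\<^sub>\<infinity>i\<in>I - F. l i)"
      using l that by (intro abs_infsum_mult_le summable_on_subset_banach[OF l(1)]) auto
    also have "\<dots> < r / 4"
      using F(3) \<open>D > 0\<close> by (simp add: field_simps)
    finally show "\<bar>\<Sum>\<^sub>\<infinity>i\<in>I - F. l i * u i\<bar> < r / 4" .
  qed
  have "norm ((\<Sum>\<^sub>\<infinity>i\<in>I. l i * t m i) - (\<Sum>\<^sub>\<infinity>i\<in>I. l i * t0 i)) < r" if "m \<ge> N" for m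
    using N[OF that] split[of "t m"] split[of t0] D by (simp add: abs_real_def split: if_splits)
  then show "\<exists>N. \<forall>m\<ge>N. norm ((\<Sum>\<^sub>\<infinity>i\<in>I. l i * t m i) - (\<Sum>\<^sub>\<infinity>i\<in>I. l i * t0 i)) < r"
    by blast
qed

lemma infsum_scaled_delta:
  fixes l u :: "'i \<Rightarrow> real"
  assumes "h \<in> I"
  shows "(\<Sum>\<^sub>\<infinity>i\<in>I. l i * (u i * (if i = h then 1 else 0))) = l h * u h"
  using infsum_cong_neutral[of I "{h}" "\<lambda>i. l i * (u i * (if i = h then 1 else 0))"
      "\<lambda>i. l i * (u i * (if i = h then 1 else 0))"] assms by auto

text \<open>
  Gaussian elimination: an equation with a nonzero coefficient removes one unknown together with itself,
  so the surplus of unknowns survives until no equation is left.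
\<close>

lemma underdetermined_system_solution:
  fixes A :: "nat \<Rightarrow> 'i \<Rightarrow> real"
  assumes "finite S" "n < card S"
  obtains c where "\<exists>i\<in>S. c i \<noteq> 0" "\<And>k. k \<in> {1..n} \<Longrightarrow> (\<Sum>i\<in>S. A k i * c i) = 0"
  using assms
proof (induction n arbitrary: S A thesis)
  case 0
  then have "S \<noteq> {}" by auto
  then show ?case
    using 0(1)[of "\<lambda>_. 1"] by auto
next
  case (Suc n)
  show ?case
  proof (cases "\<forall>i\<in>S. A (Suc n) i = 0")
    case True
    obtain c where c: "\<exists>i\<in>S. c i \<noteq> 0" "\<And>k. k \<in> {1..n} \<Longrightarrow> (\<Sum>i\<in>S. A k i * c i) = 0"
      using Suc.IH[of S A] Suc.prems by auto
    have "(\<Sum>i\<in>S. A k i * c i) = 0" if "k \<in> {1..Suc n}" for k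
      using True c(2)[of k] that by (cases "k = Suc n") auto
    then show ?thesis
      using Suc.prems(1) c(1) by blast
  next
    case False
    then obtain p where p: "p \<in> S" "A (Suc n) p \<noteq> 0" by blast
    define T where "T = S - {p}"
    have T: "finite T" "n < card T"
      using Suc.prems p by (auto simp: T_def)
    define A' where "A' k i = A k i - A k p * A (Suc n) i / A (Suc n) p" for k i
    obtain c where c: "\<exists>i\<in>T. c i \<noteq> 0" "\<And>k. k \<in> {1..n} \<Longrightarrow> (\<Sum>i\<in>T. A' k i * c i) = 0"
      using Suc.IH[OF _ T, of A'] by auto
    define s where "s = (\<Sum>i\<in>T. A (Suc n) i * c i)"
    define c' where "c' = c(p := - s / A (Suc n) p)"
    have sum: "(\<Sum>i\<in>S. A k i * c' i) = (\<Sum>i\<in>T. A k i * c i) - A k p * s / A (Suc n) p" for k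
    proof -
      have "(\<Sum>i\<in>S. A k i * c' i) = A k p * c' p + (\<Sum>i\<in>T. A k i * c' i)"
        using p(1) Suc.prems(2) unfolding T_def by (simp add: sum.remove)
      also have "(\<Sum>i\<in>T. A k i * c' i) = (\<Sum>i\<in>T. A k i * c i)"
        by (intro sum.cong) (auto simp: T_def c'_def)
      finally show ?thesis by (simp add: c'_def)
    qed
    have "(\<Sum>i\<in>S. A k i * c' i) = 0" if k: "k \<in> {1..Suc n}" for k
    proof (cases "k = Suc n")
      case True
      then show ?thesis
        using p sum[of "Suc n"] by (simp add: s_def)
    next
      case False
      have "(\<Sum>i\<in>T. A' k i * c i) = (\<Sum>i\<in>T. A k i * c i - (A k p / A (Suc n) p) * (A (Suc n) i * c i))"
        by (intro sum.cong) (auto simp: A'_def algebra_simps)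
      also have "\<dots> = (\<Sum>i\<in>T. A k i * c i) - (A k p / A (Suc n) p) * s"
        by (simp add: sum_subtractf sum_distrib_left s_def)
      finally show ?thesis
        using c(2)[of k] sum[of k] False k by simp
    qed
    moreover have "\<exists>i\<in>S. c' i \<noteq> 0"
      using c(1) by (auto simp: T_def c'_def)
    ultimately show ?thesis
      using Suc.prems(1) by blast
  qed
qed

section \<open>Kernels with an orthonormal expansion\<close>

text \<open>
  The kernel is a series in bounded functions \<open>psi i\<close> that are orthonormal in \<open>L\<^sub>2\<close>.  The averages over the
  finite node sets \<open>Y m\<close> reproduce this orthonormality in the limit.  They replace the integral operator
  of the kernel: a finite average of the functions \<open>kernel_at y\<close> lies in \<open>H\<close> at once, whereas their
  integral would first have to be constructed in \<open>H\<close>.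
\<close>

locale mercer_rkhs = rkhs X K H ip
  for X :: "'a set"
    and K :: "'a \<Rightarrow> 'a \<Rightarrow> real"
    and H :: "('a \<Rightarrow> real) set"
    and ip :: "('a \<Rightarrow> real) \<Rightarrow> ('a \<Rightarrow> real) \<Rightarrow> real" +
  fixes \<mu> :: "'a measure"
    and I :: "'i set"
    and lam :: "'i \<Rightarrow> real"
    and psi :: "'i \<Rightarrow> 'a \<Rightarrow> real"
    and B :: real
    and Y :: "nat \<Rightarrow> 'a set"
  assumes finite_measure: "finite_measure \<mu>"
    and space_eq: "space \<mu> = X"
    and lam_pos: "i \<in> I \<Longrightarrow> 0 < lam i"
    and lam_summable: "lam summable_on I"
    and psi_measurable: "i \<in> I \<Longrightarrow> psi i \<in> borel_measurable \<mu>"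
    and psi_bound: "i \<in> I \<Longrightarrow> x \<in> X \<Longrightarrow> \<bar>psi i x\<bar> \<le> B"
    and psi_orthonormal:
      "i \<in> I \<Longrightarrow> j \<in> I \<Longrightarrow> (\<integral>x. psi i x * psi j x \<partial>\<mu>) = (if i = j then 1 else 0)"
    and kernel_expansion:
      "x \<in> X \<Longrightarrow> y \<in> X \<Longrightarrow> K x y = (\<Sum>\<^sub>\<infinity>i\<in>I. lam i * (psi i x * psi i y))"
    and nodes: "finite (Y m)" "Y m \<subseteq> X"
    and quadrature: "i \<in> I \<Longrightarrow> j \<in> I \<Longrightarrow>
      (\<lambda>m. (\<Sum>y\<in>Y m. psi i y * psi j y) / real (card (Y m))) \<longlonglongrightarrow> (if i = j then 1 else 0)"
begin

definition eigenfunction :: "'i \<Rightarrow> 'a \<Rightarrow> real" where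
  "eigenfunction i = (\<lambda>x. if x \<in> X then sqrt (lam i) * psi i x else 0)"

text \<open>
  The average \<open>u m\<close> of \<open>psi h y * kernel_at y\<close> over \<open>y \<in> Y m\<close> has the expansion
  \<open>\<Sum>i. lam i * q m i * psi i\<close>, where \<open>q m i\<close> is the average of \<open>psi i * psi h\<close> and tends to
  \<open>\<delta> i = (if i = h then 1 else 0)\<close>.  Inner products of these averages are again such series, so
  dominated convergence shows that the sequence is Cauchy with pointwise limit \<open>lam h * psi h\<close>.  Pairing it with
  \<open>f\<close> gives averages of \<open>f * psi h\<close>, which identifies the inner product of \<open>f\<close> with the limit.
\<close>

lemma eigenfunction_in_space:
  assumes h: "h \<in> I"
  shows "eigenfunction h \<in> H"
    and "\<And>f. f \<in> H \<Longrightarrow> (\<lambda>m. (\<Sum>y\<in>Y m. f y * psi h y) / real (card (Y m)))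
            \<longlonglongrightarrow> sqrt (lam h) * ip f (eigenfunction h)"
proof -
  define q where "q m i = (\<Sum>y\<in>Y m. psi i y * psi h y) / real (card (Y m))" for m i
  define u where "u m x = (\<Sum>y\<in>Y m. (psi h y / real (card (Y m))) * kernel_at y x)" for m x
  define \<delta> where "\<delta> i = (if i = h then 1 else 0 :: real)" for i
  have lam0: "0 \<le> lam i" if "i \<in> I" for i
    using lam_pos[OF that] by simp
  have B0: "\<bar>psi i y * psi j y\<bar> \<le> B\<^sup>2" if "i \<in> I" "j \<in> I" "y \<in> X" for i j y
    using mult_mono[OF psi_bound[OF that(1,3)] psi_bound[OF that(2,3)]]
      psi_bound[OF that(1,3)] by (simp add: abs_mult power2_eq_square)
  have q_bound: "\<bar>q m i\<bar> \<le> B\<^sup>2" if "i \<in> I" for m i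
  proof -
    have "\<bar>\<Sum>y\<in>Y m. psi i y * psi h y\<bar> \<le> (\<Sum>y\<in>Y m. B\<^sup>2)"
      using nodes[of m] B0[OF that h] by (intro sum_abs[THEN order_trans] sum_mono) auto
    then show ?thesis
      by (cases "card (Y m) = 0") (auto simp: q_def field_simps)
  qed
  have q_lim: "(\<lambda>m. q m i) \<longlonglongrightarrow> \<delta> i" if "i \<in> I" for i
    using quadrature[OF that h] by (simp add: q_def \<delta>_def)
  have node_in: "kernel_at y \<in> H" if "y \<in> Y m" for y m
    using kernel_in that nodes by blast
  have uH: "u m \<in> H" for m
    unfolding u_def using nodes node_in by (intro sum_closed) auto
  have ip_u: "ip f (u m) = (\<Sum>y\<in>Y m. f y * psi h y) / real (card (Y m))" if "f \<in> H" for f m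
  proof -
    have "ip f (u m) = (\<Sum>y\<in>Y m. (psi h y / real (card (Y m))) * ip f (kernel_at y))"
      unfolding u_def using nodes node_in that by (intro ip_sum_right) auto
    also have "\<dots> = (\<Sum>y\<in>Y m. (psi h y / real (card (Y m))) * f y)"
      using nodes reproducing[OF that] by (intro sum.cong) auto
    finally show ?thesis
      by (simp add: sum_divide_distrib mult.commute)
  qed
  have average: "(\<Sum>y\<in>Y m. psi h y * (\<Sum>\<^sub>\<infinity>i\<in>I. lam i * (c i * psi i y))) / real (card (Y m)) =
      (\<Sum>\<^sub>\<infinity>i\<in>I. lam i * (c i * q m i))" if c: "\<And>i. i \<in> I \<Longrightarrow> \<bar>c i\<bar> \<le> C" for m c C
  proof -
    have "C \<ge> 0 \<or> I = {}"
      using c abs_ge_zero order_trans by blast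
    then have "\<bar>c i * psi i y\<bar> \<le> C * B" if "i \<in> I" "y \<in> X" for i y
      using mult_mono[OF c[OF that(1)] psi_bound[OF that]] that by (auto simp: abs_mult)
    then have s: "(\<lambda>i. lam i * (c i * psi i y)) summable_on I" if "y \<in> X" for y
      using that by (intro summable_mult_bounded[OF lam_summable lam0, of _ "C * B"]) auto
    have "(\<Sum>y\<in>Y m. psi h y * (\<Sum>\<^sub>\<infinity>i\<in>I. lam i * (c i * psi i y))) / real (card (Y m)) =
        (\<Sum>y\<in>Y m. \<Sum>\<^sub>\<infinity>i\<in>I. (psi h y / real (card (Y m))) * (lam i * (c i * psi i y)))"
      unfolding infsum_cmult_right' by (simp add: sum_divide_distrib)
    also have "\<dots> = (\<Sum>\<^sub>\<infinity>i\<in>I. \<Sum>y\<in>Y m. (psi h y / real (card (Y m))) * (lam i * (c i * psi i y)))"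
      using nodes s by (intro sum_infsum_swap summable_on_cmult_right) auto
    also have "\<dots> = (\<Sum>\<^sub>\<infinity>i\<in>I. lam i * (c i * q m i))"
      by (intro infsum_cong) (simp add: q_def sum_divide_distrib sum_distrib_left mult_ac)
    finally show ?thesis .
  qed
  have u_at: "u m x = (\<Sum>\<^sub>\<infinity>i\<in>I. lam i * (psi i x * q m i))" if x: "x \<in> X" for m x
  proof -
    have "u m x = (\<Sum>y\<in>Y m. psi h y * K x y) / real (card (Y m))"
      using x by (simp add: u_def sum_divide_distrib)
    also have "(\<Sum>y\<in>Y m. psi h y * K x y) =
        (\<Sum>y\<in>Y m. psi h y * (\<Sum>\<^sub>\<infinity>i\<in>I. lam i * (psi i x * psi i y)))"
    proof (intro sum.cong refl arg_cong2[where f = "(*)"])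
      show "K x y = (\<Sum>\<^sub>\<infinity>i\<in>I. lam i * (psi i x * psi i y))" if "y \<in> Y m" for y
        using kernel_expansion[OF x] nodes that by blast
    qed
    finally show ?thesis
      using average[of "\<lambda>i. psi i x" B m] psi_bound x by simp
  qed
  have ip_uu: "ip (u m) (u n) = (\<Sum>\<^sub>\<infinity>i\<in>I. lam i * (q m i * q n i))" for m n
  proof -
    have "ip (u m) (u n) = (\<Sum>y\<in>Y n. psi h y * (\<Sum>\<^sub>\<infinity>i\<in>I. lam i * (q m i * psi i y))) / real (card (Y n))"
      unfolding ip_u[OF uH]
    proof (intro sum.cong refl arg_cong2[where f = "(/)"])
      show "u m y * psi h y = psi h y * (\<Sum>\<^sub>\<infinity>i\<in>I. lam i * (q m i * psi i y))" if "y \<in> Y n" for y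
        using u_at[of y m] nodes[of n] that by (auto simp: mult.commute)
    qed
    then show ?thesis
      using average[of "q m" "B\<^sup>2" n] q_bound by simp
  qed
  \<comment> \<open>The factor 2 comes from \<open>(x - y)\<^sup>2 \<le> 2 * x\<^sup>2 + 2 * y\<^sup>2\<close> applied to \<open>q m i - \<delta> i\<close> and \<open>q n i - \<delta> i\<close>.\<close>
  define D where "D m = (\<Sum>\<^sub>\<infinity>i\<in>I. lam i * (2 * (q m i - \<delta> i)\<^sup>2))" for m
  have qd: "\<bar>2 * (q m i - \<delta> i)\<^sup>2\<bar> \<le> 2 * (B\<^sup>2 + 1)\<^sup>2" if "i \<in> I" for m i
  proof -
    have "\<bar>q m i - \<delta> i\<bar> \<le> B\<^sup>2 + 1"
      using q_bound[OF that, of m] by (auto simp: \<delta>_def)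
    then have "(q m i - \<delta> i)\<^sup>2 \<le> (B\<^sup>2 + 1)\<^sup>2"
      by (simp add: abs_le_square_iff[symmetric])
    then show ?thesis by simp
  qed
  have "D \<longlonglongrightarrow> (\<Sum>\<^sub>\<infinity>i\<in>I. lam i * (2 * (\<delta> i - \<delta> i)\<^sup>2))"
    unfolding D_def
  proof (rule infsum_mult_tendsto[OF lam_summable lam0])
    show "(\<lambda>m. 2 * (q m i - \<delta> i)\<^sup>2) \<longlonglongrightarrow> 2 * (\<delta> i - \<delta> i)\<^sup>2" if "i \<in> I" for i
      using q_lim[OF that] by (intro tendsto_intros)
    show "\<bar>2 * (q m i - \<delta> i)\<^sup>2\<bar> \<le> 2 * (B\<^sup>2 + 1)\<^sup>2" if "i \<in> I" for m i
      by (rule qd[OF that])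
  qed
  then have D_lim: "D \<longlonglongrightarrow> 0" by simp
  have q_prod: "\<bar>q m i * q n i\<bar> \<le> B\<^sup>2 * B\<^sup>2" if "i \<in> I" for m n i
    using mult_mono[OF q_bound[OF that, of m] q_bound[OF that, of n]] by (simp add: abs_mult)
  have cauchy: "ip (\<lambda>x. u m x - u n x) (\<lambda>x. u m x - u n x) \<le> D m + D n" for m n
  proof -
    have s: "(\<lambda>i. lam i * (q k i * q l i)) summable_on I" for k l
      by (rule summable_mult_bounded[OF lam_summable lam0 q_prod])
    have sD: "(\<lambda>i. lam i * (2 * (q k i - \<delta> i)\<^sup>2)) summable_on I" for k
      by (rule summable_mult_bounded[OF lam_summable lam0 qd])
    have "((\<lambda>i. lam i * (q m i * q m i) + - (2 * (lam i * (q m i * q n i))) + lam i * (q n i * q n i))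
        has_sum (ip (u m) (u m) + - (2 * ip (u m) (u n)) + ip (u n) (u n))) I"
      unfolding ip_uu using s
      by (intro has_sum_add has_sum_uminusI has_sum_cmult_right has_sum_infsum)
    moreover have "((\<lambda>i. lam i * (2 * (q m i - \<delta> i)\<^sup>2) + lam i * (2 * (q n i - \<delta> i)\<^sup>2))
        has_sum (D m + D n)) I"
      unfolding D_def using sD by (intro has_sum_add has_sum_infsum)
    moreover have "lam i * (q m i * q m i) + - (2 * (lam i * (q m i * q n i))) + lam i * (q n i * q n i)
        \<le> lam i * (2 * (q m i - \<delta> i)\<^sup>2) + lam i * (2 * (q n i - \<delta> i)\<^sup>2)" if "i \<in> I" for i
    proof -
      have "0 \<le> lam i * (q m i + q n i - 2 * \<delta> i)\<^sup>2"
        using lam0[OF that] by simp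
      then show ?thesis
        by (simp add: power2_eq_square algebra_simps)
    qed
    ultimately have "ip (u m) (u m) + - (2 * ip (u m) (u n)) + ip (u n) (u n) \<le> D m + D n"
      by (rule has_sum_mono)
    then show ?thesis
      using ip_diff_self[OF uH uH] by simp
  qed
  define v where "v x = (if x \<in> X then lam h * psi h x else 0)" for x
  have u_lim: "(\<lambda>m. u m x) \<longlonglongrightarrow> v x" if x: "x \<in> X" for x
  proof -
    have "(\<lambda>m. \<Sum>\<^sub>\<infinity>i\<in>I. lam i * (psi i x * q m i)) \<longlonglongrightarrow> (\<Sum>\<^sub>\<infinity>i\<in>I. lam i * (psi i x * \<delta> i))"
    proof (rule infsum_mult_tendsto[OF lam_summable lam0])
      show "(\<lambda>m. psi i x * q m i) \<longlonglongrightarrow> psi i x * \<delta> i" if "i \<in> I" for i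
        using q_lim[OF that] by (intro tendsto_intros)
      show "\<bar>psi i x * q m i\<bar> \<le> B * B\<^sup>2" if "i \<in> I" for m i
        using mult_mono[OF psi_bound[OF that x] q_bound[OF that, of m]] psi_bound[OF that x]
        by (simp add: abs_mult)
    qed
    then show ?thesis
      using infsum_scaled_delta[OF h, of lam "\<lambda>i. psi i x"] x by (simp add: u_at \<delta>_def v_def)
  qed
  have v0: "v x = 0" if "x \<notin> X" for x
    using that by (simp add: v_def)
  have v: "v \<in> H" "\<And>f. f \<in> H \<Longrightarrow> (\<lambda>m. ip f (u m)) \<longlonglongrightarrow> ip f v"
    by (rule cauchy_sequence_limit[OF uH cauchy D_lim u_lim v0]; assumption)+
  have e: "eigenfunction h = (\<lambda>x. (1 / sqrt (lam h)) * v x)"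
    using lam_pos[OF h] by (auto simp: eigenfunction_def v_def fun_eq_iff field_simps)
  show eH: "eigenfunction h \<in> H"
    unfolding e by (rule scale_closed[OF v(1)])
  show "(\<lambda>m. (\<Sum>y\<in>Y m. f y * psi h y) / real (card (Y m))) \<longlonglongrightarrow> sqrt (lam h) * ip f (eigenfunction h)"
    if f: "f \<in> H" for f
  proof -
    have "ip f (eigenfunction h) = (1 / sqrt (lam h)) * ip v f"
      unfolding e using ip_commute[OF f scale_closed[OF v(1)]] ip_scale_left[OF v(1) f] by (simp only:)
    then have "sqrt (lam h) * ip f (eigenfunction h) = ip f v"
      using lam_pos[OF h] ip_commute[OF f v(1)] by simp
    then show ?thesis
      using v(2)[OF f] ip_u[OF f] by simp
  qed
qed

lemma eigenfunction_orthonormal: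
  assumes "g \<in> I" "h \<in> I"
  shows "ip (eigenfunction g) (eigenfunction h) = (if g = h then 1 else 0)"
proof -
  have "(\<lambda>m. sqrt (lam g) * ((\<Sum>y\<in>Y m. psi g y * psi h y) / real (card (Y m))))
      \<longlonglongrightarrow> sqrt (lam g) * (if g = h then 1 else 0)"
    using quadrature[OF assms] by (intro tendsto_intros)
  moreover have "sqrt (lam g) * ((\<Sum>y\<in>Y m. psi g y * psi h y) / real (card (Y m))) =
      (\<Sum>y\<in>Y m. eigenfunction g y * psi h y) / real (card (Y m))" for m
  proof -
    have "(\<Sum>y\<in>Y m. eigenfunction g y * psi h y) = (\<Sum>y\<in>Y m. sqrt (lam g) * (psi g y * psi h y))"
      using nodes[of m] by (intro sum.cong) (auto simp: eigenfunction_def)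
    then show ?thesis
      by (simp add: sum_distrib_left)
  qed
  ultimately have "(\<lambda>m. (\<Sum>y\<in>Y m. eigenfunction g y * psi h y) / real (card (Y m)))
      \<longlonglongrightarrow> sqrt (lam g) * (if g = h then 1 else 0)"
    by (simp only:)
  from LIMSEQ_unique[OF eigenfunction_in_space(2)[OF assms(2) eigenfunction_in_space(1)[OF assms(1)]] this]
  have "sqrt (lam h) * ip (eigenfunction g) (eigenfunction h) =
      sqrt (lam g) * (if g = h then 1 else 0)" .
  then show ?thesis
    using lam_pos[OF assms(1)] lam_pos[OF assms(2)] by (auto split: if_splits)
qed

definition residual :: "('a \<Rightarrow> real) \<Rightarrow> 'i set \<Rightarrow> 'a \<Rightarrow> real" where
  "residual f F = (\<lambda>x. f x - (\<Sum>i\<in>F. ip f (eigenfunction i) * eigenfunction i x))"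

lemma combination_in_space:
  assumes "finite F" "F \<subseteq> I"
  shows "(\<lambda>x. \<Sum>i\<in>F. c i * eigenfunction i x) \<in> H"
  using assms eigenfunction_in_space(1) by (intro sum_closed) auto

lemma ip_combination_eigenfunction:
  assumes "finite F" "F \<subseteq> I" "i \<in> F"
  shows "ip (\<lambda>x. \<Sum>i\<in>F. c i * eigenfunction i x) (eigenfunction i) = c i"
proof -
  have "ip (\<lambda>x. \<Sum>i\<in>F. c i * eigenfunction i x) (eigenfunction i) =
      (\<Sum>j\<in>F. c j * ip (eigenfunction j) (eigenfunction i))"
    using assms eigenfunction_in_space(1) by (intro ip_sum_left) auto
  also have "\<dots> = (\<Sum>j\<in>F. c j * (if j = i then 1 else 0))"
    using assms by (intro sum.cong refl) (simp add: eigenfunction_orthonormal subset_iff)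
  finally show ?thesis
    using assms by (simp add: if_distrib cong: if_cong)
qed

lemma ip_combination_self:
  assumes "finite F" "F \<subseteq> I"
  shows "ip (\<lambda>x. \<Sum>i\<in>F. c i * eigenfunction i x) (\<lambda>x. \<Sum>i\<in>F. c i * eigenfunction i x) =
    (\<Sum>i\<in>F. (c i)\<^sup>2)"
proof -
  have "ip (\<lambda>x. \<Sum>i\<in>F. c i * eigenfunction i x) (\<lambda>x. \<Sum>i\<in>F. c i * eigenfunction i x) =
      (\<Sum>j\<in>F. c j * ip (\<lambda>x. \<Sum>i\<in>F. c i * eigenfunction i x) (eigenfunction j))"
    using assms eigenfunction_in_space(1) combination_in_space by (intro ip_sum_right) auto
  then show ?thesis
    using ip_combination_eigenfunction[OF assms] by (simp add: power2_eq_square)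
qed

lemma residual_in_space:
  assumes "f \<in> H" "finite F" "F \<subseteq> I"
  shows "residual f F \<in> H"
  unfolding residual_def using assms combination_in_space by (intro diff_closed) auto

lemma ip_residual_self:
  assumes "f \<in> H" "finite F" "F \<subseteq> I"
  shows "ip (residual f F) (residual f F) = ip f f - (\<Sum>i\<in>F. (ip f (eigenfunction i))\<^sup>2)"
proof -
  have "ip f (\<lambda>x. \<Sum>i\<in>F. ip f (eigenfunction i) * eigenfunction i x) =
      (\<Sum>i\<in>F. (ip f (eigenfunction i))\<^sup>2)"
    using assms eigenfunction_in_space(1) by (subst ip_sum_right) (auto simp: power2_eq_square)
  then show ?thesis
    unfolding residual_def using assms combination_in_space
    by (subst ip_diff_self) (auto simp: ip_combination_self)
qed

lemma Bessel_inequality: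
  assumes "f \<in> H" "finite F" "F \<subseteq> I"
  shows "(\<Sum>i\<in>F. (ip f (eigenfunction i))\<^sup>2) \<le> ip f f"
  using ip_residual_self[OF assms] ip_nonneg[OF residual_in_space[OF assms]] by simp

text \<open>
  \<open>residual f F x\<close> is also the inner product of \<open>f\<close> with the residual of \<open>kernel_at x\<close>, whose squared norm
  is the tail of the expansion of \<open>K x x\<close>.  So every \<open>f \<in> H\<close> is the uniform limit of its partial
  expansions.
\<close>

lemma residual_pointwise:
  assumes f: "f \<in> H" and F: "finite F" "F \<subseteq> I" and x: "x \<in> X"
  shows "(residual f F x)\<^sup>2 \<le> ip f f * (B\<^sup>2 * (\<Sum>\<^sub>\<infinity>i\<in>I - F. lam i))"
proof -
  have k: "kernel_at x \<in> H"
    using kernel_in[OF x] .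
  have c: "ip (kernel_at x) (eigenfunction i) = eigenfunction i x" if "i \<in> I" for i
    using ip_commute[OF k] reproducing[OF _ x] eigenfunction_in_space(1)[OF that] by simp
  have psi2: "\<bar>psi i x * psi i x\<bar> \<le> B\<^sup>2" if "i \<in> I" for i
    using mult_mono[OF psi_bound[OF that x] psi_bound[OF that x]] psi_bound[OF that x]
    by (simp add: power2_eq_square)
  have lam0: "0 \<le> lam i" if "i \<in> I" for i
    using lam_pos[OF that] by simp
  have "residual f F x = ip f (residual (kernel_at x) F)"
  proof -
    have "ip f (residual (kernel_at x) F) = ip f (kernel_at x) -
        ip f (\<lambda>y. \<Sum>i\<in>F. ip (kernel_at x) (eigenfunction i) * eigenfunction i y)"
      unfolding residual_def by (rule ip_diff_right[OF k combination_in_space[OF F] f])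
    also have "ip f (\<lambda>y. \<Sum>i\<in>F. ip (kernel_at x) (eigenfunction i) * eigenfunction i y) =
        (\<Sum>i\<in>F. ip (kernel_at x) (eigenfunction i) * ip f (eigenfunction i))"
      using F eigenfunction_in_space(1) f by (intro ip_sum_right) auto
    also have "\<dots> = (\<Sum>i\<in>F. ip f (eigenfunction i) * eigenfunction i x)"
      using F c by (intro sum.cong) auto
    finally show ?thesis
      using reproducing[OF f x] by (simp add: residual_def)
  qed
  moreover have "ip (residual (kernel_at x) F) (residual (kernel_at x) F) \<le>
      B\<^sup>2 * (\<Sum>\<^sub>\<infinity>i\<in>I - F. lam i)"
  proof -
    have "ip (residual (kernel_at x) F) (residual (kernel_at x) F) =
        K x x - (\<Sum>i\<in>F. (eigenfunction i x)\<^sup>2)"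
      unfolding ip_residual_self[OF k F] reproducing[OF k x] using F c x by (auto intro!: sum.cong)
    also have "(\<Sum>i\<in>F. (eigenfunction i x)\<^sup>2) = (\<Sum>i\<in>F. lam i * (psi i x * psi i x))"
      using F lam0 x by (intro sum.cong) (auto simp: eigenfunction_def power2_eq_square mult_ac)
    also have "K x x - \<dots> = (\<Sum>\<^sub>\<infinity>i\<in>I - F. lam i * (psi i x * psi i x))"
      using infsum_Diff[of "\<lambda>i. lam i * (psi i x * psi i x)" I F] F kernel_expansion[OF x x]
        summable_mult_bounded[OF lam_summable lam0 psi2] by simp
    also have "\<dots> \<le> B\<^sup>2 * (\<Sum>\<^sub>\<infinity>i\<in>I - F. lam i)"
      using abs_infsum_mult_le[of lam "I - F" "\<lambda>i. psi i x * psi i x" "B\<^sup>2"] lam0 psi2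
        summable_on_subset_banach[OF lam_summable, of "I - F"] by fastforce
    finally show ?thesis .
  qed
  then have "ip f f * ip (residual (kernel_at x) F) (residual (kernel_at x) F) \<le>
      ip f f * (B\<^sup>2 * (\<Sum>\<^sub>\<infinity>i\<in>I - F. lam i))"
    by (rule mult_left_mono[OF _ ip_nonneg[OF f]])
  ultimately show ?thesis
    using Cauchy_Schwarz[OF f residual_in_space[OF k F]] by simp
qed

lemma tail_le_total:
  assumes "F \<subseteq> G" "finite G" "G \<subseteq> I"
  shows "(\<Sum>\<^sub>\<infinity>i\<in>I - G. lam i) \<le> (\<Sum>\<^sub>\<infinity>i\<in>I - F. lam i)"
  using assms lam_pos
  by (intro infsum_mono2 summable_on_subset_banach[OF lam_summable]) (auto intro: less_imp_le)

lemma residual_bounded: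
  assumes "f \<in> H" "finite F" "F \<subseteq> I" "x \<in> X"
  shows "\<bar>residual f F x\<bar> \<le> sqrt (ip f f * (B\<^sup>2 * (\<Sum>\<^sub>\<infinity>i\<in>I. lam i)))"
proof -
  have "ip f f * (B\<^sup>2 * (\<Sum>\<^sub>\<infinity>i\<in>I - F. lam i)) \<le> ip f f * (B\<^sup>2 * (\<Sum>\<^sub>\<infinity>i\<in>I. lam i))"
    using tail_le_total[of "{}" F] assms ip_nonneg by (intro mult_left_mono) auto
  then show ?thesis
    using residual_pointwise[OF assms] by (intro real_le_rsqrt) auto
qed

text \<open>
  One sequence of finite index sets serves all \<open>f\<close> and \<open>x\<close>.  A sequence is needed, rather than the net
  of finite sets, because measurability and dominated convergence are statements about sequences.
\<close>

lemma expansion_sequence: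
  assumes S: "finite S" "S \<subseteq> I"
  shows "\<exists>F. (\<forall>n. finite (F n) \<and> S \<subseteq> F n \<and> F n \<subseteq> I) \<and>
    (\<forall>f\<in>H. \<forall>x\<in>X. (\<lambda>n. residual f (F n) x) \<longlonglongrightarrow> 0)"
proof -
  have "\<exists>F. finite F \<and> F \<subseteq> I \<and> (\<Sum>\<^sub>\<infinity>i\<in>I - F. lam i) < inverse (real (Suc n))" for n
    by (rule infsum_tail_less[OF lam_summable, of "inverse (real (Suc n))"]) auto
  then obtain G where G: "\<And>n. finite (G n)" "\<And>n. G n \<subseteq> I"
    "\<And>n. (\<Sum>\<^sub>\<infinity>i\<in>I - G n. lam i) < inverse (real (Suc n))"
    using choice[of "\<lambda>n F. finite F \<and> F \<subseteq> I \<and> (\<Sum>\<^sub>\<infinity>i\<in>I - F. lam i) < inverse (real (Suc n))"]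
    by blast
  define F where "F n = G n \<union> S" for n
  have F: "finite (F n)" "S \<subseteq> F n" "F n \<subseteq> I" for n
    using G S by (auto simp: F_def)
  have tail: "(\<Sum>\<^sub>\<infinity>i\<in>I - F n. lam i) \<le> inverse (real (Suc n))" for n
  proof -
    have "(\<Sum>\<^sub>\<infinity>i\<in>I - F n. lam i) \<le> (\<Sum>\<^sub>\<infinity>i\<in>I - G n. lam i)"
      using F[of n] by (intro tail_le_total) (auto simp: F_def)
    with G(3)[of n] show ?thesis
      by linarith
  qed
  have "(\<lambda>n. residual f (F n) x) \<longlonglongrightarrow> 0" if fx: "f \<in> H" "x \<in> X" for f x
  proof -
    have le: "norm ((residual f (F n) x)\<^sup>2) \<le> (ip f f * B\<^sup>2) * inverse (real (Suc n))" for n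
    proof -
      have "ip f f * (B\<^sup>2 * (\<Sum>\<^sub>\<infinity>i\<in>I - F n. lam i)) \<le> ip f f * (B\<^sup>2 * inverse (real (Suc n)))"
        by (intro mult_left_mono tail ip_nonneg fx) auto
      with residual_pointwise[OF fx(1) F(1,3) fx(2), of n] show ?thesis
        by (simp add: mult.assoc)
    qed
    have "(\<lambda>n. (ip f f * B\<^sup>2) * inverse (real (Suc n))) \<longlonglongrightarrow> 0"
      by (rule tendsto_mult_right_zero[OF LIMSEQ_inverse_real_of_nat])
    then have "(\<lambda>n. (residual f (F n) x)\<^sup>2) \<longlonglongrightarrow> 0"
      by (rule Lim_null_comparison[OF always_eventually, rotated]) (use le in blast)
    from tendsto_real_sqrt[OF this] have "(\<lambda>n. \<bar>residual f (F n) x\<bar>) \<longlonglongrightarrow> 0"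
      by simp
    then show ?thesis
      by (rule tendsto_rabs_zero_cancel)
  qed
  with F show ?thesis
    by (intro exI[of _ F] conjI allI ballI) simp_all
qed

sublocale \<mu>: finite_measure \<mu>
  by (rule finite_measure)

lemma eigenfunction_measurable:
  assumes "i \<in> I"
  shows "eigenfunction i \<in> borel_measurable \<mu>"
proof -
  have "(\<lambda>x. sqrt (lam i) * psi i x) \<in> borel_measurable \<mu>"
    by (intro borel_measurable_times borel_measurable_const psi_measurable[OF assms])
  moreover have "eigenfunction i \<in> borel_measurable \<mu> \<longleftrightarrow>
      (\<lambda>x. sqrt (lam i) * psi i x) \<in> borel_measurable \<mu>"
    by (rule measurable_cong) (simp add: eigenfunction_def space_eq)
  ultimately show ?thesis
    by blast
qed

lemma combination_measurable:
  assumes "F \<subseteq> I"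
  shows "(\<lambda>x. \<Sum>i\<in>F. c i * eigenfunction i x) \<in> borel_measurable \<mu>"
  by (intro borel_measurable_sum borel_measurable_times borel_measurable_const
      eigenfunction_measurable) (use assms in blast)

lemma space_measurable:
  assumes "f \<in> H"
  shows "f \<in> borel_measurable \<mu>"
proof -
  obtain F where "\<forall>n. finite (F n) \<and> {} \<subseteq> F n \<and> F n \<subseteq> I"
    and "\<forall>f\<in>H. \<forall>x\<in>X. (\<lambda>n. residual f (F n) x) \<longlonglongrightarrow> 0"
    using expansion_sequence[OF finite.emptyI empty_subsetI] by (elim exE conjE)
  then have F: "\<And>n. F n \<subseteq> I" "\<And>x. x \<in> X \<Longrightarrow> (\<lambda>n. residual f (F n) x) \<longlonglongrightarrow> 0"
    using assms by simp_all
  show ?thesis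
  proof (rule borel_measurable_LIMSEQ_real)
    show "(\<lambda>x. \<Sum>i\<in>F n. ip f (eigenfunction i) * eigenfunction i x) \<in> borel_measurable \<mu>" for n
      by (rule combination_measurable[OF F(1)])
    fix x
    assume "x \<in> space \<mu>"
    then have "x \<in> X"
      by (simp add: space_eq)
    then have "(\<lambda>n. f x - residual f (F n) x) \<longlonglongrightarrow> f x - 0"
      by (intro tendsto_diff tendsto_const F(2))
    then show "(\<lambda>n. \<Sum>i\<in>F n. ip f (eigenfunction i) * eigenfunction i x) \<longlonglongrightarrow> f x"
      by (simp add: residual_def)
  qed
qed

lemma space_subset_L2:
  assumes "f \<in> H"
  shows "f \<in> L2_space \<mu>"
proof -
  define C where "C = ip f f * (B\<^sup>2 * (\<Sum>\<^sub>\<infinity>i\<in>I. lam i))"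
  have "(f x)\<^sup>2 \<le> C" if "x \<in> X" for x
    using residual_pointwise[OF assms _ _ that, of "{}"] by (simp add: residual_def C_def)
  then have "integrable \<mu> (\<lambda>x. (f x)\<^sup>2)"
    using space_measurable[OF assms] by (intro \<mu>.integrable_const_bound[of _ C]) (auto simp: space_eq)
  then show ?thesis
    using space_measurable[OF assms] by (simp add: L2_space_def)
qed

lemma integral_combination_square:
  assumes "finite F" "F \<subseteq> I"
  shows "(\<integral>x. (\<Sum>i\<in>F. c i * eigenfunction i x)\<^sup>2 \<partial>\<mu>) = (\<Sum>i\<in>F. (c i)\<^sup>2 * lam i)"
proof -
  have int: "integrable \<mu> (\<lambda>x. psi i x * psi j x)" if "i \<in> I" "j \<in> I" for i j
  proof (rule \<mu>.integrable_const_bound[of _ "\<bar>B\<bar> * \<bar>B\<bar>"])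
    show "AE x in \<mu>. norm (psi i x * psi j x) \<le> \<bar>B\<bar> * \<bar>B\<bar>"
    proof (rule AE_I2)
      fix x
      assume "x \<in> space \<mu>"
      then have "\<bar>psi i x\<bar> \<le> \<bar>B\<bar>" "\<bar>psi j x\<bar> \<le> \<bar>B\<bar>"
        using psi_bound[OF that(1), of x] psi_bound[OF that(2), of x] by (auto simp: space_eq)
      then show "norm (psi i x * psi j x) \<le> \<bar>B\<bar> * \<bar>B\<bar>"
        using mult_mono[of "\<bar>psi i x\<bar>" "\<bar>B\<bar>" "\<bar>psi j x\<bar>" "\<bar>B\<bar>"] by (simp add: abs_mult)
    qed
  qed (use psi_measurable that in measurable)
  have "(\<integral>x. (\<Sum>i\<in>F. c i * eigenfunction i x)\<^sup>2 \<partial>\<mu>) =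
      (\<integral>x. (\<Sum>i\<in>F. \<Sum>j\<in>F. (c i * c j * (sqrt (lam i) * sqrt (lam j))) * (psi i x * psi j x)) \<partial>\<mu>)"
    by (intro Bochner_Integration.integral_cong refl)
      (auto simp: eigenfunction_def space_eq power2_eq_square sum_product intro!: sum.cong)
  also have "\<dots> = (\<Sum>i\<in>F. \<Sum>j\<in>F. (c i * c j * (sqrt (lam i) * sqrt (lam j))) *
      (\<integral>x. psi i x * psi j x \<partial>\<mu>))"
  proof -
    have term_int: "integrable \<mu> (\<lambda>x. (c i * c j * (sqrt (lam i) * sqrt (lam j))) * (psi i x * psi j x))"
      if "i \<in> F" "j \<in> F" for i j
      using int[of i j] that assms(2) by (intro integrable_mult_right) auto
    have "(\<integral>x. (\<Sum>i\<in>F. \<Sum>j\<in>F. (c i * c j * (sqrt (lam i) * sqrt (lam j))) * (psi i x * psi j x)) \<partial>\<mu>) =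
        (\<Sum>i\<in>F. \<integral>x. (\<Sum>j\<in>F. (c i * c j * (sqrt (lam i) * sqrt (lam j))) * (psi i x * psi j x)) \<partial>\<mu>)"
      by (intro Bochner_Integration.integral_sum Bochner_Integration.integrable_sum term_int)
    also have "\<dots> = (\<Sum>i\<in>F. \<Sum>j\<in>F. \<integral>x. (c i * c j * (sqrt (lam i) * sqrt (lam j))) * (psi i x * psi j x) \<partial>\<mu>)"
      by (intro sum.cong refl Bochner_Integration.integral_sum term_int)
    finally show ?thesis
      by simp
  qed
  also have "\<dots> = (\<Sum>i\<in>F. \<Sum>j\<in>F. if j = i then (c i)\<^sup>2 * lam i else 0)"
  proof (intro sum.cong refl)
    fix i j
    assume "i \<in> F" "j \<in> F"
    then have ij: "i \<in> I" "j \<in> I"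
      using assms(2) by auto
    then show "(c i * c j * (sqrt (lam i) * sqrt (lam j))) * (\<integral>x. psi i x * psi j x \<partial>\<mu>) =
        (if j = i then (c i)\<^sup>2 * lam i else 0)"
      using lam_pos[OF ij(1)] unfolding psi_orthonormal[OF ij] by (auto simp: power2_eq_square)
  qed
  also have "\<dots> = (\<Sum>i\<in>F. (c i)\<^sup>2 * lam i)"
    using assms(1) by simp
  finally show ?thesis .
qed

text \<open>
  The partial sums over \<open>F n - S\<close> have squared \<open>L\<^sub>2\<close> norm \<open>\<Sum>i. (ip f (eigenfunction i))\<^sup>2 * lam i\<close>,
  where every \<open>lam i\<close> is at most \<open>\<epsilon>\<^sup>2\<close>; Bessel's inequality bounds the rest, and the partial sums converge
  boundedly to the residual.
\<close>

lemma integral_residual_square_le: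
  assumes f: "f \<in> H" and S: "finite S" "S \<subseteq> I" and small: "\<And>i. i \<in> I - S \<Longrightarrow> lam i \<le> \<epsilon>\<^sup>2"
  shows "(\<integral>x. (residual f S x)\<^sup>2 \<partial>\<mu>) \<le> \<epsilon>\<^sup>2 * ip f f"
proof -
  obtain F where "\<forall>n. finite (F n) \<and> S \<subseteq> F n \<and> F n \<subseteq> I"
    and "\<forall>f\<in>H. \<forall>x\<in>X. (\<lambda>n. residual f (F n) x) \<longlonglongrightarrow> 0"
    using expansion_sequence[OF S] by (elim exE conjE)
  then have F: "\<And>n. finite (F n)" "\<And>n. S \<subseteq> F n" "\<And>n. F n \<subseteq> I"
    and lim: "\<And>x. x \<in> X \<Longrightarrow> (\<lambda>n. residual f (F n) x) \<longlonglongrightarrow> 0"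
    using f by simp_all
  have FS: "finite (F n - S)" "F n - S \<subseteq> I" for n
    using F(1)[of n] F(3)[of n] by auto
  define c where "c i = ip f (eigenfunction i)" for i
  define g where "g n x = (\<Sum>i\<in>F n - S. c i * eigenfunction i x)" for n x
  define C where "C = sqrt (ip f f * (B\<^sup>2 * (\<Sum>\<^sub>\<infinity>i\<in>I. lam i)))"
  have g: "g n x = residual f S x - residual f (F n) x" for n x
    using sum.subset_diff[OF F(2) F(1), of "\<lambda>i. c i * eigenfunction i x" n]
    by (simp add: g_def residual_def c_def)
  have [measurable]: "g n \<in> borel_measurable \<mu>" for n
    unfolding g_def by (rule combination_measurable[OF FS(2)])
  have [measurable]: "residual f S \<in> borel_measurable \<mu>"
    using residual_in_space[OF f S] by (rule space_measurable)
  have g_lim: "(\<lambda>n. \<integral>x. (g n x)\<^sup>2 \<partial>\<mu>) \<longlonglongrightarrow> (\<integral>x. (residual f S x)\<^sup>2 \<partial>\<mu>)"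
  proof (rule integral_dominated_convergence[where w = "\<lambda>_. (2 * C)\<^sup>2"])
    show "AE x in \<mu>. (\<lambda>n. (g n x)\<^sup>2) \<longlonglongrightarrow> (residual f S x)\<^sup>2"
    proof (rule AE_I2)
      fix x
      assume "x \<in> space \<mu>"
      then have "x \<in> X"
        by (simp add: space_eq)
      then have "(\<lambda>n. (residual f S x - residual f (F n) x)\<^sup>2) \<longlonglongrightarrow> (residual f S x - 0)\<^sup>2"
        by (intro tendsto_power tendsto_diff tendsto_const lim)
      then show "(\<lambda>n. (g n x)\<^sup>2) \<longlonglongrightarrow> (residual f S x)\<^sup>2"
        by (simp add: g)
    qed
    show "AE x in \<mu>. norm ((g n x)\<^sup>2) \<le> (2 * C)\<^sup>2" for n
    proof (rule AE_I2)
      fix x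
      assume "x \<in> space \<mu>"
      then have "\<bar>g n x\<bar> \<le> 2 * C"
        using residual_bounded[OF f S, of x] residual_bounded[OF f F(1,3), of x n]
        by (simp add: g C_def space_eq)
      then show "norm ((g n x)\<^sup>2) \<le> (2 * C)\<^sup>2"
        using power_mono[of "\<bar>g n x\<bar>" "2 * C" 2] by simp
    qed
  qed auto
  have g_le: "(\<integral>x. (g n x)\<^sup>2 \<partial>\<mu>) \<le> \<epsilon>\<^sup>2 * ip f f" for n
  proof -
    have "(\<integral>x. (g n x)\<^sup>2 \<partial>\<mu>) = (\<Sum>i\<in>F n - S. (c i)\<^sup>2 * lam i)"
      unfolding g_def by (rule integral_combination_square[OF FS])
    also have "\<dots> \<le> (\<Sum>i\<in>F n - S. (c i)\<^sup>2 * \<epsilon>\<^sup>2)"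
    proof (intro sum_mono mult_left_mono)
      show "lam i \<le> \<epsilon>\<^sup>2" if "i \<in> F n - S" for i
        using small FS(2)[of n] that by blast
    qed simp
    also have "\<dots> = \<epsilon>\<^sup>2 * (\<Sum>i\<in>F n - S. (c i)\<^sup>2)"
      by (simp add: sum_distrib_left mult.commute)
    also have "\<dots> \<le> \<epsilon>\<^sup>2 * ip f f"
      unfolding c_def by (intro mult_left_mono Bessel_inequality[OF f FS]) simp
    finally show ?thesis .
  qed
  show ?thesis
    by (rule LIMSEQ_le_const2[OF g_lim]) (simp add: g_le)
qed

section \<open>Information complexity as an eigenvalue count\<close>

lemma combination_in_L2:
  assumes "finite F" "F \<subseteq> I"
  shows "(\<lambda>x. \<Sum>i\<in>F. c i * eigenfunction i x) \<in> L2_space \<mu>"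
  by (rule space_subset_L2[OF combination_in_space[OF assms]])

text \<open>
  By orthogonality the \<open>L\<^sub>2\<close> distance of two combinations is a continuous function of their coefficients, so
  preimages of open sets are open.
\<close>

lemma synthesis_measurable:
  fixes idx :: "nat \<Rightarrow> 'i"
  assumes idx: "bij_betw idx {1..n} S" and S: "finite S" "S \<subseteq> I"
  shows "(\<lambda>z x. \<Sum>k\<in>{1..n}. z k * eigenfunction (idx k) x)
    \<in> measurable (\<Pi>\<^sub>M k\<in>{1..n}. (borel :: real measure)) (L2_borel \<mu>)"
proof -
  define \<phi> where "\<phi> z x = (\<Sum>k\<in>{1..n}. z k * eigenfunction (idx k) x)" for z :: "nat \<Rightarrow> real" and x
  define inv where "inv = inv_into {1..n} idx"
  have inv: "inv (idx k) = k" if "k \<in> {1..n}" for k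
    using idx that by (simp add: inv_def bij_betw_def)
  have \<phi>: "\<phi> z x = (\<Sum>i\<in>S. z (inv i) * eigenfunction i x)" for z x
    unfolding \<phi>_def using inv
    by (subst sum.reindex_bij_betw[OF idx, symmetric]) (intro sum.cong refl, simp)
  have \<phi>_L2: "\<phi> z \<in> L2_space \<mu>" for z
    using combination_in_L2[OF S, of "\<lambda>i. z (inv i)"] by (simp add: \<phi>[abs_def])
  have norm_diff: "L2_norm \<mu> (\<lambda>x. \<phi> w x - \<phi> z x) = sqrt (\<Sum>i\<in>S. (w (inv i) - z (inv i))\<^sup>2 * lam i)" for w z
  proof -
    have "\<phi> w x - \<phi> z x = (\<Sum>i\<in>S. (w (inv i) - z (inv i)) * eigenfunction i x)" for x
      by (simp add: \<phi> left_diff_distrib sum_subtractf)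
    then show ?thesis
      using integral_combination_square[OF S, of "\<lambda>i. w (inv i) - z (inv i)"] by (simp add: L2_norm_def)
  qed
  \<comment> \<open>Extending a tuple by zeros reduces measurability to openness in the countable product.\<close>
  define ext where "ext z = (\<lambda>k. if k \<in> {1..n} then z k else 0)" for z :: "nat \<Rightarrow> real"
  have ext_meas: "ext \<in> measurable (\<Pi>\<^sub>M k\<in>{1..n}. borel) (\<Pi>\<^sub>M k\<in>UNIV. borel)"
    unfolding ext_def
  proof (rule measurable_PiM_single')
    show "(\<lambda>z. if k \<in> {1..n} then z k else 0) \<in> borel_measurable (\<Pi>\<^sub>M k\<in>{1..n}. borel)" for k :: nat
      by (cases "k \<in> {1..n}") auto
  qed auto
  have \<phi>_ext: "\<phi> (ext z) = \<phi> z" for z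
    by (auto simp: \<phi>_def ext_def intro!: sum.cong)
  have "\<phi> \<in> measurable (\<Pi>\<^sub>M k\<in>{1..n}. borel) (L2_borel \<mu>)"
    unfolding L2_borel_def
  proof (rule measurable_measure_of)
    show "{U. L2_open \<mu> U} \<subseteq> Pow (L2_space \<mu>)"
      by (auto simp: L2_open_def)
    show "\<phi> \<in> space (\<Pi>\<^sub>M k\<in>{1..n}. borel) \<rightarrow> L2_space \<mu>"
      using \<phi>_L2 by blast
    fix U
    assume "U \<in> {U. L2_open \<mu> U}"
    then have U: "L2_open \<mu> U" by simp
    have "open (\<phi> -` U)"
    proof (rule Topological_Spaces.openI)
      fix z
      assume "z \<in> \<phi> -` U"
      then obtain r where r: "r > 0"
        "\<And>g. g \<in> L2_space \<mu> \<Longrightarrow> L2_norm \<mu> (\<lambda>x. g x - \<phi> z x) < r \<Longrightarrow> g \<in> U"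
        using U by (auto simp: L2_open_def)
      define T where "T = {w. sqrt (\<Sum>i\<in>S. (w (inv i) - z (inv i))\<^sup>2 * lam i) < r}"
      have "open T"
        unfolding T_def by (intro open_Collect_less continuous_intros continuous_on_product_coordinates)
      moreover have "z \<in> T"
        using r(1) by (simp add: T_def)
      moreover have "T \<subseteq> \<phi> -` U"
        using r(2)[OF \<phi>_L2] by (auto simp: T_def norm_diff)
      ultimately show "\<exists>T. open T \<and> z \<in> T \<and> T \<subseteq> \<phi> -` U"
        by blast
    qed
    then have "\<phi> -` U \<in> sets (\<Pi>\<^sub>M k\<in>UNIV. borel)"
      unfolding sets_PiM_equal_borel by simp
    from measurable_sets[OF ext_meas this]
    show "\<phi> -` U \<inter> space (\<Pi>\<^sub>M k\<in>{1..n}. borel) \<in> sets (\<Pi>\<^sub>M k\<in>{1..n}. borel)"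
      by (simp add: vimage_def \<phi>_ext)
  qed
  then show ?thesis
    by (simp add: \<phi>_def[abs_def])
qed

lemma minimal_error_le:
  assumes S: "finite S" "S \<subseteq> I" and small: "\<And>i. i \<in> I - S \<Longrightarrow> lam i \<le> \<epsilon>\<^sup>2" and \<epsilon>: "0 \<le> \<epsilon>"
  shows "minimal_error \<mu> H ip (card S) \<le> ennreal \<epsilon>"
proof -
  define A where "A f x = (\<Sum>i\<in>S. ip f (eigenfunction i) * eigenfunction i x)" for f :: "'a \<Rightarrow> real" and x
  have "A \<in> algorithms \<mu> H ip (card S)"
  proof (cases "card S = 0")
    case True
    then show ?thesis
      using S by (auto simp: algorithms_def A_def[abs_def])
  next
    case False
    obtain idx where idx: "bij_betw idx {1..card S} S"
      using ex_bij_betw_nat_finite_1[OF S(1)] by blast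
    define \<phi> where "\<phi> z x = (\<Sum>k\<in>{1..card S}. z k * eigenfunction (idx k) x)" for z :: "nat \<Rightarrow> real" and x
    define L where "L k f = ip f (eigenfunction (idx k))" for k f
    have "A = (\<lambda>f. \<phi> (\<lambda>k\<in>{1..card S}. L k f))"
    proof (intro ext)
      fix f x
      have "A f x = (\<Sum>k\<in>{1..card S}. ip f (eigenfunction (idx k)) * eigenfunction (idx k) x)"
        unfolding A_def by (rule sum.reindex_bij_betw[OF idx, symmetric])
      then show "A f x = \<phi> (\<lambda>k\<in>{1..card S}. L k f) x"
        by (simp add: \<phi>_def L_def)
    qed
    moreover have "\<forall>k\<in>{1..card S}. continuous_linear_functional H ip (L k)"
    proof
      fix k
      assume that: "k \<in> {1..card S}"
      have "idx k \<in> I"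
        using idx S(2) that by (auto simp: bij_betw_def)
      then show "continuous_linear_functional H ip (L k)"
        unfolding L_def[abs_def] by (intro continuous_linear_functional_ip eigenfunction_in_space(1))
    qed
    moreover have "\<phi> \<in> measurable (\<Pi>\<^sub>M k\<in>{1..card S}. (borel :: real measure)) (L2_borel \<mu>)"
      unfolding \<phi>_def[abs_def] by (rule synthesis_measurable[OF idx S])
    ultimately have "\<exists>\<phi> L. A = (\<lambda>f. \<phi> (\<lambda>k\<in>{1..card S}. L k f)) \<and>
        (\<forall>k\<in>{1..card S}. continuous_linear_functional H ip (L k)) \<and>
        \<phi> \<in> measurable (\<Pi>\<^sub>M k\<in>{1..card S}. (borel :: real measure)) (L2_borel \<mu>)"
      by (intro exI[of _ \<phi>] exI[of _ L] conjI)
    then show ?thesis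
      by (simp only: algorithms_def False if_False mem_Collect_eq)
  qed
  then have "minimal_error \<mu> H ip (card S) \<le> worst_case_error \<mu> H ip A"
    unfolding minimal_error_def by (rule INF_lower)
  also have "\<dots> \<le> ennreal \<epsilon>"
    unfolding worst_case_error_def
  proof (rule SUP_least)
    fix f
    assume "f \<in> {f \<in> H. hnorm ip f \<le> 1}"
    then have f: "f \<in> H" "ip f f \<le> 1"
      using ip_le_one by auto
    have "(\<integral>x. (residual f S x)\<^sup>2 \<partial>\<mu>) \<le> \<epsilon>\<^sup>2 * ip f f"
      by (rule integral_residual_square_le[OF f(1) S small])
    also have "\<dots> \<le> \<epsilon>\<^sup>2 * 1"
      using f(2) by (intro mult_left_mono) auto
    finally have "L2_norm \<mu> (residual f S) \<le> \<epsilon>"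
      using \<epsilon> by (auto simp: L2_norm_def intro!: real_le_lsqrt)
    then show "ennreal (L2_norm \<mu> (\<lambda>x. f x - A f x)) \<le> ennreal \<epsilon>"
      by (simp add: residual_def[abs_def] A_def ennreal_leI)
  qed
  finally show ?thesis .
qed

text \<open>
  Applied to a function \<open>f\<close> and the common output \<open>g\<close> of an algorithm for \<open>f\<close> and \<open>- f\<close>: one of the two
  errors is at least the norm of \<open>f\<close>.
\<close>

lemma parallelogram_L2:
  assumes "f \<in> L2_space \<mu>" "g \<in> L2_space \<mu>"
  shows "(L2_norm \<mu> (\<lambda>x. f x - g x))\<^sup>2 + (L2_norm \<mu> (\<lambda>x. - f x - g x))\<^sup>2 =
    2 * (L2_norm \<mu> f)\<^sup>2 + 2 * (L2_norm \<mu> g)\<^sup>2"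
proof -
  have [measurable]: "f \<in> borel_measurable \<mu>" "g \<in> borel_measurable \<mu>"
    and int: "integrable \<mu> (\<lambda>x. (f x)\<^sup>2)" "integrable \<mu> (\<lambda>x. (g x)\<^sup>2)"
    using assms by (auto simp: L2_space_def)
  have fg: "integrable \<mu> (\<lambda>x. f x * g x)"
  proof (rule Bochner_Integration.integrable_bound[OF Bochner_Integration.integrable_add[OF int]])
    show "AE x in \<mu>. norm (f x * g x) \<le> norm ((f x)\<^sup>2 + (g x)\<^sup>2)"
    proof (rule AE_I2)
      fix x
      have "\<bar>f x\<bar> * \<bar>g x\<bar> \<le> \<bar>f x\<bar>\<^sup>2 + \<bar>g x\<bar>\<^sup>2"
        using sum_squares_bound[of "\<bar>f x\<bar>" "\<bar>g x\<bar>"] mult_nonneg_nonneg[of "\<bar>f x\<bar>" "\<bar>g x\<bar>"]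
        by linarith
      then show "norm (f x * g x) \<le> norm ((f x)\<^sup>2 + (g x)\<^sup>2)"
        by (simp add: abs_mult)
    qed
  qed measurable
  have sq: "(L2_norm \<mu> h)\<^sup>2 = (\<integral>x. (h x)\<^sup>2 \<partial>\<mu>)" for h
    by (simp add: L2_norm_def)
  have "(\<integral>x. (f x - g x)\<^sup>2 \<partial>\<mu>) = (\<integral>x. ((f x)\<^sup>2 + (g x)\<^sup>2) - 2 * (f x * g x) \<partial>\<mu>)"
    by (simp add: power2_diff algebra_simps)
  also have "\<dots> = (\<integral>x. (f x)\<^sup>2 \<partial>\<mu>) + (\<integral>x. (g x)\<^sup>2 \<partial>\<mu>) - 2 * (\<integral>x. f x * g x \<partial>\<mu>)"
    using int fg by simp
  finally have 1: "(\<integral>x. (f x - g x)\<^sup>2 \<partial>\<mu>) =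
    (\<integral>x. (f x)\<^sup>2 \<partial>\<mu>) + (\<integral>x. (g x)\<^sup>2 \<partial>\<mu>) - 2 * (\<integral>x. f x * g x \<partial>\<mu>)" .
  have "(\<integral>x. (- f x - g x)\<^sup>2 \<partial>\<mu>) = (\<integral>x. ((f x)\<^sup>2 + (g x)\<^sup>2) + 2 * (f x * g x) \<partial>\<mu>)"
    by (simp add: power2_diff algebra_simps)
  also have "\<dots> = (\<integral>x. (f x)\<^sup>2 \<partial>\<mu>) + (\<integral>x. (g x)\<^sup>2 \<partial>\<mu>) + 2 * (\<integral>x. f x * g x \<partial>\<mu>)"
    using int fg by simp
  finally have "(\<integral>x. (- f x - g x)\<^sup>2 \<partial>\<mu>) =
    (\<integral>x. (f x)\<^sup>2 \<partial>\<mu>) + (\<integral>x. (g x)\<^sup>2 \<partial>\<mu>) + 2 * (\<integral>x. f x * g x \<partial>\<mu>)" .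
  with 1 show ?thesis
    unfolding sq by simp
qed

text \<open>
  The functionals of the algorithm impose \<open>n\<close> homogeneous linear equations on the \<open>card S\<close> coefficients.
  A nontrivial solution has zero information, hence the same information as its negative.  The
  algorithm without information is constant and fits the same pattern with \<open>n = 0\<close>.
\<close>

lemma unit_combination_invisible_to_algorithm:
  assumes A: "A \<in> algorithms \<mu> H ip n" and S: "finite S" "S \<subseteq> I" "n < card S"
  obtains c where "(\<Sum>i\<in>S. (c i)\<^sup>2) = 1"
    and "A (\<lambda>x. \<Sum>i\<in>S. c i * eigenfunction i x) = A (\<lambda>x. - (\<Sum>i\<in>S. c i * eigenfunction i x))"
    and "A (\<lambda>x. \<Sum>i\<in>S. c i * eigenfunction i x) \<in> L2_space \<mu>"
proof -
  have "\<exists>L. (\<forall>k\<in>{1..n}. continuous_linear_functional H ip (L k)) \<and>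
      (\<forall>f g. (\<forall>k\<in>{1..n}. L k f = L k g) \<longrightarrow> A f = A g) \<and> (\<forall>f. A f \<in> L2_space \<mu>)"
  proof (cases "n = 0")
    case True
    then have "A = (\<lambda>f x. 0)"
      using A by (simp add: algorithms_def)
    moreover have "(\<lambda>x. 0) \<in> L2_space \<mu>"
      by (simp add: L2_space_def)
    ultimately show ?thesis
      using True by auto
  next
    case False
    then obtain \<phi> L where AL: "A = (\<lambda>f. \<phi> (\<lambda>i\<in>{1..n}. L i f))"
      "\<forall>k\<in>{1..n}. continuous_linear_functional H ip (L k)"
      "\<phi> \<in> measurable (\<Pi>\<^sub>M i\<in>{1..n}. (borel :: real measure)) (L2_borel \<mu>)"
      using A unfolding algorithms_def by auto
    have "A f = A g" if "\<forall>k\<in>{1..n}. L k f = L k g" for f g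
    proof -
      have "(\<lambda>i\<in>{1..n}. L i f) = (\<lambda>i\<in>{1..n}. L i g)"
        using that by (intro restrict_ext) auto
      then show ?thesis
        by (simp add: AL(1))
    qed
    moreover have "A f \<in> L2_space \<mu>" for f
    proof -
      have "(\<lambda>i\<in>{1..n}. L i f) \<in> space (\<Pi>\<^sub>M i\<in>{1..n}. (borel :: real measure))"
        by (simp add: space_PiM)
      from measurable_space[OF AL(3) this] show ?thesis
        unfolding AL(1) L2_borel_def by (simp add: space_measure_of_conv)
    qed
    ultimately show ?thesis
      using AL(2) by blast
  qed
  then obtain L where L: "\<And>k. k \<in> {1..n} \<Longrightarrow> continuous_linear_functional H ip (L k)"
    and A_eq: "\<And>f g. (\<And>k. k \<in> {1..n} \<Longrightarrow> L k f = L k g) \<Longrightarrow> A f = A g"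
    and A_L2: "\<And>f. A f \<in> L2_space \<mu>"
    by blast
  obtain c where c: "\<exists>i\<in>S. c i \<noteq> 0"
    "\<And>k. k \<in> {1..n} \<Longrightarrow> (\<Sum>i\<in>S. L k (eigenfunction i) * c i) = 0"
    using underdetermined_system_solution[OF S(1,3), of "\<lambda>k i. L k (eigenfunction i)"] by blast
  have L_add: "L k (\<lambda>x. f x + g x) = L k f + L k g"
    and L_scale: "L k (\<lambda>x. t * f x) = t * L k f" if "k \<in> {1..n}" "f \<in> H" "g \<in> H" for k f g t
    using L[OF that(1)] that(2,3) unfolding continuous_linear_functional_def by simp_all
  define s where "s = sqrt (\<Sum>i\<in>S. (c i)\<^sup>2)"
  have s: "s > 0"
    using c(1) S(1) by (auto simp: s_def intro: sum_pos2)
  define c' where "c' i = c i / s" for i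
  have L_sum: "L k (\<lambda>x. \<Sum>i\<in>F. u i * eigenfunction i x) = (\<Sum>i\<in>F. u i * L k (eigenfunction i))"
    if "finite F" "F \<subseteq> S" "k \<in> {1..n}" for k u F
    using that
  proof (induction F)
    case empty
    then show ?case
      using L_scale[of k "\<lambda>x. 0" "\<lambda>x. 0" 0] zero_closed by simp
  next
    case (insert i F)
    have i: "eigenfunction i \<in> H"
      using insert S(2) eigenfunction_in_space(1) by auto
    have F: "(\<lambda>x. \<Sum>i\<in>F. u i * eigenfunction i x) \<in> H"
      using insert S(2) by (intro combination_in_space) auto
    have "L k (\<lambda>x. u i * eigenfunction i x + (\<Sum>i\<in>F. u i * eigenfunction i x)) =
        L k (\<lambda>x. u i * eigenfunction i x) + L k (\<lambda>x. \<Sum>i\<in>F. u i * eigenfunction i x)"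
      by (rule L_add[OF insert.prems(2) scale_closed[OF i] F])
    moreover have "L k (\<lambda>x. u i * eigenfunction i x) = u i * L k (eigenfunction i)"
      by (rule L_scale[OF insert.prems(2) i i])
    ultimately show ?case
      using insert by simp
  qed
  have zero: "L k (\<lambda>x. \<Sum>i\<in>S. (t * c' i) * eigenfunction i x) = 0" if "k \<in> {1..n}" for k t
  proof -
    have "(\<Sum>i\<in>S. (t * c' i) * L k (eigenfunction i)) = (t / s) * (\<Sum>i\<in>S. L k (eigenfunction i) * c i)"
      by (simp add: c'_def sum_distrib_left mult_ac)
    then show ?thesis
      using L_sum[OF S(1) subset_refl that, of "\<lambda>i. t * c' i"] c(2)[OF that] by simp
  qed
  show thesis
  proof (rule that[of c'])
    have "(\<Sum>i\<in>S. (c' i)\<^sup>2) = (\<Sum>i\<in>S. (c i)\<^sup>2) / s\<^sup>2"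
      by (simp add: c'_def power_divide sum_divide_distrib)
    also have "s\<^sup>2 = (\<Sum>i\<in>S. (c i)\<^sup>2)"
      by (simp add: s_def sum_nonneg)
    finally show "(\<Sum>i\<in>S. (c' i)\<^sup>2) = 1"
      using s by (simp add: s_def)
    have "A (\<lambda>x. \<Sum>i\<in>S. (1 * c' i) * eigenfunction i x) = A (\<lambda>x. \<Sum>i\<in>S. (-1 * c' i) * eigenfunction i x)"
      by (rule A_eq) (simp only: zero)
    then show "A (\<lambda>x. \<Sum>i\<in>S. c' i * eigenfunction i x) = A (\<lambda>x. - (\<Sum>i\<in>S. c' i * eigenfunction i x))"
      by (simp add: sum_negf)
  qed (rule A_L2)
qed

lemma minimal_error_ge:
  assumes S: "finite S" "S \<subseteq> I" "n < card S" and large: "\<And>i. i \<in> S \<Longrightarrow> \<delta> \<le> lam i"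
  shows "ennreal (sqrt \<delta>) \<le> minimal_error \<mu> H ip n"
  unfolding minimal_error_def
proof (rule INF_greatest)
  fix A
  assume "A \<in> algorithms \<mu> H ip n"
  from unit_combination_invisible_to_algorithm[OF this S] obtain c where c: "(\<Sum>i\<in>S. (c i)\<^sup>2) = 1"
    and A: "A (\<lambda>x. \<Sum>i\<in>S. c i * eigenfunction i x) = A (\<lambda>x. - (\<Sum>i\<in>S. c i * eigenfunction i x))"
      "A (\<lambda>x. \<Sum>i\<in>S. c i * eigenfunction i x) \<in> L2_space \<mu>" .
  define f where "f = (\<lambda>x. \<Sum>i\<in>S. c i * eigenfunction i x)"
  define g where "g = A f"
  have g: "g = A (\<lambda>x. - f x)" "g \<in> L2_space \<mu>"
    using A by (simp_all add: f_def g_def)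
  have f: "f \<in> H" "ip f f = 1"
    unfolding f_def using combination_in_space[OF S(1,2)] ip_combination_self[OF S(1,2)] c by simp_all
  have minus_f: "(\<lambda>x. - f x) \<in> H" "ip (\<lambda>x. - f x) (\<lambda>x. - f x) = 1"
  proof -
    have "- f x = (\<Sum>i\<in>S. - c i * eigenfunction i x)" for x
      by (simp add: f_def sum_negf)
    then show "(\<lambda>x. - f x) \<in> H" "ip (\<lambda>x. - f x) (\<lambda>x. - f x) = 1"
      using combination_in_space[OF S(1,2), of "\<lambda>i. - c i"]
        ip_combination_self[OF S(1,2), of "\<lambda>i. - c i"] c by simp_all
  qed
  have "\<delta> = \<delta> * (\<Sum>i\<in>S. (c i)\<^sup>2)"
    by (simp add: c)
  also have "\<dots> \<le> (\<Sum>i\<in>S. (c i)\<^sup>2 * lam i)"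
    unfolding sum_distrib_left mult.commute[of \<delta>] using large by (intro sum_mono mult_left_mono) auto
  also have "\<dots> = (\<integral>x. (f x)\<^sup>2 \<partial>\<mu>)"
    unfolding f_def by (rule integral_combination_square[OF S(1,2), symmetric])
  also have "\<dots> = (L2_norm \<mu> f)\<^sup>2"
    by (simp add: L2_norm_def)
  finally have "2 * \<delta> \<le> (L2_norm \<mu> (\<lambda>x. f x - g x))\<^sup>2 + (L2_norm \<mu> (\<lambda>x. - f x - g x))\<^sup>2"
    using parallelogram_L2[OF space_subset_L2[OF f(1)] g(2)] zero_le_power2[of "L2_norm \<mu> g"]
    by linarith
  then have "\<delta> \<le> (L2_norm \<mu> (\<lambda>x. f x - g x))\<^sup>2 \<or> \<delta> \<le> (L2_norm \<mu> (\<lambda>x. - f x - g x))\<^sup>2"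
    by linarith
  then have "sqrt \<delta> \<le> L2_norm \<mu> (\<lambda>x. f x - g x) \<or> sqrt \<delta> \<le> L2_norm \<mu> (\<lambda>x. - f x - g x)"
    by (auto simp: L2_norm_def intro: real_le_lsqrt)
  then obtain u where u: "u \<in> H" "ip u u = 1" "sqrt \<delta> \<le> L2_norm \<mu> (\<lambda>x. u x - A u x)"
  proof
    assume "sqrt \<delta> \<le> L2_norm \<mu> (\<lambda>x. f x - g x)"
    then show thesis
      using that[of f] f by (simp add: g_def)
  next
    assume "sqrt \<delta> \<le> L2_norm \<mu> (\<lambda>x. - f x - g x)"
    then show thesis
      using that[of "\<lambda>x. - f x"] minus_f by (simp add: g(1))
  qed
  have "ennreal (sqrt \<delta>) \<le> ennreal (L2_norm \<mu> (\<lambda>x. u x - A u x))"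
    by (rule ennreal_leI[OF u(3)])
  also have "\<dots> \<le> worst_case_error \<mu> H ip A"
    unfolding worst_case_error_def using u(1,2) by (intro SUP_upper) (simp add: hnorm_def)
  finally show "ennreal (sqrt \<delta>) \<le> worst_case_error \<mu> H ip A" .
qed

lemma finite_large_eigenvalues:
  assumes "0 < r"
  shows "finite {i \<in> I. r < lam i}"
proof (rule ccontr)
  assume inf: "infinite {i \<in> I. r < lam i}"
  obtain m :: nat where m: "(\<Sum>\<^sub>\<infinity>i\<in>I. lam i) < real m * r"
    using reals_Archimedean3[OF assms] by blast
  obtain T where T: "T \<subseteq> {i \<in> I. r < lam i}" "finite T" "card T = m"
    using infinite_arbitrarily_large[OF inf] by blast
  have "real m * r = (\<Sum>i\<in>T. r)"
    using T by simp
  also have "\<dots> \<le> (\<Sum>i\<in>T. lam i)"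
    using T by (intro sum_mono) auto
  also have "\<dots> \<le> (\<Sum>\<^sub>\<infinity>i\<in>I. lam i)"
    using T lam_pos by (intro finite_sum_le_infsum[OF lam_summable]) (auto intro: less_imp_le)
  finally show False
    using m by simp
qed

text \<open>
  The least of the finitely many eigenvalues above \<open>\<epsilon>\<^sup>2\<close> still exceeds \<open>\<epsilon>\<^sup>2\<close>, so with fewer functionals
  the error is bounded away from \<open>\<epsilon>\<close>, uniformly over all algorithms.
\<close>

theorem information_complexity_eq_card:
  assumes "0 < \<epsilon>"
  shows "information_complexity \<mu> H ip \<epsilon> = card {i \<in> I. \<epsilon>\<^sup>2 < lam i}"
proof -
  define S where "S = {i \<in> I. \<epsilon>\<^sup>2 < lam i}"
  have S: "finite S" "S \<subseteq> I"
    using finite_large_eigenvalues assms by (auto simp: S_def)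
  show ?thesis
    unfolding information_complexity_def S_def[symmetric]
  proof (rule Least_equality)
    show "minimal_error \<mu> H ip (card S) \<le> ennreal \<epsilon>"
      using assms by (intro minimal_error_le S) (auto simp: S_def)
  next
    fix n
    assume n: "minimal_error \<mu> H ip n \<le> ennreal \<epsilon>"
    show "card S \<le> n"
    proof (rule ccontr)
      assume "\<not> card S \<le> n"
      then have less: "n < card S" by simp
      then have "S \<noteq> {}" by auto
      define \<delta> where "\<delta> = Min (lam ` S)"
      have \<delta>: "\<epsilon>\<^sup>2 < \<delta>"
        unfolding \<delta>_def using S(1) \<open>S \<noteq> {}\<close> by (subst Min_gr_iff) (auto simp: S_def)
      have "ennreal (sqrt \<delta>) \<le> minimal_error \<mu> H ip n"
        using S(1) by (intro minimal_error_ge[OF S less]) (simp add: \<delta>_def)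
      with n have "ennreal (sqrt \<delta>) \<le> ennreal \<epsilon>"
        by (rule order_trans[rotated])
      then have "sqrt \<delta> \<le> \<epsilon>"
        using assms by simp
      with \<delta> show False
        using real_less_rsqrt by fastforce
    qed
  qed
qed

end

section \<open>Counting integer points by exponential weights\<close>

definition exponent :: "(nat \<Rightarrow> real) \<Rightarrow> (nat \<Rightarrow> real) \<Rightarrow> nat \<Rightarrow> (nat \<Rightarrow> int) \<Rightarrow> real" where
  "exponent a b d h = (\<Sum>k=1..d. a k * real_of_int \<bar>h k\<bar> powr b k)"

definition index_count :: "(nat \<Rightarrow> real) \<Rightarrow> (nat \<Rightarrow> real) \<Rightarrow> nat \<Rightarrow> real \<Rightarrow> nat" where
  "index_count a b d R = card {h \<in> {1..d} \<rightarrow>\<^sub>E UNIV. exponent a b d h < R}"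

definition decay_sum :: "real \<Rightarrow> real \<Rightarrow> real" where
  "decay_sum \<beta> \<theta> = (\<Sum>n. exp (- \<theta> * real (Suc n) powr \<beta>))"

text \<open>
  The maximum of \<open>u powr r * exp (- u)\<close> is attained at \<open>u = r\<close>, and \<open>r powr r\<close> bounds it.
\<close>

lemma exp_minus_le_powr:
  fixes u r :: real
  assumes "u > 0" "r > 0"
  shows "exp (- u) \<le> (r / u) powr r"
proof -
  have "r * ln (u / r) \<le> r * (u / r - 1)"
    using assms by (intro mult_left_mono ln_le_minus_one) auto
  also have "\<dots> = u - r"
    using assms by (simp add: right_diff_distrib)
  finally have "r * ln (u / r) \<le> u"
    using assms by linarith
  then have "- u \<le> r * ln (r / u)"
    using assms by (simp add: ln_div algebra_simps)
  then show ?thesis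
    using assms by (simp add: powr_def)
qed

text \<open>
  The exponent \<open>r\<close> remains free: a large \<open>r\<close> makes the series summable, and the resulting power
  of \<open>\<theta>\<close> is reduced afterwards by taking logarithms.
\<close>

lemma decay_term_le:
  assumes "\<theta> > 0" "\<beta> > 0" "r > 0" "r * \<beta> \<ge> 2"
  shows "exp (- \<theta> * real (Suc n) powr \<beta>) \<le> (r / \<theta>) powr r * real (Suc n) powr (-2)"
proof -
  have "exp (- (\<theta> * real (Suc n) powr \<beta>)) \<le> (r / (\<theta> * real (Suc n) powr \<beta>)) powr r"
    using assms by (intro exp_minus_le_powr) auto
  also have "\<dots> = (r / \<theta>) powr r * real (Suc n) powr (- (r * \<beta>))"
    using assms by (simp add: powr_divide powr_mult powr_powr powr_minus field_simps)
  also have "\<dots> \<le> (r / \<theta>) powr r * real (Suc n) powr (-2)"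
    using assms by (intro mult_left_mono powr_mono) auto
  finally show ?thesis by simp
qed

lemma summable_inverse_square: "summable (\<lambda>n. real (Suc n) powr (-2))"
  using summable_real_powr_iff[of "-2"] summable_Suc_iff[of "\<lambda>n. real n powr (-2)"] by simp

lemma decay_summable:
  assumes "\<theta> > 0" "\<beta> > 0"
  shows "summable (\<lambda>n. exp (- \<theta> * real (Suc n) powr \<beta>))"
proof (rule summable_comparison_test')
  show "summable (\<lambda>n. ((2 / \<beta>) / \<theta>) powr (2 / \<beta>) * real (Suc n) powr (-2))"
    by (intro summable_mult summable_inverse_square)
  show "norm (exp (- \<theta> * real (Suc n) powr \<beta>)) \<le> ((2 / \<beta>) / \<theta>) powr (2 / \<beta>) * real (Suc n) powr (-2)"
    if "n \<ge> 0" for n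
    using decay_term_le[of \<theta> \<beta> "2 / \<beta>" n] assms by simp
qed

lemma decay_sum_nonneg: "\<theta> > 0 \<Longrightarrow> \<beta> > 0 \<Longrightarrow> 0 \<le> decay_sum \<beta> \<theta>"
  unfolding decay_sum_def by (intro suminf_nonneg decay_summable) auto

lemma decay_sum_antimono:
  assumes "0 < \<theta>" "\<theta> \<le> \<theta>'" "\<beta> > 0"
  shows "decay_sum \<beta> \<theta>' \<le> decay_sum \<beta> \<theta>"
  unfolding decay_sum_def using assms by (intro suminf_le decay_summable) auto

text \<open>
  As \<open>n powr \<beta> \<ge> 1\<close>, half of each exponent is at least \<open>\<theta> / 2\<close> and can be taken out of the sum.
\<close>

lemma decay_sum_le_exp:
  assumes "\<theta> > 0" "\<beta> > 0"
  shows "decay_sum \<beta> \<theta> \<le> exp (- \<theta> / 2) * decay_sum \<beta> (\<theta> / 2)"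
proof -
  have s: "summable (\<lambda>n. exp (- (\<theta> / 2) * real (Suc n) powr \<beta>))"
    using decay_summable[of "\<theta> / 2" \<beta>] assms by simp
  have "decay_sum \<beta> \<theta> \<le> (\<Sum>n. exp (- \<theta> / 2) * exp (- (\<theta> / 2) * real (Suc n) powr \<beta>))"
    unfolding decay_sum_def
  proof (rule suminf_le)
    fix n
    have "real (Suc n) powr \<beta> \<ge> 1"
      using assms by (simp add: ge_one_powr_ge_zero)
    then have "\<theta> / 2 * 1 \<le> \<theta> / 2 * real (Suc n) powr \<beta>"
      using assms by (intro mult_left_mono) auto
    then show "exp (- \<theta> * real (Suc n) powr \<beta>) \<le> exp (- \<theta> / 2) * exp (- (\<theta> / 2) * real (Suc n) powr \<beta>)"
      by (simp add: exp_add[symmetric])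
  qed (rule decay_summable[OF assms] summable_mult[OF s])+
  also have "\<dots> = exp (- \<theta> / 2) * decay_sum \<beta> (\<theta> / 2)"
    unfolding decay_sum_def by (rule suminf_mult[OF s])
  finally show ?thesis .
qed

lemma ln_one_plus_le_powr:
  fixes q y :: real
  assumes "0 < q" "q \<le> 1" "0 \<le> y"
  shows "ln (1 + y) \<le> (1 + 1 / q) * y powr q"
proof (cases "y \<le> 1")
  case True
  have "ln (1 + y) \<le> y"
    using assms by (intro ln_add_one_self_le_self)
  also have "y \<le> y powr q"
    using powr_mono'[of q 1 y] assms True by simp
  also have "\<dots> \<le> (1 + 1 / q) * y powr q"
    using assms by (simp add: distrib_right)
  finally show ?thesis .
next
  case False
  then have y: "y > 1" by simp
  have "ln (1 + y) \<le> ln (2 * y)"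
    using y by (subst ln_le_cancel_iff) auto
  also have "\<dots> = ln 2 + ln (y powr q) / q"
    using y assms by (simp add: ln_mult ln_powr)
  also have "\<dots> \<le> 1 + (y powr q - 1) / q"
    using ln_le_minus_one[of "y powr q"] ln_le_minus_one[of "2::real"] assms y
    by (intro add_mono divide_right_mono) auto
  also have "\<dots> \<le> y powr q + y powr q / q"
    using y assms by (intro add_mono divide_right_mono) (auto simp: ge_one_powr_ge_zero)
  finally show ?thesis
    by (simp add: distrib_right)
qed

text \<open>
  A bound of \<open>decay_sum \<beta> \<theta>\<close> by a constant times \<open>\<theta> powr (- r)\<close> needs a large \<open>r\<close>, but \<open>ln (1 + y)\<close> is at
  most a constant times \<open>y powr (\<alpha> / r)\<close>, so every exponent \<open>\<alpha> > 0\<close> is possible.  Small exponents control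
  \<open>\<theta>\<close> near \<open>0\<close>, large ones control large \<open>\<theta>\<close>.
\<close>

lemma ln_decay_sum_le_powr:
  assumes "\<beta> > 0" "\<alpha> > 0"
  obtains C where "C \<ge> 0" "\<And>\<theta>. \<theta> > 0 \<Longrightarrow> ln (1 + 2 * decay_sum \<beta> \<theta>) \<le> C * \<theta> powr (- \<alpha>)"
proof -
  define r where "r = \<alpha> + 2 / \<beta>"
  define q where "q = \<alpha> / r"
  define Z where "Z = (\<Sum>n. real (Suc n) powr (-2))"
  define C where "C = (1 + 1 / q) * (2 * r powr r * Z) powr q"
  have r: "r > 0" "r * \<beta> \<ge> 2"
    using assms by (simp_all add: r_def field_simps add_pos_pos)
  have "\<alpha> \<le> r"
    using assms by (simp add: r_def)
  then have q: "0 < q" "q \<le> 1" "r * q = \<alpha>"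
    using assms r by (simp_all add: q_def)
  have Z: "Z \<ge> 0"
    unfolding Z_def by (intro suminf_nonneg summable_inverse_square) auto
  have "C \<ge> 0"
    using q by (simp add: C_def)
  moreover have "ln (1 + 2 * decay_sum \<beta> \<theta>) \<le> C * \<theta> powr (- \<alpha>)" if \<theta>: "\<theta> > 0" for \<theta>
  proof -
    have "decay_sum \<beta> \<theta> \<le> (\<Sum>n. (r / \<theta>) powr r * real (Suc n) powr (-2))"
      unfolding decay_sum_def using \<theta> assms r
      by (intro suminf_le decay_term_le decay_summable summable_mult summable_inverse_square)
    also have "\<dots> = (r / \<theta>) powr r * Z"
      unfolding Z_def by (rule suminf_mult[OF summable_inverse_square])
    finally have D: "2 * decay_sum \<beta> \<theta> \<le> (2 * r powr r * Z) * \<theta> powr (- r)"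
      using r \<theta> by (simp add: powr_divide powr_minus field_simps)
    have D0: "0 \<le> 2 * decay_sum \<beta> \<theta>"
      using decay_sum_nonneg[OF \<theta> assms(1)] by simp
    have "ln (1 + 2 * decay_sum \<beta> \<theta>) \<le> (1 + 1 / q) * (2 * decay_sum \<beta> \<theta>) powr q"
      by (rule ln_one_plus_le_powr[OF q(1,2) D0])
    also have "\<dots> \<le> (1 + 1 / q) * ((2 * r powr r * Z) * \<theta> powr (- r)) powr q"
      using q D D0 by (intro mult_left_mono powr_mono2) auto
    also have "\<dots> = C * \<theta> powr (- \<alpha>)"
      using Z \<theta> q(3) by (simp add: C_def powr_mult powr_powr)
    finally show ?thesis .
  qed
  ultimately show thesis
    using that by blast
qed

lemma symmetric_interval_sum_le:
  assumes "\<theta> > 0" "\<beta> > 0" "\<beta> \<le> b"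
  shows "(\<Sum>j\<in>{- int L..int L}. exp (- \<theta> * real_of_int \<bar>j\<bar> powr b)) \<le> 1 + 2 * decay_sum \<beta> \<theta>"
proof -
  have "(\<Sum>j\<in>{- int L..int L}. exp (- \<theta> * real_of_int \<bar>j\<bar> powr b)) \<le>
      1 + 2 * (\<Sum>n<L. exp (- \<theta> * real (Suc n) powr \<beta>))"
  proof (induction L)
    case 0
    then show ?case by simp
  next
    case (Suc L)
    have "{- int (Suc L)..int (Suc L)} = insert (int (Suc L)) (insert (- int (Suc L)) {- int L..int L})"
      by auto
    then have "(\<Sum>j\<in>{- int (Suc L)..int (Suc L)}. exp (- \<theta> * real_of_int \<bar>j\<bar> powr b)) =
        2 * exp (- \<theta> * real (Suc L) powr b) + (\<Sum>j\<in>{- int L..int L}. exp (- \<theta> * real_of_int \<bar>j\<bar> powr b))"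
      by (simp add: add.commute)
    also have "\<dots> \<le> 2 * exp (- \<theta> * real (Suc L) powr \<beta>) + (1 + 2 * (\<Sum>n<L. exp (- \<theta> * real (Suc n) powr \<beta>)))"
      using assms by (intro add_mono Suc.IH) (auto intro!: powr_mono)
    also have "\<dots> = 1 + 2 * (\<Sum>n<Suc L. exp (- \<theta> * real (Suc n) powr \<beta>))"
      by simp
    finally show ?case .
  qed
  also have "(\<Sum>n<L. exp (- \<theta> * real (Suc n) powr \<beta>)) \<le> decay_sum \<beta> \<theta>"
    unfolding decay_sum_def using assms by (intro sum_le_suminf decay_summable) auto
  finally show ?thesis by simp
qed

text \<open>
  A finite set of indices fits into a box, and over a box the sum of products is the product of
  one-dimensional sums.
\<close>

lemma sum_exp_exponent_le:
  assumes F: "finite F" "F \<subseteq> {1..d} \<rightarrow>\<^sub>E UNIV" and \<tau>: "\<tau> > 0" and \<beta>: "\<beta> > 0"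
    and a: "\<And>k. k \<in> {1..d} \<Longrightarrow> 0 < a k" and b: "\<And>k. k \<in> {1..d} \<Longrightarrow> \<beta> \<le> b k"
  shows "(\<Sum>h\<in>F. exp (- \<tau> * exponent a b d h)) \<le> (\<Prod>k=1..d. 1 + 2 * decay_sum \<beta> (\<tau> * a k))"
proof -
  have "finite ((\<lambda>(h, k). nat \<bar>h k\<bar>) ` (F \<times> {1..d}))"
    using F(1) by simp
  then obtain L where "\<forall>m\<in>(\<lambda>(h, k). nat \<bar>h k\<bar>) ` (F \<times> {1..d}). m \<le> L"
    using finite_nat_set_iff_bounded_le by blast
  then have L: "\<bar>h k\<bar> \<le> int L" if "h \<in> F" "k \<in> {1..d}" for h k
  proof -
    have "nat \<bar>h k\<bar> \<in> (\<lambda>(h, k). nat \<bar>h k\<bar>) ` (F \<times> {1..d})"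
      using that by (intro image_eqI[of _ _ "(h, k)"]) auto
    with \<open>\<forall>m\<in>_. m \<le> L\<close> have "nat \<bar>h k\<bar> \<le> L"
      by blast
    then show ?thesis
      by simp
  qed
  define box where "box = {1..d} \<rightarrow>\<^sub>E {- int L..int L}"
  have "F \<subseteq> box"
  proof
    fix h
    assume "h \<in> F"
    then have "h k \<in> {- int L..int L}" if "k \<in> {1..d}" for k
      using L[of h k] that by (auto simp: abs_le_iff)
    moreover have "h \<in> extensional {1..d}"
      using F(2) \<open>h \<in> F\<close> by (auto simp: PiE_iff)
    ultimately show "h \<in> box"
      by (simp add: box_def PiE_iff)
  qed
  moreover have "finite box"
    by (simp add: box_def finite_PiE)
  ultimately have "(\<Sum>h\<in>F. exp (- \<tau> * exponent a b d h)) \<le> (\<Sum>h\<in>box. exp (- \<tau> * exponent a b d h))"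
    by (intro sum_mono2) auto
  also have "\<dots> = (\<Sum>h\<in>box. \<Prod>k=1..d. exp (- (\<tau> * a k) * real_of_int \<bar>h k\<bar> powr b k))"
    by (intro sum.cong refl)
      (simp add: exponent_def exp_sum[symmetric] sum_distrib_left sum_negf mult.assoc)
  also have "\<dots> = (\<Prod>k=1..d. \<Sum>j\<in>{- int L..int L}. exp (- (\<tau> * a k) * real_of_int \<bar>j\<bar> powr b k))"
    unfolding box_def by (rule prod_sum_PiE[symmetric]) auto
  also have "\<dots> \<le> (\<Prod>k=1..d. 1 + 2 * decay_sum \<beta> (\<tau> * a k))"
    using \<tau> \<beta> a b by (intro prod_mono conjI sum_nonneg symmetric_interval_sum_le) auto
  finally show ?thesis .
qed

text \<open>
  On the index set \<open>exp (\<tau> * (R - exponent a b d h))\<close> is at least \<open>1\<close>, so its sum bounds the cardinality.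
\<close>

lemma index_set_finite_card_le:
  assumes \<tau>: "\<tau> > 0" and \<beta>: "\<beta> > 0"
    and a: "\<And>k. k \<in> {1..d} \<Longrightarrow> 0 < a k" and b: "\<And>k. k \<in> {1..d} \<Longrightarrow> \<beta> \<le> b k"
  shows "finite {h \<in> {1..d} \<rightarrow>\<^sub>E UNIV. exponent a b d h < R}"
    and "real (index_count a b d R) \<le> exp (\<tau> * R) * (\<Prod>k=1..d. 1 + 2 * decay_sum \<beta> (\<tau> * a k))"
proof -
  let ?S = "{h \<in> {1..d} \<rightarrow>\<^sub>E UNIV. exponent a b d h < R}"
  let ?P = "exp (\<tau> * R) * (\<Prod>k=1..d. 1 + 2 * decay_sum \<beta> (\<tau> * a k))"
  have le: "real (card F) \<le> ?P" if F: "finite F" "F \<subseteq> ?S" for F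
  proof -
    have "real (card F) = (\<Sum>h\<in>F. 1)" by simp
    also have "\<dots> \<le> (\<Sum>h\<in>F. exp (\<tau> * R) * exp (- \<tau> * exponent a b d h))"
      using F \<tau> by (intro sum_mono) (auto simp: exp_add[symmetric] intro!: mult_left_mono)
    also have "\<dots> = exp (\<tau> * R) * (\<Sum>h\<in>F. exp (- \<tau> * exponent a b d h))"
      by (simp add: sum_distrib_left)
    also have "\<dots> \<le> ?P"
      using F by (intro mult_left_mono sum_exp_exponent_le \<tau> \<beta> a b) auto
    finally show ?thesis .
  qed
  show fin: "finite ?S"
  proof (rule ccontr)
    assume inf: "infinite ?S"
    obtain m :: nat where m: "?P < real m"
      using reals_Archimedean2 by blast
    obtain F where F: "finite F" "card F = m" "F \<subseteq> ?S"
      using infinite_arbitrarily_large[OF inf] by blast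
    show False
      using le[OF F(1,3)] F(2) m by simp
  qed
  show "real (index_count a b d R) \<le> ?P"
    unfolding index_count_def by (rule le[OF fin subset_refl])
qed

lemma zero_index_in:
  assumes "R > 0"
  shows "(\<lambda>k\<in>{1..d}. 0) \<in> {h \<in> {1..d} \<rightarrow>\<^sub>E UNIV. exponent a b d h < R}"
  using assms by (auto simp: exponent_def)

lemma ln_index_count_le:
  assumes \<tau>: "\<tau> > 0" and \<beta>: "\<beta> > 0" and R: "R > 0"
    and a: "\<And>k. k \<in> {1..d} \<Longrightarrow> 0 < a k" and b: "\<And>k. k \<in> {1..d} \<Longrightarrow> \<beta> \<le> b k"
  shows "ln (real (index_count a b d R)) \<le> \<tau> * R + (\<Sum>k=1..d. ln (1 + 2 * decay_sum \<beta> (\<tau> * a k)))"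
proof -
  note * = index_set_finite_card_le[where \<tau> = \<tau> and \<beta> = \<beta> and d = d and a = a and b = b and R = R, OF \<tau> \<beta> a b]
  have pos: "0 < 1 + 2 * decay_sum \<beta> (\<tau> * a k)" if "k \<in> {1..d}" for k
    using decay_sum_nonneg[of "\<tau> * a k" \<beta>] \<tau> \<beta> a[OF that] by simp
  then have ne: "1 + 2 * decay_sum \<beta> (\<tau> * a k) \<noteq> 0" if "k \<in> {1..d}" for k
    using that less_irrefl by fastforce
  have "0 < index_count a b d R"
    unfolding index_count_def card_gt_0_iff using zero_index_in[OF R, of d a b] *(1) by blast
  then have "ln (real (index_count a b d R)) \<le>
      ln (exp (\<tau> * R) * (\<Prod>k=1..d. 1 + 2 * decay_sum \<beta> (\<tau> * a k)))"
    using *(2) by simp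
  also have "\<dots> = \<tau> * R + ln (\<Prod>k=1..d. 1 + 2 * decay_sum \<beta> (\<tau> * a k))"
    using pos by (subst ln_mult_pos) (auto intro: prod_pos)
  also have "ln (\<Prod>k=1..d. 1 + 2 * decay_sum \<beta> (\<tau> * a k)) = (\<Sum>k=1..d. ln (1 + 2 * decay_sum \<beta> (\<tau> * a k)))"
    by (rule ln_prod[OF finite_atLeastAtMost ne])
  finally show ?thesis .
qed

section \<open>Upper bounds for the number of integer points\<close>

text \<open>
  For fixed \<open>\<tau> = \<eta>\<close>, the sum over the coordinates is dominated by \<open>\<Sum>k. exp (- \<eta> * a k / 2)\<close>.  The
  hypothesis makes \<open>a k\<close> eventually larger than \<open>(4 / \<eta>) * ln k\<close>, so the terms are eventually at most
  \<open>k powr (- 2)\<close> and the sum is bounded independently of the dimension.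
\<close>

lemma ln_index_count_le_linear:
  assumes mono: "\<And>k. k \<ge> 1 \<Longrightarrow> a 1 \<le> a k" and a1: "0 < a 1"
    and \<beta>: "\<beta> > 0" and b: "\<And>k. k \<ge> 1 \<Longrightarrow> \<beta> \<le> b k"
    and lim: "(\<lambda>j. ln (real j) / a j) \<longlonglongrightarrow> 0" and \<eta>: "\<eta> > 0"
  shows "\<exists>C. \<forall>R>0. \<forall>d. ln (real (index_count a b d R)) \<le> \<eta> * R + C"
proof -
  have apos: "0 < a k" if "k \<ge> 1" for k
    using mono[OF that] a1 by linarith
  define w where "w k = exp (- (\<eta> * a k) / 2)" for k
  define D where "D = decay_sum \<beta> (\<eta> * a 1 / 2)"
  have D: "D \<ge> 0"
    unfolding D_def using \<eta> a1 \<beta> by (intro decay_sum_nonneg) auto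
  have "eventually (\<lambda>j. ln (real j) / a j < \<eta> / 4) sequentially"
    using lim \<eta> by (intro order_tendstoD) auto
  then have "eventually (\<lambda>j. norm (w j) \<le> real j powr (-2)) sequentially"
    using eventually_ge_at_top[of 1]
  proof eventually_elim
    case (elim j)
    then have "ln (real j) \<le> \<eta> * a j / 4"
      using apos[of j] by (simp add: field_simps)
    then have "exp (- (\<eta> * a j) / 2) \<le> exp (-2 * ln (real j))"
      by simp
    also have "\<dots> = real j powr (-2)"
      using elim by (simp add: powr_def)
    finally show ?case
      by (simp add: w_def)
  qed
  then have w: "summable w"
    by (rule summable_comparison_test_ev) (simp add: summable_real_powr_iff)
  have "ln (real (index_count a b d R)) \<le> \<eta> * R + 2 * D * suminf w" if R: "R > 0" for R d
  proof -
    have summand: "ln (1 + 2 * decay_sum \<beta> (\<eta> * a k)) \<le> 2 * D * w k" if k: "k \<in> {1..d}" for k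
    proof -
      have k1: "k \<ge> 1" using k by simp
      have pos: "0 < \<eta> * a k" "0 < \<eta> * a 1" "\<eta> * a 1 / 2 \<le> \<eta> * a k / 2"
        using \<eta> apos[OF k1] a1 mono[OF k1] by (auto intro!: mult_left_mono divide_right_mono)
      have "decay_sum \<beta> (\<eta> * a k) \<le> exp (- (\<eta> * a k) / 2) * decay_sum \<beta> (\<eta> * a k / 2)"
        by (rule decay_sum_le_exp[OF pos(1) \<beta>])
      also have "\<dots> \<le> exp (- (\<eta> * a k) / 2) * D"
        unfolding D_def using pos \<beta> by (intro mult_left_mono decay_sum_antimono) auto
      finally have "decay_sum \<beta> (\<eta> * a k) \<le> D * w k"
        by (simp add: w_def mult.commute)
      moreover have "ln (1 + 2 * decay_sum \<beta> (\<eta> * a k)) \<le> 2 * decay_sum \<beta> (\<eta> * a k)"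
        using decay_sum_nonneg[OF pos(1) \<beta>] by (intro ln_add_one_self_le_self) auto
      ultimately show ?thesis
        by linarith
    qed
    have "ln (real (index_count a b d R)) \<le> \<eta> * R + (\<Sum>k=1..d. ln (1 + 2 * decay_sum \<beta> (\<eta> * a k)))"
      using apos b by (intro ln_index_count_le \<eta> \<beta> R) auto
    also have "(\<Sum>k=1..d. ln (1 + 2 * decay_sum \<beta> (\<eta> * a k))) \<le> (\<Sum>k=1..d. 2 * D * w k)"
      by (rule sum_mono[OF summand])
    also have "\<dots> = 2 * D * (\<Sum>k=1..d. w k)"
      by (simp add: sum_distrib_left)
    also have "\<dots> \<le> 2 * D * suminf w"
    proof (intro mult_left_mono sum_le_suminf w)
      show "0 \<le> w k" for k
        by (simp add: w_def)
    qed (use D in auto)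
    finally show ?thesis by simp
  qed
  then show ?thesis
    by blast
qed

lemma arctan_diff_ge:
  assumes "0 \<le> y" "y < x"
  shows "(x - y) / (1 + x\<^sup>2) \<le> arctan x - arctan y"
proof -
  have "\<exists>z>y. z < x \<and> arctan x - arctan y = (x - y) * inverse (1 + z\<^sup>2)"
    using assms by (intro MVT2 DERIV_arctan) auto
  then obtain z where z: "y < z" "z < x" "arctan x - arctan y = (x - y) * inverse (1 + z\<^sup>2)"
    by blast
  have "z\<^sup>2 \<le> x\<^sup>2"
    using z assms by (intro power_mono) auto
  then have "inverse (1 + x\<^sup>2) \<le> inverse (1 + z\<^sup>2)"
    by (intro le_imp_inverse_le) (auto simp: add_pos_nonneg)
  then show ?thesis
    unfolding z(3) divide_inverse using assms by (intro mult_left_mono) auto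
qed

text \<open>
  The function \<open>u \<mapsto> 1 / (sqrt u * (1 + u))\<close> is decreasing with antiderivative \<open>2 * arctan (sqrt u)\<close>,
  which is bounded by \<open>pi\<close>; the sum telescopes against this antiderivative.
\<close>

lemma sum_inverse_sqrt_times_one_plus_le:
  assumes "\<kappa> > 0"
  shows "(\<Sum>k=1..d. 1 / (sqrt (\<kappa> * real k) * (1 + \<kappa> * real k))) \<le> pi / \<kappa>"
proof -
  have step: "\<kappa> * (1 / (sqrt (\<kappa> * real (Suc n)) * (1 + \<kappa> * real (Suc n)))) \<le>
      2 * arctan (sqrt (\<kappa> * real (Suc n))) - 2 * arctan (sqrt (\<kappa> * real n))" for n
  proof -
    define x y where "x = sqrt (\<kappa> * real (Suc n))" and "y = sqrt (\<kappa> * real n)"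
    have xy: "0 \<le> y" "y < x" "x\<^sup>2 = \<kappa> * real (Suc n)" "y\<^sup>2 = \<kappa> * real n"
      using assms by (simp_all add: x_def y_def)
    have "\<kappa> = x\<^sup>2 - y\<^sup>2"
      unfolding xy by (simp add: distrib_left)
    also have "\<dots> = (x - y) * (x + y)"
      by (simp add: algebra_simps power2_eq_square)
    also have "\<dots> \<le> (x - y) * (2 * x)"
      using xy by (intro mult_left_mono) auto
    finally have "\<kappa> / x \<le> 2 * (x - y)"
      using xy by (simp add: divide_le_eq mult_ac)
    then have "\<kappa> / x / (1 + x\<^sup>2) \<le> 2 * (x - y) / (1 + x\<^sup>2)"
      by (intro divide_right_mono) auto
    also have "\<dots> = 2 * ((x - y) / (1 + x\<^sup>2))"
      by simp
    also have "\<dots> \<le> 2 * (arctan x - arctan y)"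
      by (intro mult_left_mono arctan_diff_ge xy) simp
    finally show ?thesis
      unfolding x_def[symmetric] y_def[symmetric] xy(3)[symmetric] using xy(1,2) by simp
  qed
  have "\<kappa> * (\<Sum>k=1..d. 1 / (sqrt (\<kappa> * real k) * (1 + \<kappa> * real k))) \<le> 2 * arctan (sqrt (\<kappa> * real d))"
  proof (induction d)
    case (Suc n)
    then show ?case
      using step[of n] by (simp add: distrib_left)
  qed simp
  also have "\<dots> \<le> pi"
    using arctan_ubound[of "sqrt (\<kappa> * real d)"] by simp
  finally show ?thesis
    using assms by (simp add: field_simps)
qed

text \<open>
  The summand at \<open>k\<close> depends only on \<open>u = \<kappa> * k\<close> with \<open>\<kappa> = \<theta> powr (1 / p)\<close>.  It is at most a constant times
  \<open>u powr (- 1 / 2)\<close> and times \<open>u powr (- 3 / 2)\<close>, hence at most a constant times the integrable function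
  \<open>1 / (sqrt u * (1 + u))\<close>, so the whole sum is of the order of \<open>1 / \<kappa>\<close>.
\<close>

lemma sum_ln_decay_le:
  assumes \<beta>: "\<beta> > 0" and p: "p > 0"
  obtains C where "C \<ge> 0"
    "\<And>\<theta> d. \<theta> > 0 \<Longrightarrow>
      (\<Sum>k=1..d. ln (1 + 2 * decay_sum \<beta> (\<theta> * real k powr p))) \<le> C * \<theta> powr (- (1 / p))"
proof -
  obtain C1 where C1: "C1 \<ge> 0"
    "\<And>\<theta>. \<theta> > 0 \<Longrightarrow> ln (1 + 2 * decay_sum \<beta> \<theta>) \<le> C1 * \<theta> powr (- (1 / (2 * p)))"
    using ln_decay_sum_le_powr[OF \<beta>, of "1 / (2 * p)"] p by auto
  obtain C3 where C3: "C3 \<ge> 0"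
    "\<And>\<theta>. \<theta> > 0 \<Longrightarrow> ln (1 + 2 * decay_sum \<beta> \<theta>) \<le> C3 * \<theta> powr (- (3 / (2 * p)))"
    using ln_decay_sum_le_powr[OF \<beta>, of "3 / (2 * p)"] p by auto
  define C where "C = 2 * (C1 + C3)"
  have C: "C \<ge> 0"
    using C1(1) C3(1) by (simp add: C_def)
  have u: "ln (1 + 2 * decay_sum \<beta> (u powr p)) \<le> C * (1 / (sqrt u * (1 + u)))" if u: "u > 0" for u
  proof -
    have s: "sqrt u > 0" using u by simp
    have e1: "(u powr p) powr (- (1 / (2 * p))) = 1 / sqrt u"
      using u p by (simp add: powr_powr powr_minus powr_half_sqrt[symmetric] field_simps)
    have "u powr (3 / 2) = u * sqrt u"
      using powr_add[of u 1 "1 / 2"] u by (simp add: powr_half_sqrt)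
    then have e3: "(u powr p) powr (- (3 / (2 * p))) = 1 / (u * sqrt u)"
      using p by (simp add: powr_powr powr_minus inverse_eq_divide)
    show ?thesis
    proof (cases "u \<le> 1")
      case True
      have "ln (1 + 2 * decay_sum \<beta> (u powr p)) \<le> C1 * (1 / sqrt u)"
        using C1(2)[of "u powr p"] u e1 by simp
      also have "1 / sqrt u = 2 / (sqrt u * 2)"
        by simp
      also have "C1 * \<dots> \<le> C1 * (2 / (sqrt u * (1 + u)))"
        using C1(1) s True u by (intro mult_left_mono divide_left_mono) auto
      also have "\<dots> \<le> C * (1 / (sqrt u * (1 + u)))"
        using C3(1) s u by (simp add: C_def divide_right_mono)
      finally show ?thesis .
    next
      case False
      have "ln (1 + 2 * decay_sum \<beta> (u powr p)) \<le> C3 * (1 / (u * sqrt u))"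
        using C3(2)[of "u powr p"] u e3 by simp
      also have "1 / (u * sqrt u) = 2 / (sqrt u * (2 * u))"
        by simp
      also have "C3 * \<dots> \<le> C3 * (2 / (sqrt u * (1 + u)))"
        using C3(1) s False u by (intro mult_left_mono divide_left_mono) auto
      also have "\<dots> \<le> C * (1 / (sqrt u * (1 + u)))"
        using C1(1) s u by (simp add: C_def divide_right_mono)
      finally show ?thesis .
    qed
  qed
  have "(\<Sum>k=1..d. ln (1 + 2 * decay_sum \<beta> (\<theta> * real k powr p))) \<le> (C * pi) * \<theta> powr (- (1 / p))"
    if \<theta>: "\<theta> > 0" for \<theta> d
  proof -
    define \<kappa> where "\<kappa> = \<theta> powr (1 / p)"
    have \<kappa>: "\<kappa> > 0" "\<kappa> powr p = \<theta>"
      using \<theta> p by (simp_all add: \<kappa>_def powr_powr)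
    have "(\<Sum>k=1..d. ln (1 + 2 * decay_sum \<beta> (\<theta> * real k powr p))) \<le>
        (\<Sum>k=1..d. C * (1 / (sqrt (\<kappa> * real k) * (1 + \<kappa> * real k))))"
    proof (rule sum_mono)
      fix k
      assume "k \<in> {1..d}"
      then show "ln (1 + 2 * decay_sum \<beta> (\<theta> * real k powr p)) \<le>
          C * (1 / (sqrt (\<kappa> * real k) * (1 + \<kappa> * real k)))"
        using u[of "\<kappa> * real k"] \<kappa> by (simp add: powr_mult)
    qed
    also have "\<dots> = C * (\<Sum>k=1..d. 1 / (sqrt (\<kappa> * real k) * (1 + \<kappa> * real k)))"
      by (simp add: sum_distrib_left)
    also have "\<dots> \<le> C * (pi / \<kappa>)"
      by (intro mult_left_mono sum_inverse_sqrt_times_one_plus_le \<kappa>(1) C)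
    finally show ?thesis
      by (simp add: \<kappa>_def powr_minus divide_inverse mult.assoc)
  qed
  moreover have "C * pi \<ge> 0"
    using C by simp
  ultimately show thesis
    using that by blast
qed

text \<open>
  With \<open>p = (1 - s) / s\<close> and \<open>\<tau> = \<zeta> * R powr (s - 1)\<close>, the term \<open>\<tau> * R\<close> equals \<open>\<zeta> * R powr s\<close>.  For
  any constant \<open>A\<close> the hypothesis gives \<open>a k \<ge> A * k powr p\<close> from some index on; these coordinates
  contribute at most a constant times \<open>(\<tau> * A) powr (- 1 / p)\<close>, which is again a multiple of \<open>R powr s\<close> and
  small when \<open>A\<close> is large.  Each of the finitely many remaining coordinates contributes at most a multiple
  of \<open>R powr (s / 2)\<close>.
\<close>

lemma ln_index_count_le_powr:
  assumes mono: "\<And>k. k \<ge> 1 \<Longrightarrow> a 1 \<le> a k" and a1: "0 < a 1"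
    and \<beta>: "\<beta> > 0" and b: "\<And>k. k \<ge> 1 \<Longrightarrow> \<beta> \<le> b k"
    and s: "0 < s" "s < 1"
    and lim: "(\<lambda>j. real j powr ((1 - s) / s) / a j) \<longlonglongrightarrow> 0" and \<eta>: "\<eta> > 0"
  shows "\<exists>C. \<forall>R>0. \<forall>d. ln (real (index_count a b d R)) \<le> \<eta> * R powr s + C"
proof -
  define p where "p = (1 - s) / s"
  define \<zeta> where "\<zeta> = \<eta> / 3"
  have p: "p > 0" "(1 - s) / p = s"
    using s by (simp_all add: p_def)
  have \<zeta>: "\<zeta> > 0"
    using \<eta> by (simp add: \<zeta>_def)
  have apos: "0 < a k" if "k \<ge> 1" for k
    using mono[OF that] a1 by linarith
  obtain C1 where C1: "C1 \<ge> 0"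
    "\<And>\<theta>. \<theta> > 0 \<Longrightarrow> ln (1 + 2 * decay_sum \<beta> \<theta>) \<le> C1 * \<theta> powr (- (1 / (2 * p)))"
    using ln_decay_sum_le_powr[OF \<beta>, of "1 / (2 * p)"] p by auto
  obtain C2 where C2: "C2 \<ge> 0"
    "\<And>\<theta> d. \<theta> > 0 \<Longrightarrow>
      (\<Sum>k=1..d. ln (1 + 2 * decay_sum \<beta> (\<theta> * real k powr p))) \<le> C2 * \<theta> powr (- (1 / p))"
    using sum_ln_decay_le[OF \<beta> p(1)] by blast
  \<comment> \<open>Chosen to make \<open>C2 * (\<zeta> * A) powr (- 1 / p)\<close> at most \<open>\<zeta>\<close>.\<close>
  define A where "A = ((C2 + 1) / \<zeta>) powr p / \<zeta>"
  have A: "A > 0"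
    using C2(1) \<zeta> by (simp add: A_def)
  have A_eq: "C2 * (\<zeta> * A) powr (- (1 / p)) \<le> \<zeta>"
  proof -
    have "(\<zeta> * A) powr (- (1 / p)) = \<zeta> / (C2 + 1)"
      using C2(1) \<zeta> p by (simp add: A_def powr_minus powr_powr)
    moreover have "C2 * (\<zeta> / (C2 + 1)) \<le> \<zeta>"
      using C2(1) \<zeta> by (simp add: field_simps)
    ultimately show ?thesis
      by (simp only:)
  qed
  have "eventually (\<lambda>j. real j powr p / a j < 1 / A) sequentially"
    using lim A unfolding p_def by (intro order_tendstoD) auto
  then obtain k1 where k1: "\<And>j. j \<ge> k1 \<Longrightarrow> real j powr p / a j < 1 / A"
    unfolding eventually_sequentially by blast
  define E where "E = real k1 * (C1 * (\<zeta> * a 1) powr (- (1 / (2 * p))))"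
  have "ln (real (index_count a b d R)) \<le> \<eta> * R powr s + E\<^sup>2 / (4 * \<zeta>)" if R: "R > 0" for R d
  proof -
    define \<tau> where "\<tau> = \<zeta> * R powr (s - 1)"
    have \<tau>: "\<tau> > 0"
      using \<zeta> R by (simp add: \<tau>_def)
    have \<tau>_pow: "\<tau> powr (- (q / p)) = \<zeta> powr (- (q / p)) * R powr (q * s)" for q
    proof -
      have "(s - 1) * (- (q / p)) = q * ((1 - s) / p)"
        using p(1) by (simp add: field_simps)
      then show ?thesis
        unfolding p(2) using \<zeta> R by (simp add: \<tau>_def powr_mult powr_powr)
    qed
    define g where "g k = ln (1 + 2 * decay_sum \<beta> (\<tau> * a k))" for k
    have ln_nonneg: "0 \<le> ln (1 + 2 * decay_sum \<beta> \<theta>)" if "\<theta> > 0" for \<theta>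
      using decay_sum_nonneg[OF that \<beta>] by simp
    have ln_mono: "ln (1 + 2 * decay_sum \<beta> \<theta>') \<le> ln (1 + 2 * decay_sum \<beta> \<theta>)" if "0 < \<theta>" "\<theta> \<le> \<theta>'" for \<theta> \<theta>'
      using decay_sum_antimono[OF that \<beta>] decay_sum_nonneg[of \<theta>' \<beta>] that \<beta> by simp
    have summand: "g k \<le> ln (1 + 2 * decay_sum \<beta> ((\<tau> * A) * real k powr p)) + (if k < k1 then g 1 else 0)"
      if k: "k \<in> {1..d}" for k
    proof (cases "k < k1")
      case True
      have "g k \<le> g 1"
        unfolding g_def using k \<tau> a1 mono[of k] by (intro ln_mono) auto
      moreover have "0 \<le> ln (1 + 2 * decay_sum \<beta> ((\<tau> * A) * real k powr p))"
        using k \<tau> A by (intro ln_nonneg) auto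
      ultimately show ?thesis
        using True by simp
    next
      case False
      then have "A * real k powr p \<le> a k"
        using k1[of k] apos[of k] k A by (simp add: field_simps)
      then have "\<tau> * A * real k powr p \<le> \<tau> * a k"
        using \<tau> by simp
      then show ?thesis
        unfolding g_def using False k \<tau> A by (auto intro!: ln_mono)
    qed
    have g1: "0 \<le> g 1" "g 1 \<le> C1 * (\<tau> * a 1) powr (- (1 / (2 * p)))"
      unfolding g_def using ln_nonneg C1(2) \<tau> a1 by simp_all
    have "(\<Sum>k=1..d. if k < k1 then g 1 else 0) = real (card {k \<in> {1..d}. k < k1}) * g 1"
      by (simp add: sum.If_cases Int_def)
    also have "\<dots> \<le> real k1 * g 1"
    proof (intro mult_right_mono g1)
      have "card {k \<in> {1..d}. k < k1} \<le> card {..<k1}"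
        by (intro card_mono) auto
      then show "real (card {k \<in> {1..d}. k < k1}) \<le> real k1"
        by simp
    qed
    also have "\<dots> \<le> real k1 * (C1 * (\<tau> * a 1) powr (- (1 / (2 * p))))"
      by (intro mult_left_mono g1) auto
    also have "\<dots> = E * R powr (s / 2)"
      using \<tau>_pow[of "1 / 2"] \<tau> \<zeta> a1 by (simp add: E_def powr_mult)
    finally have small: "(\<Sum>k=1..d. if k < k1 then g 1 else 0) \<le> E * R powr (s / 2)" .
    have "(\<Sum>k=1..d. ln (1 + 2 * decay_sum \<beta> ((\<tau> * A) * real k powr p))) \<le> C2 * (\<tau> * A) powr (- (1 / p))"
      using \<tau> A by (intro C2(2)) auto
    also have "\<dots> = C2 * (\<zeta> * A) powr (- (1 / p)) * R powr s"
      using \<tau>_pow[of 1] \<tau> \<zeta> A by (simp add: powr_mult)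
    also have "\<dots> \<le> \<zeta> * R powr s"
      by (intro mult_right_mono A_eq) auto
    finally have main: "(\<Sum>k=1..d. ln (1 + 2 * decay_sum \<beta> ((\<tau> * A) * real k powr p))) \<le> \<zeta> * R powr s" .
    have "ln (real (index_count a b d R)) \<le> \<tau> * R + (\<Sum>k=1..d. g k)"
      unfolding g_def using apos b by (intro ln_index_count_le \<tau> \<beta> R) auto
    also have "(\<Sum>k=1..d. g k) \<le> (\<Sum>k=1..d. ln (1 + 2 * decay_sum \<beta> ((\<tau> * A) * real k powr p)) +
        (if k < k1 then g 1 else 0))"
      by (rule sum_mono[OF summand])
    also have "\<dots> = (\<Sum>k=1..d. ln (1 + 2 * decay_sum \<beta> ((\<tau> * A) * real k powr p))) +
        (\<Sum>k=1..d. if k < k1 then g 1 else 0)"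
      by (rule sum.distrib)
    also have "\<dots> \<le> \<zeta> * R powr s + E * R powr (s / 2)"
      by (intro add_mono main small)
    also have "\<tau> * R = \<zeta> * R powr s"
      using R by (simp add: \<tau>_def powr_diff)
    \<comment> \<open>A lower power of \<open>R\<close> is absorbed by completing the square in \<open>R powr (s / 2)\<close>.\<close>
    also have "E * R powr (s / 2) \<le> \<zeta> * R powr s + E\<^sup>2 / (4 * \<zeta>)"
    proof -
      have "(R powr (s / 2))\<^sup>2 = R powr s"
        by (simp add: power2_eq_square powr_add[symmetric])
      moreover have "0 \<le> (2 * \<zeta> * R powr (s / 2) - E)\<^sup>2 / (4 * \<zeta>)"
        using \<zeta> by simp
      moreover have "(2 * \<zeta> * R powr (s / 2) - E)\<^sup>2 / (4 * \<zeta>) =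
          \<zeta> * (R powr (s / 2))\<^sup>2 - E * R powr (s / 2) + E\<^sup>2 / (4 * \<zeta>)"
        using \<zeta> by (simp add: field_simps power2_eq_square)
      ultimately show ?thesis
        by simp
    qed
    finally show ?thesis
      by (simp add: \<zeta>_def)
  qed
  then show ?thesis
    by blast
qed

section \<open>Lower bounds and weak tractability\<close>

text \<open>
  The indicator function of \<open>T\<close> has exponent \<open>\<Sum>k\<in>T. a k\<close>, at most \<open>m * a d\<close>.
\<close>

lemma card_le_index_count:
  assumes fam: "\<And>T. T \<in> \<F> \<Longrightarrow> T \<subseteq> {1..d}" "\<And>T. T \<in> \<F> \<Longrightarrow> card T \<le> m"
    and R: "real m * a d < R"
    and mono: "\<And>k. k \<in> {1..d} \<Longrightarrow> a k \<le> a d" and a: "0 \<le> a d"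
    and fin: "finite {h \<in> {1..d} \<rightarrow>\<^sub>E UNIV. exponent a b d h < R}"
  shows "card \<F> \<le> index_count a b d R"
proof -
  define ind :: "nat set \<Rightarrow> nat \<Rightarrow> int" where "ind T = (\<lambda>k\<in>{1..d}. if k \<in> T then 1 else 0)" for T
  have "inj_on ind \<F>"
  proof (rule inj_onI)
    fix S T
    assume ST: "S \<in> \<F>" "T \<in> \<F>" "ind S = ind T"
    have "T = {k \<in> {1..d}. ind T k = 1}" if "T \<in> \<F>" for T
      using fam(1)[OF that] by (auto simp: ind_def)
    from this[OF ST(1)] this[OF ST(2)] ST(3) show "S = T"
      by simp
  qed
  moreover have "ind ` \<F> \<subseteq> {h \<in> {1..d} \<rightarrow>\<^sub>E UNIV. exponent a b d h < R}"
  proof (rule image_subsetI)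
    fix T
    assume T: "T \<in> \<F>"
    have "ind T \<in> {1..d} \<rightarrow>\<^sub>E UNIV"
      by (simp add: ind_def)
    have "exponent a b d (ind T) = (\<Sum>k=1..d. if k \<in> T then a k else 0)"
      unfolding exponent_def by (intro sum.cong) (auto simp: ind_def)
    also have "\<dots> = (\<Sum>k\<in>T. a k)"
      using fam(1)[OF T] by (simp add: sum.If_cases Int_absorb1)
    also have "\<dots> \<le> (\<Sum>k\<in>T. a d)"
      using fam(1)[OF T] mono by (intro sum_mono) auto
    also have "\<dots> \<le> real m * a d"
      using fam(2)[OF T] a by (simp add: mult_right_mono)
    finally have "exponent a b d (ind T) < R"
      using R by simp
    with \<open>ind T \<in> _\<close> show "ind T \<in> {h \<in> {1..d} \<rightarrow>\<^sub>E UNIV. exponent a b d h < R}"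
      by simp
  qed
  ultimately show ?thesis
    unfolding index_count_def by (rule card_inj_on_le[OF _ _ fin])
qed

text \<open>
  The quotient tends to \<open>0\<close> because the denominator tends to infinity: if \<open>1 / \<epsilon> + d\<close> is large, then
  \<open>ln (1 / \<epsilon>)\<close> or \<open>d\<close> is large, and the constant \<open>C\<close> becomes negligible.
\<close>

lemma EC_WT_I:
  assumes st: "0 < s" "0 < t"
    and pos: "\<And>\<epsilon> d. \<epsilon> \<in> {0<..<1} \<Longrightarrow> d \<ge> 1 \<Longrightarrow> n \<epsilon> d \<ge> 1"
    and bound: "\<And>\<eta>. \<eta> > 0 \<Longrightarrow> \<exists>C. \<forall>\<epsilon>\<in>{0<..<1}. \<forall>d\<ge>1.
      ln (real (n \<epsilon> d)) \<le> \<eta> * ln (1 / \<epsilon>) powr s + C"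
  shows "EC_WT n s t"
  unfolding EC_WT_def
proof (rule tendstoI)
  fix r :: real
  assume r: "r > 0"
  then have "r / 2 > 0"
    by simp
  from bound[OF this] obtain C where "\<forall>\<epsilon>\<in>{0<..<1}. \<forall>d\<ge>1. ln (real (n \<epsilon> d)) \<le> r / 2 * ln (1 / \<epsilon>) powr s + C"
    by blast
  then have C: "ln (real (n \<epsilon> d)) \<le> r / 2 * ln (1 / \<epsilon>) powr s + C" if "\<epsilon> \<in> {0<..<1}" "d \<ge> 1" for \<epsilon> d
    using that by simp
  \<comment> \<open>Once the denominator exceeds \<open>D\<close>, the constant \<open>C\<close> contributes less than \<open>r / 2\<close> to the quotient.\<close>
  define D where "D = 2 * \<bar>C\<bar> / r + 1"
  have D: "D > 0"
    using r by (simp add: D_def add_nonneg_pos)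
  define P where "P x \<longleftrightarrow> exp (D powr (1 / s)) + D powr (1 / t) \<le> x" for x :: real
  have "eventually P at_top"
    unfolding P_def by (rule eventually_ge_at_top)
  then have "eventually (\<lambda>(\<epsilon>, d). P (1 / \<epsilon> + real d)) (filtercomap (\<lambda>(\<epsilon>, d). 1 / \<epsilon> + real d) at_top)"
    unfolding eventually_filtercomap by (intro exI[of _ P]) auto
  then have "eventually (\<lambda>z. z \<in> {0<..<1} \<times> {1..} \<longrightarrow>
      dist (case z of (\<epsilon>, d) \<Rightarrow> ln (real (n \<epsilon> d)) / (ln (1 / \<epsilon>) powr s + real d powr t)) 0 < r)
      (filtercomap (\<lambda>(\<epsilon>, d). 1 / \<epsilon> + real d) at_top)"
  proof eventually_elim
    case (elim z)
    obtain \<epsilon> d where z: "z = (\<epsilon>, d)" by fastforce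
    show ?case
    proof
      assume "z \<in> {0<..<1} \<times> {1..}"
      then have \<epsilon>: "\<epsilon> \<in> {0<..<1}" and d: "d \<ge> 1"
        by (auto simp: z)
      define x where "x = ln (1 / \<epsilon>)"
      have x: "x > 0" "1 / \<epsilon> = exp x"
        using \<epsilon> by (simp_all add: x_def)
      have P: "exp (D powr (1 / s)) + D powr (1 / t) \<le> exp x + real d"
        using elim x(2) by (simp add: z P_def)
      have "D \<le> x powr s + real d powr t"
      proof (cases "D powr (1 / s) \<le> x")
        case True
        then have "(D powr (1 / s)) powr s \<le> x powr s"
          using st by (intro powr_mono2) auto
        then show ?thesis
          using D st by (simp add: powr_powr add_increasing2)
      next
        case False
        then have "D powr (1 / t) \<le> real d"
          using P exp_less_mono[of x "D powr (1 / s)"] by linarith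
        then have "(D powr (1 / t)) powr t \<le> real d powr t"
          using st by (intro powr_mono2) auto
        then show ?thesis
          using D st by (simp add: powr_powr add_increasing)
      qed
      define y where "y = x powr s + real d powr t"
      have y: "D \<le> y" "x powr s \<le> y"
        using \<open>D \<le> _\<close> by (simp_all add: y_def)
      have "ln (real (n \<epsilon> d)) \<le> r / 2 * x powr s + C"
        using C[OF \<epsilon> d] by (simp add: x_def)
      also have "\<dots> \<le> r / 2 * y + \<bar>C\<bar>"
        using y r by (intro add_mono mult_left_mono) auto
      also have "\<bar>C\<bar> < r / 2 * D"
        using r by (simp add: D_def field_simps)
      also have "r / 2 * D \<le> r / 2 * y"
        using y r by (intro mult_left_mono) auto
      finally have "ln (real (n \<epsilon> d)) < r * y"
        by simp
      moreover have "0 \<le> ln (real (n \<epsilon> d))"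
        using pos[OF \<epsilon> d] by simp
      ultimately show "dist (case z of (\<epsilon>, d) \<Rightarrow> ln (real (n \<epsilon> d)) / (ln (1 / \<epsilon>) powr s + real d powr t)) 0 < r"
        using y(1) D by (simp add: z x_def[symmetric] y_def[symmetric] divide_less_eq)
    qed
  qed
  then show "eventually (\<lambda>z. dist (case z of (\<epsilon>, d) \<Rightarrow> ln (real (n \<epsilon> d)) / (ln (1 / \<epsilon>) powr s + real d powr t)) 0 < r)
      eps_dim_at_top"
    unfolding eps_dim_at_top_def eventually_inf_principal .
qed

text \<open>
  The pairs \<open>(exp (- x j), j)\<close> leave every bounded region because \<open>d = j\<close> does, whatever \<open>x\<close> is.
\<close>

lemma EC_WT_D:
  assumes EC: "EC_WT n s t" and x: "\<And>j. j \<ge> 1 \<Longrightarrow> x j > 0"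
  shows "(\<lambda>j. ln (real (n (exp (- x j)) j)) / (x j powr s + real j powr t)) \<longlonglongrightarrow> 0"
proof -
  have "filterlim (\<lambda>j. (exp (- x j), j)) eps_dim_at_top sequentially"
    unfolding eps_dim_at_top_def filterlim_inf filterlim_filtercomap_iff filterlim_principal
  proof
    have "filterlim (\<lambda>j. exp (x j) + real j) at_top sequentially"
      by (rule filterlim_at_top_mono[OF filterlim_real_sequentially]) simp
    then show "filterlim ((\<lambda>(\<epsilon>, d). 1 / \<epsilon> + real d) \<circ> (\<lambda>j. (exp (- x j), j))) at_top sequentially"
      by (simp add: o_def exp_minus inverse_eq_divide)
    show "\<forall>\<^sub>F j in sequentially. (exp (- x j), j) \<in> {0<..<1} \<times> {1..}"
      using eventually_ge_at_top[of 1] by eventually_elim (use x in auto)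
  qed
  from filterlim_compose[OF EC[unfolded EC_WT_def] this] show ?thesis
    by (simp add: ln_div)
qed

text \<open>
  The exponent of \<open>m j\<close> lies between \<open>t\<close> and \<open>1\<close>.  As it exceeds \<open>t\<close>, the term \<open>j powr t\<close> is at most \<open>m j\<close>
  and hence at most a constant times \<open>m j * a j\<close>; as it is below \<open>1\<close>, the quotient \<open>j / m j\<close> exceeds a positive power of \<open>j\<close> for large \<open>j\<close>, so
  \<open>ln (j choose m j)\<close> is at least a constant times \<open>m j * ln j\<close>.  Dividing by \<open>m j\<close> leaves \<open>ln j / a j\<close>.
\<close>

lemma ln_over_weight_tendsto_zero:
  fixes a :: "nat \<Rightarrow> real" and N :: "nat \<Rightarrow> nat"
  assumes mono: "\<And>k. k \<ge> 1 \<Longrightarrow> a 1 \<le> a k" and a1: "0 < a 1" and t: "0 < t" "t < 1" and c: "c > 0"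
    and m: "\<And>j. m j = nat \<lceil>real j powr ((1 + t) / 2)\<rceil>"
    and N: "\<And>j. j \<ge> 1 \<Longrightarrow> (j choose m j) \<le> N j"
    and lim: "(\<lambda>j. ln (real (N j)) / (2 * real (m j) * a j / c + real j powr t)) \<longlonglongrightarrow> 0"
  shows "(\<lambda>j. ln (real j) / a j) \<longlonglongrightarrow> 0"
proof -
  define q where "q j = ln (real (N j)) / (2 * real (m j) * a j / c + real j powr t)" for j
  define t' where "t' = (1 + t) / 2"
  define \<kappa> where "\<kappa> = (1 - t') / 2"
  have t': "t < t'" "0 < t'" "t' < 1" "\<kappa> > 0"
    using t by (simp_all add: t'_def \<kappa>_def)
  have "eventually (\<lambda>j. 2 \<le> real j powr \<kappa>) sequentially"
  proof -
    have "eventually (\<lambda>j. 2 powr (1 / \<kappa>) \<le> real j) sequentially"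
      using filterlim_real_sequentially by (simp add: filterlim_at_top)
    then show ?thesis
    proof eventually_elim
      case (elim j)
      then have "(2 powr (1 / \<kappa>)) powr \<kappa> \<le> real j powr \<kappa>"
        using t' by (intro powr_mono2) auto
      then show ?case
        using t' by (simp add: powr_powr)
    qed
  qed
  then have ev: "eventually (\<lambda>j. norm (ln (real j) / a j) \<le> q j * ((2 / c + 1 / a 1) / \<kappa>)) sequentially"
    using eventually_ge_at_top[of 1]
  proof eventually_elim
    case (elim j)
    have j: "real j \<ge> 1"
      using elim by simp
    have aj: "a 1 \<le> a j" "0 < a j"
      using mono[of j] a1 elim by auto
    have jt: "1 \<le> real j powr t'" "real j powr t' \<le> real j"
      using j t' powr_mono[of t' 1 "real j"] by (auto simp: ge_one_powr_ge_zero)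
    have mj: "real j powr t' \<le> real (m j)" "real (m j) \<le> 2 * real j powr t'" "m j \<le> j" "m j \<ge> 1"
    proof -
      show 1: "real j powr t' \<le> real (m j)"
        unfolding m t'_def[symmetric] by linarith
      show "real (m j) \<le> 2 * real j powr t'"
        unfolding m t'_def[symmetric] using jt by linarith
      show "m j \<le> j"
        unfolding m t'_def[symmetric] using jt by (simp add: nat_le_iff ceiling_le_iff)
      show "m j \<ge> 1"
        using 1 jt by linarith
    qed
    have "real j powr \<kappa> * real (m j) \<le> real j powr \<kappa> * (2 * real j powr t')"
      by (intro mult_left_mono mj) auto
    also have "\<dots> \<le> real j powr \<kappa> * (real j powr \<kappa> * real j powr t')"
      using elim by (intro mult_left_mono mult_right_mono) auto
    also have "\<dots> = real j powr (\<kappa> + \<kappa> + t')"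
      by (simp only: powr_add mult.assoc)
    also have "\<dots> = real j"
      using j by (simp add: \<kappa>_def)
    finally have "real j powr \<kappa> \<le> real j / real (m j)"
      using mj by (simp add: field_simps)
    then have "(real j powr \<kappa>) ^ m j \<le> (real j / real (m j)) ^ m j"
      by (intro power_mono) auto
    also have "\<dots> \<le> real (j choose m j)"
      by (rule binomial_ge_n_over_k_pow_k[OF mj(3)])
    also have "\<dots> \<le> real (N j)"
      using N[of j] elim by simp
    finally have pow_le: "(real j powr \<kappa>) ^ m j \<le> real (N j)" .
    have "1 \<le> N j"
      using N[of j] elim zero_less_binomial[OF mj(3)] by linarith
    then have q: "0 \<le> q j"
      unfolding q_def using aj c by (intro divide_nonneg_nonneg add_nonneg_nonneg) auto
    then have "ln ((real j powr \<kappa>) ^ m j) \<le> ln (real (N j))"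
      using j by (intro ln_mono[OF pow_le]) auto
    then have "real (m j) * (\<kappa> * ln (real j)) \<le> ln (real (N j))"
      using j by (simp add: ln_realpow ln_powr)
    also have "\<dots> = q j * (2 * real (m j) * a j / c + real j powr t)"
    proof -
      have "0 < 2 * real (m j) * a j / c + real j powr t"
        using mj aj c j by (intro add_nonneg_pos) auto
      then show ?thesis
        by (simp add: q_def)
    qed
    also have "\<dots> \<le> q j * (real (m j) * (2 * a j / c + 1))"
    proof (rule mult_left_mono)
      have "real j powr t \<le> real (m j)"
        using powr_mono[of t t' "real j"] j t' mj(1) by linarith
      then show "2 * real (m j) * a j / c + real j powr t \<le> real (m j) * (2 * a j / c + 1)"
        by (simp add: algebra_simps)
      show "0 \<le> q j"
        by (rule q)
    qed
    finally have "real (m j) * (\<kappa> * ln (real j)) \<le> real (m j) * (q j * (2 * a j / c + 1))"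
      by (simp add: mult_ac)
    then have "\<kappa> * ln (real j) \<le> q j * (2 * a j / c + 1)"
      using mj(4) by simp
    moreover have "q j * (2 * a j / c + 1) \<le> q j * ((2 / c + 1 / a 1) * a j)"
    proof (rule mult_left_mono)
      have "1 \<le> a j / a 1"
        using aj a1 by simp
      then show "2 * a j / c + 1 \<le> (2 / c + 1 / a 1) * a j"
        by (simp add: algebra_simps)
      show "0 \<le> q j"
        by (rule q)
    qed
    ultimately have "\<kappa> * ln (real j) \<le> q j * ((2 / c + 1 / a 1) * a j)"
      by simp
    then have "ln (real j) / a j \<le> q j * ((2 / c + 1 / a 1) / \<kappa>)"
      using t'(4) aj(2) by (simp add: pos_divide_le_eq pos_le_divide_eq mult_ac)
    moreover have "0 \<le> ln (real j) / a j"
      using j aj by simp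
    ultimately show ?case
      by simp
  qed
  have "(\<lambda>j. q j * ((2 / c + 1 / a 1) / \<kappa>)) \<longlonglongrightarrow> 0"
    using lim unfolding q_def[symmetric] by (rule tendsto_mult_left_zero)
  with ev show ?thesis
    by (rule Lim_null_comparison)
qed

text \<open>
  As \<open>t \<le> 1\<close>, the term \<open>j powr t\<close> multiplied by the vanishing quotient is absorbed by \<open>ln (N j) \<ge> j * ln 2\<close>.
  What remains is that \<open>j\<close> is at most \<open>(j * a j) powr s\<close> times a null sequence; its power \<open>1 / s\<close> is the claim.
\<close>

lemma powr_over_weight_tendsto_zero:
  fixes a :: "nat \<Rightarrow> real" and N :: "nat \<Rightarrow> nat"
  assumes apos: "\<And>k. k \<ge> 1 \<Longrightarrow> 0 < a k" and s: "0 < s" "s < 1" and t: "t \<le> 1" and c: "c > 0"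
    and N: "\<And>j. j \<ge> 1 \<Longrightarrow> 2 ^ j \<le> N j"
    and lim: "(\<lambda>j. ln (real (N j)) / ((2 * real j * a j / c) powr s + real j powr t)) \<longlonglongrightarrow> 0"
  shows "(\<lambda>j. real j powr ((1 - s) / s) / a j) \<longlonglongrightarrow> 0"
proof -
  define q where "q j = ln (real (N j)) / ((2 * real j * a j / c) powr s + real j powr t)" for j
  have q0: "q \<longlonglongrightarrow> 0"
    using lim by (simp add: q_def[abs_def])
  have "eventually (\<lambda>j. q j < ln 2 / 2) sequentially"
    using q0 by (intro order_tendstoD) auto
  then have ev: "eventually (\<lambda>j. norm (real j powr ((1 - s) / s) / a j) \<le>
      (2 / c) * (\<bar>q j\<bar> * (2 / ln 2)) powr (1 / s)) sequentially"
    using eventually_ge_at_top[of 1]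
  proof eventually_elim
    case (elim j)
    have j: "real j \<ge> 1"
      using elim by simp
    have aj: "0 < a j"
      using apos elim by simp
    define x where "x = 2 * real j * a j / c"
    have x: "x > 0"
      using j aj c by (simp add: x_def)
    have "ln (2 ^ j) \<le> ln (real (N j))"
    proof (subst ln_le_cancel_iff)
      show "(2::real) ^ j \<le> real (N j)"
        using N[of j] elim by (metis of_nat_le_iff of_nat_numeral of_nat_power)
      then show "0 < real (N j)"
        using zero_less_power[of "2::real" j] by linarith
    qed simp
    then have l: "real j * ln 2 \<le> ln (real (N j))"
      by (simp add: ln_realpow)
    have den: "0 < x powr s + real j powr t"
      using x by (simp add: add_pos_nonneg)
    have "ln (real (N j)) = q j * (x powr s + real j powr t)"
      using den by (simp add: q_def x_def)
    moreover have q: "0 \<le> q j"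
      unfolding q_def x_def[symmetric] using den l j ln_gt_zero[of "2::real"]
      by (intro divide_nonneg_pos order_trans[OF _ l]) auto
    moreover have "q j * (x powr s + real j powr t) \<le> q j * x powr s + ln 2 / 2 * real j"
      unfolding distrib_left using elim q powr_mono[of t 1 "real j"] j t
      by (intro add_mono mult_mono) auto
    ultimately have "real j * (ln 2 / 2) \<le> q j * x powr s"
      using l by (simp only: times_divide_eq_left times_divide_eq_right mult.commute[of "ln 2"])
    then have "real j \<le> (q j * (2 / ln 2)) * x powr s"
      by (simp add: field_simps)
    then have "real j powr (1 / s) \<le> ((q j * (2 / ln 2)) * x powr s) powr (1 / s)"
      using s by (intro powr_mono2) auto
    also have "\<dots> = (q j * (2 / ln 2)) powr (1 / s) * x"
    proof -
      have "(Q * x powr s) powr (1 / s) = Q powr (1 / s) * x" if "0 \<le> Q" for Q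
        using that x s by (simp add: powr_mult powr_powr)
      from this[of "q j * (2 / ln 2)"] q show ?thesis
        by simp
    qed
    finally have "real j powr (1 / s) \<le> (q j * (2 / ln 2)) powr (1 / s) * ((2 / c) * a j) * real j"
      by (simp add: x_def mult_ac)
    moreover have "real j powr (1 / s) = real j powr ((1 - s) / s) * real j"
      using j s powr_add[of "real j" "(1 - s) / s" 1] by (simp add: field_simps)
    ultimately have "real j powr ((1 - s) / s) * real j \<le>
        (q j * (2 / ln 2)) powr (1 / s) * ((2 / c) * a j) * real j"
      by (simp only:)
    then have "real j powr ((1 - s) / s) \<le> (q j * (2 / ln 2)) powr (1 / s) * ((2 / c) * a j)"
      by (rule mult_right_le_imp_le) (use j in simp)
    then show ?case
      using aj q by (simp add: pos_divide_le_eq mult_ac)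
  qed
  have "(\<lambda>j. (\<bar>q j\<bar> * (2 / ln 2)) powr (1 / s)) \<longlonglongrightarrow> 0"
  proof -
    have "(\<lambda>j. \<bar>q j\<bar> * (2 / ln 2)) \<longlonglongrightarrow> 0"
      using q0 by (intro tendsto_mult_left_zero tendsto_rabs_zero)
    then show ?thesis
      using s by (intro tendsto_zero_powrI[where b = "1 / s"]) auto
  qed
  then have "(\<lambda>j. (2 / c) * (\<bar>q j\<bar> * (2 / ln 2)) powr (1 / s)) \<longlonglongrightarrow> 0"
    by (rule tendsto_mult_right_zero)
  with ev show ?thesis
    by (rule Lim_null_comparison)
qed

section \<open>The Korobov kernel in the Hartley basis\<close>

definition phase :: "nat \<Rightarrow> (nat \<Rightarrow> int) \<Rightarrow> (nat \<Rightarrow> real) \<Rightarrow> real" where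
  "phase d h x = 2 * pi * (\<Sum>k=1..d. real_of_int (h k) * x k)"

text \<open>
  The Hartley kernel.  The functions \<open>cas d h\<close> for all \<open>h\<close> play the role of the complex exponentials, but
  they are real valued.
\<close>

definition cas :: "nat \<Rightarrow> (nat \<Rightarrow> int) \<Rightarrow> (nat \<Rightarrow> real) \<Rightarrow> real" where
  "cas d h x = cos (phase d h x) + sin (phase d h x)"

lemma cis_phase: "cis (phase d h x) = (\<Prod>k=1..d. cis (2 * pi * real_of_int (h k) * x k))"
  by (simp add: phase_def cis_conv_exp exp_sum[symmetric] sum_distrib_left mult_ac)

text \<open>
  Integrals and grid averages of such products thus reduce to those of the characters
  \<open>cis (phase d p x)\<close>, which are \<open>1\<close> for \<open>p = 0\<close> and \<open>0\<close> otherwise, for averages over fine enough grids.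
  Both values are real, so the second summand does not contribute.
\<close>

lemma cas_mult:
  "cas d g x * cas d h x =
    Re (cis (phase d (\<lambda>k. g k - h k) x)) + Im (cis (phase d (\<lambda>k. g k + h k) x))"
proof -
  have *: "phase d (\<lambda>k. g k - h k) x = phase d g x - phase d h x"
    "phase d (\<lambda>k. g k + h k) x = phase d g x + phase d h x"
    by (simp_all add: phase_def algebra_simps sum.distrib sum_subtractf)
  show ?thesis
    unfolding cas_def * by (simp add: cos_diff sin_add algebra_simps)
qed

lemma cas_mult_points:
  "cas d h x * cas d h y = cos (phase d h x - phase d h y) + sin (phase d h x + phase d h y)"
  by (simp add: cas_def cos_diff sin_add algebra_simps)

lemma abs_cas_le: "\<bar>cas d h x\<bar> \<le> 2"
  unfolding cas_def using abs_cos_le_one[of "phase d h x"] abs_sin_le_one[of "phase d h x"] by linarith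

lemma PiE_zero_diff_iff:
  assumes "g \<in> A \<rightarrow>\<^sub>E (UNIV :: int set)" "h \<in> A \<rightarrow>\<^sub>E UNIV"
  shows "(\<forall>k\<in>A. g k - h k = 0) \<longleftrightarrow> g = h"
  using assms by (auto intro: PiE_ext)

subsection \<open>Quadrature\<close>

definition grid :: "nat \<Rightarrow> nat \<Rightarrow> (nat \<Rightarrow> real) set" where
  "grid d m = ({1..d} \<rightarrow>\<^sub>E (\<lambda>j. real j / real m) ` {..<m})"

lemma finite_grid: "finite (grid d m)"
  by (simp add: grid_def finite_PiE)

lemma grid_subset: "grid d m \<subseteq> unit_cube d"
  unfolding grid_def unit_cube_def by (intro PiE_mono) auto

lemma sum_roots_of_unity:
  assumes "\<bar>n\<bar> < int m"
  shows "(\<Sum>j<m. cis (2 * pi * real_of_int n * (real j / real m))) = (if n = 0 then of_nat m else 0)"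
proof (cases "n = 0")
  case False
  define z where "z = cis (2 * pi * real_of_int n / real m)"
  have m: "m > 0"
    using assms by linarith
  have "z \<noteq> 1"
  proof
    assume "z = 1"
    then have "cos (2 * pi * real_of_int n / real m) = 1"
      by (auto simp: z_def complex_eq_iff)
    then obtain i :: int where "2 * pi * real_of_int n / real m = real_of_int i * 2 * pi"
      unfolding cos_one_2pi_int by blast
    then have "real_of_int n = real_of_int (i * int m)"
      using m by (simp add: field_simps)
    then have "n = i * int m"
      by (simp only: of_int_eq_iff)
    then have "int m dvd n"
      by simp
    with assms False show False
      by (meson abs_dvd_iff dvd_imp_le_int not_less order.trans abs_ge_self)
  qed
  have "z ^ m = 1"
    unfolding z_def Complex.DeMoivre using m by (simp add: cis_multiple_2pi)
  have "(\<Sum>j<m. cis (2 * pi * real_of_int n * (real j / real m))) = (\<Sum>j<m. z ^ j)"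
    by (intro sum.cong) (simp_all add: z_def Complex.DeMoivre mult_ac)
  also have "\<dots> = 0"
    using \<open>z \<noteq> 1\<close> \<open>z ^ m = 1\<close> by (simp add: geometric_sum)
  finally show ?thesis
    using False by simp
qed simp

lemma grid_average_cis:
  assumes "m > 0" "\<And>k. k \<in> {1..d} \<Longrightarrow> \<bar>p k\<bar> < int m"
  shows "(\<Sum>y\<in>grid d m. cis (phase d p y)) / of_nat (card (grid d m)) =
    (if \<forall>k\<in>{1..d}. p k = 0 then 1 else 0)"
proof -
  have inj: "inj_on (\<lambda>j. real j / real m) {..<m}"
    using assms(1) by (auto simp: inj_on_def)
  have "(\<Sum>y\<in>grid d m. cis (phase d p y)) =
      (\<Prod>k=1..d. \<Sum>v\<in>(\<lambda>j. real j / real m) ` {..<m}. cis (2 * pi * real_of_int (p k) * v))"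
    unfolding grid_def cis_phase by (rule prod_sum_PiE[symmetric]) auto
  also have "\<dots> = (\<Prod>k=1..d. if p k = 0 then of_nat m else 0)"
  proof (intro prod.cong refl)
    fix k
    assume k: "k \<in> {1..d}"
    have "(\<Sum>v\<in>(\<lambda>j. real j / real m) ` {..<m}. cis (2 * pi * real_of_int (p k) * v)) =
        (\<Sum>j<m. cis (2 * pi * real_of_int (p k) * (real j / real m)))"
      by (simp only: sum.reindex[OF inj] o_def)
    also have "\<dots> = (if p k = 0 then of_nat m else 0)"
      by (rule sum_roots_of_unity[OF assms(2)[OF k]])
    finally show "(\<Sum>v\<in>(\<lambda>j. real j / real m) ` {..<m}. cis (2 * pi * real_of_int (p k) * v)) =
        (if p k = 0 then of_nat m else 0)" .
  qed
  finally have sum: "(\<Sum>y\<in>grid d m. cis (phase d p y)) = (\<Prod>k=1..d. if p k = 0 then of_nat m else 0)" .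
  have card: "card (grid d m) = m ^ d"
    by (simp add: grid_def card_PiE card_image[OF inj])
  show ?thesis
  proof (cases "\<forall>k\<in>{1..d}. p k = 0")
    case True
    then have "(\<Prod>k=1..d. if p k = 0 then of_nat m else 0) = (of_nat m ^ d :: complex)"
      by simp
    then show ?thesis
      using True assms(1) by (simp add: sum card)
  next
    case False
    then have "(\<Prod>k=1..d. if p k = 0 then of_nat m else 0) = (0 :: complex)"
      by (intro prod_zero) auto
    then show ?thesis
      unfolding if_not_P[OF False] by (simp only: sum div_0)
  qed
qed

text \<open>
  Equality holds as soon as the mesh is too fine for \<open>g - h\<close> or \<open>g + h\<close> to be aliased to \<open>0\<close>.
\<close>

lemma grid_quadrature:
  assumes g: "g \<in> {1..d} \<rightarrow>\<^sub>E UNIV" and h: "h \<in> {1..d} \<rightarrow>\<^sub>E UNIV"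
  shows "(\<lambda>m. (\<Sum>y\<in>grid d m. cas d g y * cas d h y) / real (card (grid d m))) \<longlonglongrightarrow> (if g = h then 1 else 0)"
proof (rule tendsto_eventually)
  define L where "L = (\<Sum>k=1..d. \<bar>g k\<bar> + \<bar>h k\<bar>)"
  have L: "\<bar>g k\<bar> + \<bar>h k\<bar> \<le> L" if "k \<in> {1..d}" for k
    unfolding L_def using that by (intro member_le_sum) auto
  show "eventually (\<lambda>m. (\<Sum>y\<in>grid d m. cas d g y * cas d h y) / real (card (grid d m)) = (if g = h then 1 else 0)) sequentially"
    using eventually_gt_at_top[of "nat L"]
  proof eventually_elim
    case (elim m)
    define c where "c = card (grid d m)"
    have m: "m > 0" "L < int m"
      using elim by linarith+
    have small: "\<bar>g k - h k\<bar> < int m" "\<bar>g k + h k\<bar> < int m" if "k \<in> {1..d}" for k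
      using L[OF that] m by linarith+
    have "(\<Sum>y\<in>grid d m. cas d g y * cas d h y) / real c =
        Re ((\<Sum>y\<in>grid d m. cis (phase d (\<lambda>k. g k - h k) y)) / of_nat c) +
        Im ((\<Sum>y\<in>grid d m. cis (phase d (\<lambda>k. g k + h k) y)) / of_nat c)"
      by (simp add: cas_mult sum.distrib add_divide_distrib)
    also have "\<dots> = (if \<forall>k\<in>{1..d}. g k - h k = 0 then 1 else 0)"
      unfolding c_def using small
      by (subst (1 2) grid_average_cis[OF m(1)]) auto
    finally show ?case
      using PiE_zero_diff_iff[OF g h] by (simp only: c_def)
  qed
qed

subsection \<open>Orthonormality\<close>

abbreviation unit_interval_measure :: "real measure" where
  "unit_interval_measure \<equiv> restrict_space lborel {0..1}"

lemma finite_unit_interval_measure: "finite_measure unit_interval_measure"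
  by (rule finite_measureI) (simp add: emeasure_restrict_space space_restrict_space)

lemma product_sigma_finite_unit_interval: "product_sigma_finite (\<lambda>k::nat. unit_interval_measure)"
  unfolding product_sigma_finite_def
  using finite_measure.axioms(1)[OF finite_unit_interval_measure] by simp

lemma space_cube_measure: "space (cube_measure d) = unit_cube d"
  by (simp add: cube_measure_def unit_cube_def space_PiM space_restrict_space)

lemma finite_cube_measure: "finite_measure (cube_measure d)"
proof (rule finite_measureI)
  interpret product_sigma_finite "\<lambda>k::nat. unit_interval_measure"
    by (rule product_sigma_finite_unit_interval)
  have "emeasure (cube_measure d) (space (cube_measure d)) =
      (\<Prod>k\<in>{1..d}. emeasure unit_interval_measure (space unit_interval_measure))"
    unfolding cube_measure_def space_PiM by (rule emeasure_PiM) (simp, rule sets.top)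
  also have "\<dots> = 1"
    by (simp add: emeasure_restrict_space space_restrict_space)
  finally show "emeasure (cube_measure d) (space (cube_measure d)) \<noteq> \<infinity>"
    by simp
qed

lemma integral_cis_unit_interval:
  "(\<integral>t. cis (2 * pi * real_of_int n * t) \<partial>unit_interval_measure) = (if n = 0 then 1 else 0)"
proof -
  have *: "(\<integral>t. cis (2 * pi * real_of_int n * t) \<partial>unit_interval_measure) =
      (\<integral>t. indicator {0..1} t *\<^sub>R cis (2 * pi * real_of_int n * t) \<partial>lborel)"
    by (rule integral_restrict_space) simp
  show ?thesis
  proof (cases "n = 0")
    case True
    then show ?thesis
      unfolding * by simp
  next
    case False
    define c where "c = 2 * complex_of_real pi * of_int n * \<i>"
    define F where "F t = exp (complex_of_real t * c) / c" for t
    have c: "c \<noteq> 0"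
      using False by (simp add: c_def)
    have cis: "cis (2 * pi * real_of_int n * t) = exp (complex_of_real t * c)" for t
      by (simp add: cis_conv_exp c_def mult_ac)
    have "has_bochner_integral lborel (\<lambda>t. indicator {0..1} t *\<^sub>R cis (2 * pi * real_of_int n * t)) (F 1 - F 0)"
    proof (rule has_bochner_integral_FTC_Icc)
      show "(F has_vector_derivative cis (2 * pi * real_of_int n * t)) (at t within {0..1})" for t
        unfolding F_def cis
      proof (rule has_vector_derivative_real_field)
        show "((\<lambda>z. exp (z * c) / c) has_field_derivative exp (complex_of_real t * c)) (at (complex_of_real t))"
          using c by (auto intro!: derivative_eq_intros)
      qed
      show "continuous_on {0..1} (\<lambda>t. cis (2 * pi * real_of_int n * t))"
        by (intro continuous_intros)
    qed simp
    moreover have "F 1 - F 0 = 0"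
      using cis_multiple_2pi[of "real_of_int n"] cis[of 1] by (simp add: F_def)
    ultimately show ?thesis
      unfolding * using False has_bochner_integral_integral_eq by fastforce
  qed
qed

lemma coordinate_measurable:
  assumes "k \<in> {1..d}"
  shows "(\<lambda>x. x k) \<in> borel_measurable (cube_measure d)"
proof -
  have "(\<lambda>x. x k) \<in> measurable (cube_measure d) unit_interval_measure"
    unfolding cube_measure_def using assms by (rule measurable_component_singleton)
  moreover have "(\<lambda>t. t) \<in> borel_measurable unit_interval_measure"
    by (intro measurable_restrict_space1) simp
  ultimately show ?thesis
    by (rule measurable_compose)
qed

lemma phase_measurable: "phase d h \<in> borel_measurable (cube_measure d)"
  unfolding phase_def[abs_def]
  by (intro borel_measurable_times borel_measurable_const borel_measurable_sum coordinate_measurable)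

lemma cas_measurable: "cas d h \<in> borel_measurable (cube_measure d)"
proof -
  have "(\<lambda>t :: real. cos t + sin t) \<in> borel_measurable borel"
    by (intro borel_measurable_continuous_onI continuous_intros)
  from measurable_compose[OF phase_measurable this] show ?thesis
    unfolding cas_def[abs_def] .
qed

lemma integrable_cis_phase: "integrable (cube_measure d) (\<lambda>x. cis (phase d h x))"
proof -
  interpret finite_measure "cube_measure d"
    by (rule finite_cube_measure)
  have "(\<lambda>x. cis (phase d h x)) \<in> borel_measurable (cube_measure d)"
    by (rule measurable_compose[OF phase_measurable])
      (intro borel_measurable_continuous_onI continuous_intros)
  then show ?thesis
    by (intro integrable_const_bound[of _ 1]) auto
qed

lemma integral_cis_phase:
  "(\<integral>x. cis (phase d p x) \<partial>cube_measure d) = (if \<forall>k\<in>{1..d}. p k = 0 then 1 else 0)"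
proof -
  interpret product_sigma_finite "\<lambda>k::nat. unit_interval_measure"
    by (rule product_sigma_finite_unit_interval)
  have int: "integrable unit_interval_measure (\<lambda>t. cis (2 * pi * real_of_int n * t))" for n
  proof (rule finite_measure.integrable_const_bound[OF finite_unit_interval_measure, of _ 1])
    show "(\<lambda>t. cis (2 * pi * real_of_int n * t)) \<in> borel_measurable unit_interval_measure"
    proof (rule measurable_restrict_space1)
      have "(\<lambda>t. cis (2 * pi * real_of_int n * t)) \<in> borel_measurable borel"
        by (intro borel_measurable_continuous_onI continuous_intros)
      then show "(\<lambda>t. cis (2 * pi * real_of_int n * t)) \<in> borel_measurable lborel"
        by simp
    qed
  qed auto
  have "(\<integral>x. cis (phase d p x) \<partial>cube_measure d) =
      (\<Prod>k=1..d. \<integral>t. cis (2 * pi * real_of_int (p k) * t) \<partial>unit_interval_measure)"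
    unfolding cis_phase cube_measure_def by (rule product_integral_prod) (simp_all add: int)
  also have "\<dots> = (\<Prod>k=1..d. if p k = 0 then 1 else 0)"
    by (simp add: integral_cis_unit_interval)
  also have "\<dots> = (if \<forall>k\<in>{1..d}. p k = 0 then 1 else 0)"
    by (cases "\<forall>k\<in>{1..d}. p k = 0") (auto intro!: prod_zero)
  finally show ?thesis .
qed

lemma integral_cas_mult:
  assumes g: "g \<in> {1..d} \<rightarrow>\<^sub>E UNIV" and h: "h \<in> {1..d} \<rightarrow>\<^sub>E UNIV"
  shows "(\<integral>x. cas d g x * cas d h x \<partial>cube_measure d) = (if g = h then 1 else 0)"
proof -
  have "(\<integral>x. cas d g x * cas d h x \<partial>cube_measure d) =
      Re (\<integral>x. cis (phase d (\<lambda>k. g k - h k) x) \<partial>cube_measure d) +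
      Im (\<integral>x. cis (phase d (\<lambda>k. g k + h k) x) \<partial>cube_measure d)"
    unfolding cas_mult integral_Re[OF integrable_cis_phase, symmetric]
      integral_Im[OF integrable_cis_phase, symmetric]
    by (intro Bochner_Integration.integral_add integrable_Re integrable_Im integrable_cis_phase)
  also have "\<dots> = (if \<forall>k\<in>{1..d}. g k - h k = 0 then 1 else 0)"
    unfolding integral_cis_phase by auto
  finally show ?thesis
    using PiE_zero_diff_iff[OF g h] by (simp only:)
qed

subsection \<open>Expansion\<close>

lemma korobov_weight_eq: "korobov_weight \<omega> a b d h = \<omega> powr exponent a b d h"
  by (simp add: korobov_weight_def exponent_def)

lemma korobov_weight_summable:
  assumes \<omega>: "0 < \<omega>" "\<omega> < 1" and \<beta>: "\<beta> > 0"
    and a: "\<And>k. k \<in> {1..d} \<Longrightarrow> 0 < a k" and b: "\<And>k. k \<in> {1..d} \<Longrightarrow> \<beta> \<le> b k"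
  shows "korobov_weight \<omega> a b d summable_on ({1..d} \<rightarrow>\<^sub>E UNIV)"
proof (rule nonneg_bdd_above_summable_on)
  show "bdd_above (sum (korobov_weight \<omega> a b d) ` {F. F \<subseteq> {1..d} \<rightarrow>\<^sub>E UNIV \<and> finite F})"
  proof (rule bdd_aboveI2)
    fix F :: "(nat \<Rightarrow> int) set"
    assume F: "F \<in> {F. F \<subseteq> {1..d} \<rightarrow>\<^sub>E UNIV \<and> finite F}"
    have "sum (korobov_weight \<omega> a b d) F = (\<Sum>h\<in>F. exp (- (- ln \<omega>) * exponent a b d h))"
      using \<omega> by (intro sum.cong) (auto simp: korobov_weight_eq powr_def)
    also have "\<dots> \<le> (\<Prod>k=1..d. 1 + 2 * decay_sum \<beta> (- ln \<omega> * a k))"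
      using F \<omega> by (intro sum_exp_exponent_le \<beta> a b) auto
    finally show "sum (korobov_weight \<omega> a b d) F \<le> (\<Prod>k=1..d. 1 + 2 * decay_sum \<beta> (- ln \<omega> * a k))" .
  qed
qed (simp add: korobov_weight_def)

lemma infsum_odd_eq_0:
  fixes f :: "(nat \<Rightarrow> int) \<Rightarrow> real"
  assumes "\<And>h. h \<in> {1..d} \<rightarrow>\<^sub>E UNIV \<Longrightarrow> f (\<lambda>k\<in>{1..d}. - h k) = - f h"
  shows "(\<Sum>\<^sub>\<infinity>h\<in>{1..d} \<rightarrow>\<^sub>E UNIV. f h) = 0"
proof -
  define r where "r h = (\<lambda>k\<in>{1..d}. - h k)" for h :: "nat \<Rightarrow> int"
  have r: "r (r h) = h" "r h \<in> {1..d} \<rightarrow>\<^sub>E UNIV" if "h \<in> {1..d} \<rightarrow>\<^sub>E UNIV" for h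
  proof -
    show "r (r h) = h"
    proof
      fix k
      show "r (r h) k = h k"
        using PiE_arb[OF that, of k] by (simp add: r_def)
    qed
    show "r h \<in> {1..d} \<rightarrow>\<^sub>E UNIV"
      by (simp add: r_def)
  qed
  have "bij_betw r ({1..d} \<rightarrow>\<^sub>E UNIV) ({1..d} \<rightarrow>\<^sub>E UNIV)"
  proof (rule bij_betw_byWitness[where f' = r])
    show "r ` ({1..d} \<rightarrow>\<^sub>E UNIV) \<subseteq> {1..d} \<rightarrow>\<^sub>E UNIV"
      by (rule image_subsetI) (rule r(2))
    then show "r ` ({1..d} \<rightarrow>\<^sub>E UNIV) \<subseteq> {1..d} \<rightarrow>\<^sub>E UNIV" .
  qed (simp_all add: r(1))
  then have "(\<Sum>\<^sub>\<infinity>h\<in>{1..d} \<rightarrow>\<^sub>E UNIV. f h) = (\<Sum>\<^sub>\<infinity>h\<in>{1..d} \<rightarrow>\<^sub>E UNIV. f (r h))"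
    by (rule infsum_reindex_bij_betw[symmetric])
  also have "\<dots> = (\<Sum>\<^sub>\<infinity>h\<in>{1..d} \<rightarrow>\<^sub>E UNIV. - f h)"
    using assms by (intro infsum_cong) (simp add: r_def)
  also have "\<dots> = - (\<Sum>\<^sub>\<infinity>h\<in>{1..d} \<rightarrow>\<^sub>E UNIV. f h)"
    by (rule infsum_uminus)
  finally show ?thesis
    by simp
qed

text \<open>
  The product \<open>cas d h x * cas d h y\<close> differs from the real part of the character by a sine, which is odd in \<open>h\<close>
  and is annihilated by the even weights.
\<close>

lemma korobov_kernel_cas_expansion:
  assumes summable: "korobov_weight \<omega> a b d summable_on ({1..d} \<rightarrow>\<^sub>E UNIV)"
  shows "korobov_kernel \<omega> a b d x y =
    (\<Sum>\<^sub>\<infinity>h\<in>{1..d} \<rightarrow>\<^sub>E UNIV. korobov_weight \<omega> a b d h * (cas d h x * cas d h y))"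
proof -
  let ?I = "{1..d} \<rightarrow>\<^sub>E (UNIV :: int set)"
  let ?w = "korobov_weight \<omega> a b d"
  have w0: "0 \<le> ?w h" for h
    by (simp add: korobov_weight_def)
  have "korobov_kernel \<omega> a b d x y =
      Re (\<Sum>\<^sub>\<infinity>h\<in>?I. complex_of_real (?w h) * cis (phase d h x - phase d h y))"
    unfolding korobov_kernel_def
    by (intro arg_cong[where f = Re] infsum_cong)
      (simp add: cis_conv_exp phase_def right_diff_distrib sum_subtractf mult_ac)
  also have "\<dots> = (\<Sum>\<^sub>\<infinity>h\<in>?I. Re (complex_of_real (?w h) * cis (phase d h x - phase d h y)))"
  proof (rule infsum_Re[symmetric])
    have "(\<lambda>h. norm (complex_of_real (?w h) * cis (phase d h x - phase d h y))) summable_on ?I"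
      using summable w0 by (simp add: norm_mult)
    then show "(\<lambda>h. complex_of_real (?w h) * cis (phase d h x - phase d h y)) summable_on ?I"
      by (rule abs_summable_summable)
  qed
  also have "\<dots> = (\<Sum>\<^sub>\<infinity>h\<in>?I. ?w h * cos (phase d h x - phase d h y))"
    by simp
  also have "\<dots> = (\<Sum>\<^sub>\<infinity>h\<in>?I. ?w h * cos (phase d h x - phase d h y)) +
      (\<Sum>\<^sub>\<infinity>h\<in>?I. ?w h * sin (phase d h x + phase d h y))"
  proof -
    have "(\<Sum>\<^sub>\<infinity>h\<in>?I. ?w h * sin (phase d h x + phase d h y)) = 0"
    proof (rule infsum_odd_eq_0)
      fix h :: "nat \<Rightarrow> int"
      have "phase d (\<lambda>k\<in>{1..d}. - h k) z = - phase d h z" for z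
        by (simp add: phase_def sum_negf)
      moreover have "?w (\<lambda>k\<in>{1..d}. - h k) = ?w h"
        by (simp add: korobov_weight_def)
      ultimately show "?w (\<lambda>k\<in>{1..d}. - h k) *
          sin (phase d (\<lambda>k\<in>{1..d}. - h k) x + phase d (\<lambda>k\<in>{1..d}. - h k) y) =
          - (?w h * sin (phase d h x + phase d h y))"
        using sin_minus[of "phase d h x + phase d h y"] by simp
    qed
    then show ?thesis
      by simp
  qed
  also have "\<dots> = (\<Sum>\<^sub>\<infinity>h\<in>?I. ?w h * cos (phase d h x - phase d h y) + ?w h * sin (phase d h x + phase d h y))"
    using summable w0
    by (intro infsum_add[symmetric] summable_mult_bounded[where C = 1]) auto
  finally show ?thesis
    by (simp add: cas_mult_points distrib_left)
qed

text \<open>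
  Taking logarithms, \<open>\<epsilon>\<^sup>2 < korobov_weight \<omega> a b d h\<close> is a strict upper bound for the exponent.
\<close>

theorem korobov_information_complexity:
  assumes rkhs: "rkhs (unit_cube d) (korobov_kernel \<omega> a b d) H ip"
    and \<omega>: "0 < \<omega>" "\<omega> < 1" and \<beta>: "\<beta> > 0"
    and a: "\<And>k. k \<in> {1..d} \<Longrightarrow> 0 < a k" and b: "\<And>k. k \<in> {1..d} \<Longrightarrow> \<beta> \<le> b k"
    and \<epsilon>: "0 < \<epsilon>"
  shows "information_complexity (cube_measure d) H ip \<epsilon> =
    index_count a b d (2 / ln (1 / \<omega>) * ln (1 / \<epsilon>))"
proof -
  have summable: "korobov_weight \<omega> a b d summable_on ({1..d} \<rightarrow>\<^sub>E UNIV)"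
    by (rule korobov_weight_summable[OF \<omega> \<beta> a b])
  interpret mercer_rkhs "unit_cube d" "korobov_kernel \<omega> a b d" H ip "cube_measure d"
    "{1..d} \<rightarrow>\<^sub>E UNIV" "korobov_weight \<omega> a b d" "cas d" 2 "grid d"
  proof (intro mercer_rkhs.intro mercer_rkhs_axioms.intro)
    show "rkhs (unit_cube d) (korobov_kernel \<omega> a b d) H ip"
      by (rule rkhs)
    show "0 < korobov_weight \<omega> a b d h" for h
      using \<omega> by (simp add: korobov_weight_def)
    show "korobov_kernel \<omega> a b d x y =
        (\<Sum>\<^sub>\<infinity>h\<in>{1..d} \<rightarrow>\<^sub>E UNIV. korobov_weight \<omega> a b d h * (cas d h x * cas d h y))" for x y
      by (rule korobov_kernel_cas_expansion[OF summable])
  qed (rule finite_cube_measure space_cube_measure summable cas_measurable abs_cas_le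
      integral_cas_mult finite_grid grid_subset grid_quadrature; assumption)+
  have "\<epsilon>\<^sup>2 < korobov_weight \<omega> a b d h \<longleftrightarrow> exponent a b d h < 2 / ln (1 / \<omega>) * ln (1 / \<epsilon>)" for h
  proof -
    have "\<epsilon>\<^sup>2 < korobov_weight \<omega> a b d h \<longleftrightarrow> ln (\<epsilon>\<^sup>2) < ln (korobov_weight \<omega> a b d h)"
      using \<epsilon> \<omega> by (subst ln_less_cancel_iff) (auto simp: korobov_weight_def)
    also have "\<dots> \<longleftrightarrow> 2 * ln \<epsilon> < exponent a b d h * ln \<omega>"
      using \<epsilon> \<omega> by (simp add: ln_realpow korobov_weight_eq ln_powr)
    also have "\<dots> \<longleftrightarrow> exponent a b d h < 2 / ln (1 / \<omega>) * ln (1 / \<epsilon>)"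
      using \<epsilon> \<omega> ln_less_zero[OF \<omega>] by (simp add: ln_div field_simps)
    finally show ?thesis .
  qed
  then show ?thesis
    using information_complexity_eq_card[OF \<epsilon>] by (simp add: index_count_def)
qed

section \<open>Characterisation of exponential convergent weak tractability\<close>

theorem theorem1p1:
  fixes \<omega> :: real
    and a b :: "nat \<Rightarrow> real"
    and H :: "nat \<Rightarrow> ((nat \<Rightarrow> real) \<Rightarrow> real) set"
    and ip :: "nat \<Rightarrow> ((nat \<Rightarrow> real) \<Rightarrow> real) \<Rightarrow> ((nat \<Rightarrow> real) \<Rightarrow> real) \<Rightarrow> real"
  assumes "0 < \<omega>" and "\<omega> < 1"
    and "0 < a 1" and "\<And>k. k \<ge> 1 \<Longrightarrow> a k \<le> a (Suc k)"
    and "\<And>k. k \<ge> 1 \<Longrightarrow> 0 < b k" and "0 < (INF k\<in>{1..}. b k)"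
    and "\<And>d. d \<ge> 1 \<Longrightarrow> rkhs (unit_cube d) (korobov_kernel \<omega> a b d) (H d) (ip d)"
  shows "(\<forall>t. 0 < t \<and> t < 1 \<longrightarrow>
            (EC_WT (\<lambda>\<epsilon> d. information_complexity (cube_measure d) (H d) (ip d) \<epsilon>) 1 t \<longleftrightarrow>
              (\<lambda>j. ln (real j) / a j) \<longlonglongrightarrow> 0)) \<and>
         (\<forall>s t. 0 < s \<and> s < 1 \<and> 0 < t \<and> t \<le> 1 \<longrightarrow>
            (EC_WT (\<lambda>\<epsilon> d. information_complexity (cube_measure d) (H d) (ip d) \<epsilon>) s t \<longleftrightarrow>
              (\<lambda>j. real j powr ((1 - s) / s) / a j) \<longlonglongrightarrow> 0))"
proof -
  define \<beta> where "\<beta> = (INF k\<in>{1..}. b k)"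
  have \<beta>: "\<beta> > 0"
    using assms(6) by (simp add: \<beta>_def)
  have b: "\<beta> \<le> b k" if "k \<ge> 1" for k
  proof -
    have "bdd_below (b ` {1..})"
      using assms(5) by (intro bdd_belowI2[of _ 0]) (auto intro: less_imp_le)
    then show ?thesis
      unfolding \<beta>_def using that by (intro cINF_lower) auto
  qed
  have a_mono: "a i \<le> a k" if "1 \<le> i" "i \<le> k" for i k
    using that(2,1)
  proof (induction rule: dec_induct)
    case (step n)
    then show ?case
      using assms(4)[of n] by simp
  qed simp
  have a_min: "a 1 \<le> a k" if "k \<ge> 1" for k
    using a_mono[of 1 k] that by simp
  have apos: "0 < a k" if "k \<ge> 1" for k
    using a_mono[of 1 k] that assms(3) by linarith
  define c where "c = 2 / ln (1 / \<omega>)"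
  have c: "c > 0"
    using assms(1,2) by (simp add: c_def)
  define n where "n \<epsilon> d = information_complexity (cube_measure d) (H d) (ip d) \<epsilon>" for \<epsilon> d
  have fin: "finite {h \<in> {1..d} \<rightarrow>\<^sub>E UNIV. exponent a b d h < R}" for d R
    using index_set_finite_card_le(1)[of 1 \<beta> d a b R] \<beta> apos b by simp
  have n_eq: "n \<epsilon> d = index_count a b d (c * ln (1 / \<epsilon>))" if "0 < \<epsilon>" "d \<ge> 1" for \<epsilon> d
    unfolding n_def c_def
    by (rule korobov_information_complexity[OF assms(7)[OF that(2)] assms(1,2) \<beta> _ _ that(1)])
      (use apos b in auto)
  have n_pos: "n \<epsilon> d \<ge> 1" if "\<epsilon> \<in> {0<..<1}" "d \<ge> 1" for \<epsilon> d
  proof -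
    have "(\<lambda>k\<in>{1..d}. 0) \<in> {h \<in> {1..d} \<rightarrow>\<^sub>E UNIV. exponent a b d h < c * ln (1 / \<epsilon>)}"
      using that c by (intro zero_index_in) simp
    then have "0 < index_count a b d (c * ln (1 / \<epsilon>))"
      unfolding index_count_def card_gt_0_iff using fin by blast
    then show ?thesis
      using n_eq[of \<epsilon> d] that by simp
  qed
  have sufficient: "EC_WT n s t"
    if "0 < s" "0 < t"
      and bound: "\<And>\<eta>. \<eta> > 0 \<Longrightarrow> \<exists>C. \<forall>R>0. \<forall>d. ln (real (index_count a b d R)) \<le> \<eta> * R powr s + C"
    for s t
  proof (rule EC_WT_I[OF that(1,2) n_pos])
    fix \<eta> :: real
    assume "\<eta> > 0"
    then obtain C where C: "\<And>R d. R > 0 \<Longrightarrow> ln (real (index_count a b d R)) \<le> \<eta> / c powr s * R powr s + C"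
      using bound[of "\<eta> / c powr s"] c by auto
    have "ln (real (n \<epsilon> d)) \<le> \<eta> * ln (1 / \<epsilon>) powr s + C" if "\<epsilon> \<in> {0<..<1}" "d \<ge> 1" for \<epsilon> d
      using C[of "c * ln (1 / \<epsilon>)" d] n_eq[of \<epsilon> d] that c by (simp add: powr_mult)
    then show "\<exists>C. \<forall>\<epsilon>\<in>{0<..<1}. \<forall>d\<ge>1. ln (real (n \<epsilon> d)) \<le> \<eta> * ln (1 / \<epsilon>) powr s + C"
      by blast
  qed
  have necessary: "(\<lambda>j. ln (real (index_count a b j (R j))) / ((R j / c) powr s + real j powr t)) \<longlonglongrightarrow> 0"
    if EC: "EC_WT n s t" and R: "\<And>j. j \<ge> 1 \<Longrightarrow> R j > 0" for R s t
  proof (rule Lim_transform_eventually)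
    show "(\<lambda>j. ln (real (n (exp (- (R j / c))) j)) / ((R j / c) powr s + real j powr t)) \<longlonglongrightarrow> 0"
      using R c by (intro EC_WT_D[OF EC]) auto
    show "eventually (\<lambda>j. ln (real (n (exp (- (R j / c))) j)) / ((R j / c) powr s + real j powr t) =
        ln (real (index_count a b j (R j))) / ((R j / c) powr s + real j powr t)) sequentially"
      using eventually_ge_at_top[of 1]
    proof eventually_elim
      case (elim j)
      have "c * ln (1 / exp (- (R j / c))) = R j"
        using c by (simp add: ln_div)
      then show ?case
        using n_eq[of "exp (- (R j / c))" j] elim by simp
    qed
  qed
  have part1: "EC_WT n 1 t \<longleftrightarrow> (\<lambda>j. ln (real j) / a j) \<longlonglongrightarrow> 0" if t: "0 < t" "t < 1" for t
  proof
    assume lim: "(\<lambda>j. ln (real j) / a j) \<longlonglongrightarrow> 0"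
    show "EC_WT n 1 t"
    proof (rule sufficient)
      fix \<eta> :: real
      assume \<eta>: "\<eta> > 0"
      have "\<exists>C. \<forall>R>0. \<forall>d. ln (real (index_count a b d R)) \<le> \<eta> * R + C"
        by (rule ln_index_count_le_linear[OF a_min assms(3) \<beta> b lim \<eta>])
      then show "\<exists>C. \<forall>R>0. \<forall>d. ln (real (index_count a b d R)) \<le> \<eta> * R powr 1 + C"
        by simp
    qed (use t in auto)
  next
    assume EC: "EC_WT n 1 t"
    \<comment> \<open>Subsets of this size are counted with \<open>R j = 2 * m j * a j\<close>; the factor 2 makes the bound strict.\<close>
    define m where "m j = nat \<lceil>real j powr ((1 + t) / 2)\<rceil>" for j
    define R where "R j = 2 * real (m j) * a j" for j
    have m: "m j \<ge> 1" if "j \<ge> 1" for j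
    proof -
      have "real j powr ((1 + t) / 2) > 0"
        using that by simp
      then show ?thesis
        unfolding m_def by linarith
    qed
    have R: "R j > 0" if "j \<ge> 1" for j
      using m[OF that] apos[OF that] by (simp add: R_def)
    show "(\<lambda>j. ln (real j) / a j) \<longlonglongrightarrow> 0"
    proof (rule ln_over_weight_tendsto_zero[where a = a and t = t and m = m and c = c
          and N = "\<lambda>j. index_count a b j (R j)", OF a_min assms(3) t c])
      show "(\<lambda>j. ln (real (index_count a b j (R j))) / (2 * real (m j) * a j / c + real j powr t)) \<longlonglongrightarrow> 0"
      proof (rule Lim_transform_eventually[OF necessary[OF EC R]])
        show "eventually (\<lambda>j. ln (real (index_count a b j (R j))) / ((R j / c) powr 1 + real j powr t) =
            ln (real (index_count a b j (R j))) / (2 * real (m j) * a j / c + real j powr t)) sequentially"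
          using eventually_ge_at_top[of 1]
        proof eventually_elim
          case (elim j)
          then have "(R j / c) powr 1 = R j / c"
            using R c by (simp add: less_imp_le)
          then show ?case
            by (simp only: R_def)
        qed
      qed
      show "m j = nat \<lceil>real j powr ((1 + t) / 2)\<rceil>" for j
        by (rule m_def)
      show "(j choose m j) \<le> index_count a b j (R j)" if j: "j \<ge> 1" for j
      proof -
        have "(j choose m j) = card {T. T \<subseteq> {1..j} \<and> card T = m j}"
          by (simp add: n_subsets)
        also have "\<dots> \<le> index_count a b j (R j)"
        proof (rule card_le_index_count)
          show "real (m j) * a j < R j"
            using R[OF j] by (simp add: R_def)
        qed (use apos[OF j] a_mono fin in auto)
        finally show ?thesis .
      qed
    qed
  qed
  have part2: "EC_WT n s t \<longleftrightarrow> (\<lambda>j. real j powr ((1 - s) / s) / a j) \<longlonglongrightarrow> 0"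
    if s: "0 < s" "s < 1" and t: "0 < t" "t \<le> 1" for s t
  proof
    assume lim: "(\<lambda>j. real j powr ((1 - s) / s) / a j) \<longlonglongrightarrow> 0"
    show "EC_WT n s t"
    proof (rule sufficient)
      fix \<eta> :: real
      assume \<eta>: "\<eta> > 0"
      show "\<exists>C. \<forall>R>0. \<forall>d. ln (real (index_count a b d R)) \<le> \<eta> * R powr s + C"
        by (rule ln_index_count_le_powr[OF a_min assms(3) \<beta> b s lim \<eta>])
    qed (use s t in auto)
  next
    assume EC: "EC_WT n s t"
    define R where "R j = 2 * real j * a j" for j
    have R: "R j > 0" if "j \<ge> 1" for j
      using apos[OF that] that by (simp add: R_def)
    show "(\<lambda>j. real j powr ((1 - s) / s) / a j) \<longlonglongrightarrow> 0"
    proof (rule powr_over_weight_tendsto_zero[where a = a and s = s and t = t and c = c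
          and N = "\<lambda>j. index_count a b j (R j)", OF apos s t(2) c])
      show "(\<lambda>j. ln (real (index_count a b j (R j))) / ((2 * real j * a j / c) powr s + real j powr t)) \<longlonglongrightarrow> 0"
        using necessary[OF EC R] by (simp add: R_def)
      show "2 ^ j \<le> index_count a b j (R j)" if j: "j \<ge> 1" for j
      proof -
        have "2 ^ j = card (Pow {1..j})"
          by (simp add: card_Pow)
        also have "\<dots> \<le> index_count a b j (R j)"
        proof (rule card_le_index_count)
          show "real j * a j < R j"
            using R[OF j] by (simp add: R_def)
          show "card T \<le> j" if "T \<in> Pow {1..j}" for T
            using that card_mono[of "{1..j}" T] by simp
        qed (use apos[OF j] a_mono fin in auto)
        finally show ?thesis .
      qed
    qed
  qed
  show ?thesis
    using part1 part2 unfolding n_def by blast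
qed

end
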